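(* Fix an integer $g\ge 2$, and let $k(x)$ be a positive-integer-valued function with $k(x)\to\infty$ as $x\to\infty$. Then the number of integers $n\le x$ for which all $g$ base-$g$ digits $0,1,\dots,g-1$ appear among the last (i.e., rightmost, least significant) $k(x)$ digits of the base-$g$ expansion of $s(n)$ is $(1+o(1))x$ as $x\to\infty$. Moreover, the same result holds for the first (i.e., leftmost, most significant) $k(x)$ digits: the number of integers $n\le x$ for which all $g$ base-$g$ digits appear among the first $k(x)$ digits of the base-$g$ expansion of $s(n)$ is $(1+o(1))x$ as $x\to\infty$.
   Context: For a positive integer $n$, $s(n)=\sum_{d\mid n,\ d<n} d=\sigma(n)-n$ denotes the sum of the proper divisors of $n$. The base-$g$ expansion is the usual one without leading zeros. If $s(n)$ has fewer than $k(x)$ base-$g$ digits, the "first (or last) $k(x)$ digits" means all of its digits. *)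

theory Defs
  imports Complex_Main "HOL-Library.Landau_Symbols"
begin

definition sum_proper_divisors :: "nat \<Rightarrow> nat" where
  "sum_proper_divisors n = (\<Sum>d | d dvd n \<and> d < n. d)"

(* Base-g expansion, most significant digit first, without leading zeros; the expansion of 0 is
   the single digit 0. The test g < 2 only serves to make the recursion terminate. *)
function base_expansion :: "nat \<Rightarrow> nat \<Rightarrow> nat list" where
  "base_expansion g n =
     (if g < 2 \<or> n < g then [n] else base_expansion g (n div g) @ [n mod g])"
  by auto
termination
  by (relation "measure snd") auto

declare base_expansion.simps [simp del]

(* If there are fewer than k digits, both of the following return all of them. *)
definition first_digits :: "nat \<Rightarrow> nat \<Rightarrow> nat \<Rightarrow> nat list" where
  "first_digits g k n = take k (base_expansion g n)"

definition last_digits :: "nat \<Rightarrow> nat \<Rightarrow> nat \<Rightarrow> nat list" where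
  "last_digits g k n = drop (length (base_expansion g n) - k) (base_expansion g n)"

lemma horner_sum_base_expansion:
  "horner_sum (\<lambda>d. d) g (rev (base_expansion g n)) = n"
proof (induction g n rule: base_expansion.induct)
  case (1 g n)
  then show ?case
    by (subst base_expansion.simps) (auto simp: ac_simps)
qed

lemma base_expansion_digit_less:
  assumes "g \<ge> 2" "d \<in> set (base_expansion g n)"
  shows "d < g"
  using assms
proof (induction g n rule: base_expansion.induct)
  case (1 g n)
  show ?case
    using 1 base_expansion.simps[of g n] by (auto split: if_splits)
qed

lemma hd_base_expansion:
  assumes "g \<ge> 2" "n > 0"
  shows "base_expansion g n \<noteq> [] \<and> hd (base_expansion g n) \<noteq> 0"
  using assms
proof (induction g n rule: base_expansion.induct)
  case (1 g n)
  show ?case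
  proof (cases "n < g")
    case True
    then show ?thesis using 1 by (simp add: base_expansion.simps)
  next
    case False
    then have "n div g > 0" using 1 by (simp add: div_greater_zero_iff)
    then show ?thesis using 1 False by (simp add: base_expansion.simps[of g n])
  qed
qed

end

theory Submission
  imports Defs "HOL-Number_Theory.Number_Theory" "HOL-Computational_Algebra.Nth_Powers"
begin

text \<open>
  Fix the number \<open>K\<close> of digits; monotonicity in \<open>k(x)\<close> reduces both claims to showing that the upper
  density of the bad \<open>n\<close> tends to 0 as \<open>K\<close> grows.

  For the last digits, let \<open>q\<close> be a prime divisor of \<open>g\<close>. By Dirichlet's theorem the primes
  \<open>p \<equiv> -1\<close> modulo \<open>q\<close> have divergent reciprocal sum, so by Turan's variance argument almost all \<open>n\<close>
  have many such primes as exact divisors, each contributing a factor \<open>p + 1\<close> to \<open>\<sigma>(n)\<close>. Hence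
  \<open>g\<^sup>K\<close> divides \<open>\<sigma>(n)\<close> and \<open>s(n) \<equiv> -n\<close> modulo \<open>g\<^sup>K\<close> for almost all \<open>n\<close>, and the last \<open>K\<close> digits are
  equidistributed. Only prime moduli are needed, whose characters come from a primitive root;
  Dirichlet's theorem is proved by Shapiro's elementary method, with Monsky's argument for
  \<open>L(1, \<chi>) \<noteq> 0\<close> for real \<open>\<chi>\<close>.

  For the first digits, \<open>s(n) / n\<close> is up to a small error the sum of \<open>1 / d\<close> over the divisors
  \<open>1 < d \<le> y\<close> of \<open>n\<close>, which only depends on \<open>n\<close> modulo \<open>y!\<close>. So on each residue class \<open>s(n)\<close> is
  essentially a constant multiple of \<open>n\<close>, and the bad \<open>n\<close> lie in few short intervals.
\<close>

section \<open>Sums over divisors\<close>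

text \<open>Both halves must guard against integers with \<open>s(n)\<close> tiny compared to
  \<open>n\<close>, such as primes, where \<open>s(n) = 1\<close>. Discarding the integers without a
  prime factor up to some fixed \<open>D\<close> costs arbitrarily little density and leaves
  \<open>s(n) \<ge> n div D\<close>. For the last digits this makes \<open>s(n)\<close> so long that
  its residue modulo \<open>g ^ K\<close> really lists its last \<open>K\<close> digits, zeros
  included; for the first digits it keeps the truncated sum of \<open>1 / d\<close> at least
  \<open>1 / D\<close>, so that a small absolute error is also a small relative one.

  Prime moduli suffice because a prime \<open>p\<close> need only supply a single factor
  \<open>q\<close> through \<open>p + 1\<close>: \<open>k\<close> such exact divisors give
  \<open>q ^ k\<close>, and the prime powers in \<open>g ^ K\<close> are treated one at a time. The
  primes are taken large so that few integers are divisible by the square of one of them; hence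
  Dirichlet's theorem is needed with an arbitrarily large reciprocal sum beyond any prescribed
  point.

  The parameters \<open>K\<close>, \<open>D\<close>, \<open>y\<close> are fixed before
  \<open>N\<close> grows, so every count has the form \<open>a * N + b\<close> with \<open>b\<close>
  arbitrary, and no uniformity is required.\<close>

lemma sum_divisors_swap:
  fixes F :: "nat \<Rightarrow> nat \<Rightarrow> 'a::comm_monoid_add"
  shows "(\<Sum>n=1..N. \<Sum>d | d dvd n. F d (n div d)) = (\<Sum>d=1..N. \<Sum>m=1..N div d. F d m)"
proof -
  have "(\<Sum>n=1..N. \<Sum>d | d dvd n. F d (n div d))
      = (\<Sum>(n, d)\<in>Sigma {1..N} (\<lambda>n. {d. d dvd n}). F d (n div d))"
    by (subst sum.Sigma) auto
  also have "\<dots> = (\<Sum>(d, m)\<in>Sigma {1..N} (\<lambda>d. {1..N div d}). F d m)"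
  proof (rule sum.reindex_bij_witness[of _ "\<lambda>(d, m). (d * m, d)" "\<lambda>(n, d). (d, n div d)"], goal_cases)
    case (1 a)
    then show ?case by auto
  next
    case (2 a)
    then obtain n d where "a = (n, d)" "n \<ge> 1" "n \<le> N" "d dvd n" by auto
    then show ?case
      by (auto simp: Suc_le_eq div_le_mono dvd_imp_le dest: dvd_imp_le intro: Nat.gr0I)
  next
    case (3 b)
    then show ?case by auto
  next
    case (4 b)
    then obtain d m where "b = (d, m)" "d \<ge> 1" "d \<le> N" "m \<ge> 1" "m \<le> N div d" by auto
    then show ?case by (auto simp: less_eq_div_iff_mult_less_eq mult.commute)
  next
    case (5 a)
    then show ?case by auto
  qed
  also have "\<dots> = (\<Sum>d=1..N. \<Sum>m=1..N div d. F d m)"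
    by (subst sum.Sigma) auto
  finally show ?thesis .
qed

text \<open>Splitting off one prime power at a time takes the place of a theory of multiplicative
  functions: it serves the Moebius function, the coefficients \<open>c\<close> of Monsky's argument,
  and the factor \<open>p + 1\<close> of the divisor sum.\<close>

lemma sum_divisors_prime_power_mult:
  fixes f :: "nat \<Rightarrow> 'a::comm_monoid_add"
  assumes "prime p" "\<not> p dvd m"
  shows "(\<Sum>d | d dvd p ^ k * m. f d) = (\<Sum>i\<le>k. \<Sum>d | d dvd m. f (p ^ i * d))"
proof -
  have p: "p > 0" using assms(1) by (simp add: prime_gt_0_nat)
  have "m > 0" using assms(2) by (auto intro: Nat.gr0I)
  have img: "{d. d dvd p ^ k * m} = (\<lambda>(i, d). p ^ i * d) ` ({..k} \<times> {d. d dvd m})"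
  proof safe
    fix d assume "d dvd p ^ k * m"
    then obtain a b where ab: "d = a * b" "a dvd p ^ k" "b dvd m"
      by (metis division_decomp)
    from ab(2) obtain i where "i \<le> k" "a = p ^ i"
      using assms(1) divides_primepow_nat by blast
    then show "d \<in> (\<lambda>(i, d). p ^ i * d) ` ({..k} \<times> {d. d dvd m})"
      using ab by auto
  next
    fix i d :: nat assume "i \<le> k" "d dvd m"
    then show "p ^ i * d dvd p ^ k * m" by (intro mult_dvd_mono le_imp_power_dvd)
  qed
  have inj: "inj_on (\<lambda>(i, d). p ^ i * d) ({..k} \<times> {d. d dvd m})"
  proof (rule inj_onI, clarify)
    fix i d i' d' assume *: "d dvd m" "d' dvd m" "p ^ i * d = p ^ i' * d'"
    have nd: "\<not> p dvd d" "\<not> p dvd d'" "d \<noteq> 0" "d' \<noteq> 0"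
      using * assms(2) \<open>m > 0\<close> by (auto dest: dvd_trans)
    have "multiplicity p (p ^ i * d) = i" "multiplicity p (p ^ i' * d') = i'"
      using nd p assms(1)
      by (simp_all add: prime_elem_multiplicity_mult_distrib multiplicity_same_power
          not_dvd_imp_multiplicity_0)
    then have "i = i'" using * by simp
    then show "i = i' \<and> d = d'" using * p by auto
  qed
  have "(\<Sum>d | d dvd p ^ k * m. f d) = (\<Sum>(i, d)\<in>{..k} \<times> {d. d dvd m}. f (p ^ i * d))"
    unfolding img by (subst sum.reindex[OF inj]) (simp add: case_prod_unfold)
  also have "\<dots> = (\<Sum>i\<le>k. \<Sum>d | d dvd m. f (p ^ i * d))"
    by (subst sum.cartesian_product) auto
  finally show ?thesis .
qed

lemma prime_power_cofactor:
  fixes n :: nat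
  assumes "n > 1"
  obtains p k m where "prime p" "\<not> p dvd m" "n = p ^ Suc k * m" "0 < m" "m < n"
proof -
  obtain p where p: "prime p" "p dvd n" using assms prime_factor_nat by (metis less_irrefl_nat)
  obtain m where m: "n = p ^ multiplicity p n * m" "\<not> p dvd m"
    using multiplicity_decompose'[of n p] assms p by (auto simp: prime_nat_iff)
  have "multiplicity p n > 0" using p assms by (simp add: prime_multiplicity_gt_zero_iff)
  then obtain k where k: "multiplicity p n = Suc k" by (cases "multiplicity p n") auto
  have "m > 0" using m(2) by (auto intro: Nat.gr0I)
  have "p ^ Suc k > 1" using p(1) prime_gt_1_nat one_less_power by blast
  then have "m < p ^ Suc k * m" using \<open>m > 0\<close> by simp
  then show ?thesis using that[of p m k] p m k \<open>m > 0\<close> by metis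
qed

section \<open>The Moebius function and its inversion of the logarithm\<close>

definition moebius :: "nat \<Rightarrow> real" where
  "moebius n = (if \<exists>p. prime p \<and> p\<^sup>2 dvd n then 0 else (-1) ^ card (prime_factors n))"

lemma abs_moebius_le: "\<bar>moebius n\<bar> \<le> 1"
  by (simp add: moebius_def power_abs)

lemma moebius_1 [simp]: "moebius (Suc 0) = 1"
  by (auto simp: moebius_def prime_nat_iff)

lemma moebius_prime_mult:
  assumes "prime p" "\<not> p dvd d"
  shows "moebius (p * d) = - moebius d"
proof -
  have d0: "d \<noteq> 0" using assms(2) by (auto intro: Nat.gr0I)
  have pf: "prime_factors (p * d) = insert p (prime_factors d)"
    using assms(1) d0 by (simp add: prime_factorization_mult prime_factorization_prime)
  have "p \<notin> prime_factors d" using assms(2) by auto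
  then have card: "card (prime_factors (p * d)) = Suc (card (prime_factors d))"
    unfolding pf by simp
  have "(\<exists>r. prime r \<and> r\<^sup>2 dvd p * d) \<longleftrightarrow> (\<exists>r. prime r \<and> r\<^sup>2 dvd d)"
  proof safe
    fix r assume r: "prime r" "r\<^sup>2 dvd p * d"
    have "r \<noteq> p"
    proof
      assume "r = p"
      then have "p * p dvd p * d" using r by (simp add: power2_eq_square)
      then show False using assms by (simp add: prime_nat_iff)
    qed
    then have "coprime (r\<^sup>2) p" using r(1) assms(1) by (simp add: primes_coprime)
    then show "\<exists>r. prime r \<and> r\<^sup>2 dvd d" using r by (auto simp: coprime_dvd_mult_right_iff)
  qed auto
  then show ?thesis unfolding moebius_def card by auto
qed

lemma moebius_sum:
  assumes "n > 0"
  shows "(\<Sum>d | d dvd n. moebius d) = (if n = 1 then 1 else 0)"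
proof (cases "n = 1")
  case False
  then obtain p k m where n: "prime p" "\<not> p dvd m" "n = p ^ Suc k * m"
    using prime_power_cofactor[of n] assms by (metis nat_neq_iff less_one)
  have z: "moebius (p ^ i * d) = 0" if "i \<ge> 2" for i d
    using n(1) that unfolding moebius_def
    by (meson dvd_mult2 le_imp_power_dvd)
  have "(\<Sum>d | d dvd n. moebius d) = (\<Sum>i\<le>Suc k. \<Sum>d | d dvd m. moebius (p ^ i * d))"
    unfolding n(3) by (rule sum_divisors_prime_power_mult[OF n(1,2)])
  also have "\<dots> = (\<Sum>i\<in>{0,1}. \<Sum>d | d dvd m. moebius (p ^ i * d))"
    by (rule sum.mono_neutral_right) (auto simp: z)
  also have "\<dots> = (\<Sum>d | d dvd m. moebius d + moebius (p * d))"
    by (simp add: sum.distrib)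
  also have "\<dots> = 0"
  proof (intro sum.neutral ballI)
    fix d assume "d \<in> {d. d dvd m}"
    then have "\<not> p dvd d" using n(2) dvd_trans by blast
    then show "moebius d + moebius (p * d) = 0" using n(1) by (simp add: moebius_prime_mult)
  qed
  finally show ?thesis using False by simp
qed auto

text \<open>Writing \<open>ln (x / d)\<close> as \<open>ln (n / d) + ln (x / n)\<close>, the first
  part is Moebius inversion of \<open>ln\<close> as a divisor sum of \<open>mangoldt\<close>, and
  the second is killed by \<open>moebius_sum\<close> unless \<open>n = 1\<close>. The free
  \<open>x\<close> is what lets Shapiro's method use the weight \<open>ln (N / d)\<close> for all
  \<open>n \<le> N\<close> at once.\<close>

lemma moebius_sum_ln:
  fixes x :: real
  assumes "n > 0" "x > 0"
  shows "(\<Sum>d | d dvd n. moebius d * ln (x / d)) = mangoldt n + (if n = 1 then ln x else 0)"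
proof -
  have fin: "finite {d. d dvd n}" using assms by auto
  have pos: "d > 0" if "d dvd n" for d using that assms by (auto intro: Nat.gr0I)
  have "(\<Sum>d | d dvd n. moebius d * ln (n div d)) = 
        (\<Sum>d | d dvd n. \<Sum>e | e dvd n div d. moebius d * mangoldt e)"
    using assms mangoldt_sum[where ?'a = real]
    by (intro sum.cong refl) (auto simp: sum_distrib_left[symmetric] dvd_div_eq_0_iff)
  also have "\<dots> = (\<Sum>(d, e)\<in>Sigma {d. d dvd n} (\<lambda>d. {e. e dvd n div d}). moebius d * mangoldt e)"
    using assms by (subst sum.Sigma) (auto simp: dvd_div_eq_0_iff)
  also have "\<dots> = (\<Sum>(e, d)\<in>Sigma {e. e dvd n} (\<lambda>e. {d. d dvd n div e}). moebius d * mangoldt e)"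
  proof (rule sum.reindex_bij_witness[of _ prod.swap prod.swap], goal_cases)
    case (2 a)
    then show ?case using assms
      by (auto simp: dvd_div_iff_mult pos mult.commute dest: pos dvd_mult_left dvd_mult_right)
  next
    case (4 a)
    then show ?case using assms
      by (auto simp: dvd_div_iff_mult pos mult.commute dest: pos dvd_mult_left dvd_mult_right)
  qed auto
  also have "\<dots> = (\<Sum>e | e dvd n. \<Sum>d | d dvd n div e. moebius d * mangoldt e)"
    using assms by (subst sum.Sigma) (auto simp: dvd_div_eq_0_iff)
  also have "\<dots> = (\<Sum>e | e dvd n. (if e = n then mangoldt e else 0))"
  proof (rule sum.cong[OF refl])
    fix e assume e: "e \<in> {e. e dvd n}"
    then have "n div e > 0" using assms by (auto intro!: Nat.gr0I simp: dvd_div_eq_0_iff)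
    moreover have "n div e = 1 \<longleftrightarrow> e = n"
      using e assms by (metis div_self dvd_mult_div_cancel mem_Collect_eq mult.right_neutral not_gr0)
    ultimately show "(\<Sum>d | d dvd n div e. moebius d * mangoldt e) = (if e = n then mangoldt e else 0)"
      by (simp add: sum_distrib_right[symmetric] moebius_sum)
  qed
  also have "\<dots> = mangoldt n" using fin by (simp add: sum.delta)
  finally have A: "(\<Sum>d | d dvd n. moebius d * ln (n div d)) = mangoldt n" .
  have "(\<Sum>d | d dvd n. moebius d * ln (x / d)) =
        (\<Sum>d | d dvd n. moebius d * ln (n div d) + moebius d * ln (x / n))"
  proof (rule sum.cong[OF refl])
    fix d assume d: "d \<in> {d. d dvd n}"
    then have "real (n div d) = n / d" by (simp add: real_of_nat_div)
    then have "ln (x / d) = ln (n div d) + ln (x / n)"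
      using pos d assms by (simp add: ln_div)
    then show "moebius d * ln (x / d) = moebius d * ln (n div d) + moebius d * ln (x / n)"
      by (simp add: distrib_left)
  qed
  also have "\<dots> = mangoldt n + (\<Sum>d | d dvd n. moebius d) * ln (x / n)"
    by (simp only: sum.distrib A sum_distrib_right)
  finally show ?thesis using moebius_sum[OF assms(1)] by simp
qed

section \<open>Legendre's formula in logarithmic form, and a weak Stirling bound\<close>

lemma sum_mangoldt_div: "(\<Sum>d=1..N. mangoldt d * real (N div d)) = ln (fact N)"
proof -
  have "(\<Sum>d=1..N. mangoldt d * real (N div d)) = (\<Sum>d=1..N. \<Sum>m=1..N div d. mangoldt d)"
    by (simp add: mult.commute)
  also have "\<dots> = (\<Sum>n=1..N. \<Sum>d | d dvd n. mangoldt d)"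
    by (rule sum_divisors_swap[symmetric])
  also have "\<dots> = (\<Sum>n=1..N. ln (real n))"
    using mangoldt_sum[where ?'a = real] by (intro sum.cong) auto
  also have "\<dots> = ln (fact N)"
    unfolding fact_prod of_nat_prod by (subst ln_prod) auto
  finally show ?thesis .
qed

lemma ln_fact_ge: "ln (fact N) \<ge> real N * ln N - N"
proof (induction N)
  case (Suc N)
  show ?case
  proof (cases "N = 0")
    case False
    have "ln (real (Suc N)) - ln N = ln (1 + 1 / N)"
      using False ln_div[of "real (Suc N)" "real N"] by (simp add: field_simps)
    also have "\<dots> \<le> 1 / N" by (rule ln_add_one_self_le_self) simp
    finally have "N * (ln (real (Suc N)) - ln N) \<le> 1"
      using False by (simp add: field_simps)
    moreover have "ln (fact (Suc N)) = ln (real (Suc N)) + ln (fact N)"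
      by (simp add: ln_mult del: of_nat_Suc)
    ultimately show ?thesis using Suc by (simp add: algebra_simps)
  qed simp
qed simp

lemma ln_fact_le: "ln (fact N) \<le> real N * ln N"
proof (cases "N = 0")
  case False
  have "(fact N :: real) \<le> real N ^ N"
    by (metis fact_le_power of_nat_fact of_nat_le_iff of_nat_power order_refl)
  then have "ln (fact N) \<le> ln (real N ^ N)"
    using False by (subst ln_le_cancel_iff) auto
  then show ?thesis using False by (simp add: ln_realpow)
qed auto

section \<open>Chebyshev and Mertens bounds, and sums over a bounded character\<close>

lemma sum_interval_split:
  fixes f :: "nat \<Rightarrow> 'a::comm_monoid_add"
  assumes "M \<le> N"
  shows "(\<Sum>n=1..N. f n) = (\<Sum>n=1..M. f n) + (\<Sum>n\<in>{M<..N}. f n)"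
proof -
  have "{1..N} = {1..M} \<union> {M<..N}" "{1..M} \<inter> {M<..N} = {}" using assms by auto
  then show ?thesis by (metis finite_atLeastAtMost finite_greaterThanAtMost sum.union_disjoint)
qed

definition chebyshev_psi :: "nat \<Rightarrow> real" where
  "chebyshev_psi N = (\<Sum>d=1..N. mangoldt d)"

text \<open>Chebyshev's argument: \<open>2 * n div d - 2 * (n div d)\<close> is never negative and
  is at least 1 for \<open>n < d \<le> 2 * n\<close>, so the primes powers in that range are paid
  for by the logarithm of the central binomial coefficient.\<close>

lemma chebyshev_psi_double: "chebyshev_psi (2 * n) \<le> chebyshev_psi n + n * ln 4"
proof -
  have "chebyshev_psi (2 * n) - chebyshev_psi n = (\<Sum>d\<in>{n<..2*n}. mangoldt d)"
    unfolding chebyshev_psi_def by (subst sum_interval_split[of n "2 * n"]) auto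
  also have "\<dots> \<le> (\<Sum>d=1..2*n. mangoldt d * (real (2 * n div d) - 2 * real (n div d)))"
  proof -
    have "(\<Sum>d\<in>{n<..2*n}. mangoldt d) \<le>
          (\<Sum>d\<in>{n<..2*n}. mangoldt d * (real (2 * n div d) - 2 * real (n div d)))"
    proof (rule sum_mono)
      fix d assume d: "d \<in> {n<..2*n}"
      then have "2 * n div d \<ge> 1" by (auto simp: Suc_le_eq div_greater_zero_iff)
      then have "real (2 * n div d) - 2 * real (n div d) \<ge> 1" using d by simp
      then show "mangoldt d \<le> mangoldt d * (real (2 * n div d) - 2 * real (n div d))"
        using mangoldt_nonneg[of d] by (metis mult_left_mono mult.right_neutral)
    qed
    also have "\<dots> \<le> (\<Sum>d=1..2*n. mangoldt d * (real (2 * n div d) - 2 * real (n div d)))"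
    proof (rule sum_mono2)
      fix d assume "d \<in> {1..2*n} - {n<..2*n}"
      then have "2 * (n div d) \<le> 2 * n div d"
        by (subst less_eq_div_iff_mult_less_eq) auto
      then have "real (2 * n div d) - 2 * real (n div d) \<ge> 0" by linarith
      then show "0 \<le> mangoldt d * (real (2 * n div d) - 2 * real (n div d))"
        using mangoldt_nonneg[of d] by simp
    qed auto
    finally show ?thesis .
  qed
  also have "\<dots> = ln (fact (2 * n)) - 2 * (\<Sum>d=1..2*n. mangoldt d * real (n div d))"
    unfolding sum_mangoldt_div[symmetric] sum_distrib_left sum_subtractf[symmetric]
    by (rule sum.cong) (auto simp: algebra_simps)
  also have "(\<Sum>d=1..2*n. mangoldt d * real (n div d)) = (\<Sum>d=1..n. mangoldt d * real (n div d))"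
    by (rule sum.mono_neutral_right) auto
  also have "\<dots> = ln (fact n)" by (rule sum_mangoldt_div)
  also have "ln (fact (2 * n)) - 2 * ln (fact n) = ln (real (2 * n choose n))"
    using binomial_fact[of n "2 * n", where ?'a = real] by (simp add: ln_div ln_mult)
  also have "\<dots> \<le> ln (4 ^ n)"
  proof -
    have "2 * n choose n \<le> 2 ^ (2 * n)" by (rule binomial_le_pow2)
    also have "\<dots> = 4 ^ n" by (simp add: power_mult)
    finally have "real (2 * n choose n) \<le> 4 ^ n" by (metis of_nat_le_iff of_nat_numeral of_nat_power)
    moreover have "2 * n choose n > 0" by simp
    ultimately show ?thesis by (subst ln_le_cancel_iff) auto
  qed
  also have "\<dots> = n * ln 4" by (simp add: ln_realpow)
  finally show ?thesis by simp
qed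

lemma chebyshev_psi_mono: "m \<le> n \<Longrightarrow> chebyshev_psi m \<le> chebyshev_psi n"
  unfolding chebyshev_psi_def by (rule sum_mono2) (auto simp: mangoldt_nonneg)

lemma chebyshev_psi_le: "chebyshev_psi n \<le> 3 * ln 4 * n"
proof (induction n rule: less_induct)
  case (less n)
  show ?case
  proof (cases "n \<le> 1")
    case True
    then have "n = 0 \<or> n = 1" by auto
    then show ?thesis by (auto simp: chebyshev_psi_def)
  next
    case False
    \<comment> \<open>For \<open>n \<ge> 2\<close> rounding \<open>n / 2\<close> up gives at most
      \<open>3 / 4 * n\<close>. Doubling adds one \<open>ln 4\<close> to the inductive
      \<open>3 * ln 4\<close>, and \<open>4 * (3 / 4) = 3\<close> closes the induction.\<close>
    define m where "m = (n + 1) div 2"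
    have m: "m < n" "n \<le> 2 * m" "real m \<le> (3 / 4) * n" using False by (auto simp: m_def)
    have "chebyshev_psi n \<le> chebyshev_psi (2 * m)" by (rule chebyshev_psi_mono) (use m in auto)
    also have "\<dots> \<le> chebyshev_psi m + m * ln 4" by (rule chebyshev_psi_double)
    also have "\<dots> \<le> 4 * ln 4 * m" using less.IH[OF m(1)] by (simp only: algebra_simps)
    also have "\<dots> \<le> 4 * ln 4 * ((3 / 4) * n)" using m(3) by (intro mult_left_mono) auto
    finally show ?thesis by (simp add: mult_ac)
  qed
qed

lemma real_less_mult_div: "d > 0 \<Longrightarrow> real N < real d * (real (N div d) + 1)"
proof -
  assume "d > 0"
  then have "N < d * (N div d + 1)"
    by (metis Suc_eq_plus1 dividend_less_times_div mult_Suc_right add.commute)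
  then have "real N < real (d * (N div d + 1))" by (simp only: of_nat_less_iff)
  then show ?thesis by (simp add: algebra_simps)
qed

lemma mertens_lower: "N > 0 \<Longrightarrow> (\<Sum>d=1..N. mangoldt d / d) \<ge> ln N - 1"
proof -
  assume N: "N > 0"
  have "real N * ln N - N \<le> ln (fact N)" by (rule ln_fact_ge)
  also have "\<dots> = (\<Sum>d=1..N. mangoldt d * real (N div d))" by (rule sum_mangoldt_div[symmetric])
  also have "\<dots> \<le> (\<Sum>d=1..N. mangoldt d * (real N / d))"
    by (intro sum_mono mult_left_mono) (auto simp: mangoldt_nonneg of_nat_div_le_of_nat)
  also have "\<dots> = N * (\<Sum>d=1..N. mangoldt d / d)"
    by (simp add: sum_distrib_left mult_ac)
  finally have "N * (ln N - 1) \<le> N * (\<Sum>d=1..N. mangoldt d / d)"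
    by (simp add: algebra_simps)
  then show ?thesis using N by simp
qed

text \<open>Unlike in the lower bound, replacing \<open>N / d\<close> by \<open>N div d\<close> goes
  the wrong way; it costs at most \<open>chebyshev_psi N\<close>, which is linear in
  \<open>N\<close>.\<close>

lemma mertens_upper: "N > 0 \<Longrightarrow> (\<Sum>d=1..N. mangoldt d / d) \<le> ln N + 3 * ln 4"
proof -
  assume N: "N > 0"
  have "N * (\<Sum>d=1..N. mangoldt d / d) = (\<Sum>d=1..N. mangoldt d * (real N / d))"
    by (simp add: sum_distrib_left mult_ac)
  also have "\<dots> \<le> (\<Sum>d=1..N. mangoldt d * (real (N div d) + 1))"
  proof (intro sum_mono mult_left_mono)
    fix d assume "d \<in> {1..N}"
    then show "real N / d \<le> real (N div d) + 1"
      using real_less_mult_div[of d N] by (simp add: field_simps)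
  qed (auto simp: mangoldt_nonneg)
  also have "\<dots> = ln (fact N) + chebyshev_psi N"
    by (simp add: distrib_left sum.distrib sum_mangoldt_div[symmetric] chebyshev_psi_def)
  also have "\<dots> \<le> real N * ln N + 3 * ln 4 * N"
    by (intro add_mono ln_fact_le chebyshev_psi_le)
  also have "\<dots> = N * (ln N + 3 * ln 4)" by (simp add: algebra_simps)
  finally show ?thesis using N by simp
qed

section \<open>Abel summation, and Shapiro's method for \<open>L(1, \<chi>)\<close>\<close>

lemma norm_sum_decreasing_le:
  fixes b :: "nat \<Rightarrow> 'a::real_normed_vector" and a :: "nat \<Rightarrow> real"
  assumes bnd: "\<And>n. norm (\<Sum>i<n. b i) \<le> C"
    and dec: "\<And>i. a (Suc i) \<le> a i" and nn: "\<And>i. a i \<ge> 0"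
  shows "norm (\<Sum>i<N. a i *\<^sub>R b i) \<le> C * a 0"
proof -
  define B where "B n = (\<Sum>i<n. b i)" for n
  have "(\<Sum>i<N. a i *\<^sub>R b i) = a N *\<^sub>R B N + (\<Sum>i<N. (a i - a (Suc i)) *\<^sub>R B (Suc i))"
    by (induction N) (auto simp: B_def algebra_simps)
  also have "norm \<dots> \<le> a N * C + (\<Sum>i<N. (a i - a (Suc i)) * C)"
  proof (rule order_trans[OF norm_triangle_ineq], intro add_mono)
    show "norm (a N *\<^sub>R B N) \<le> a N * C"
      using bnd[of N] nn[of N] by (auto simp: B_def intro!: mult_left_mono)
    show "norm (\<Sum>i<N. (a i - a (Suc i)) *\<^sub>R B (Suc i)) \<le> (\<Sum>i<N. (a i - a (Suc i)) * C)"
    proof (rule order_trans[OF norm_sum], rule sum_mono)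
      fix i
      have "norm (B (Suc i)) \<le> C" unfolding B_def by (rule bnd)
      then show "norm ((a i - a (Suc i)) *\<^sub>R B (Suc i)) \<le> (a i - a (Suc i)) * C"
        using dec[of i] by (auto intro!: mult_left_mono)
    qed
  qed
  also have "(\<Sum>i<N. (a i - a (Suc i)) * C) = (a 0 - a N) * C"
    by (induction N) (auto simp: algebra_simps)
  finally show ?thesis by (simp add: algebra_simps)
qed

text \<open>A nonprincipal Dirichlet character as the analytic argument sees it: periodicity enters
  only through the bound \<open>C\<close> on the partial sums, for which the modulus will be
  taken.\<close>

locale bounded_character =
  fixes \<chi> :: "nat \<Rightarrow> complex" and C :: real
  assumes chi_0: "\<chi> 0 = 0" and chi_1: "\<chi> (Suc 0) = 1"
    and chi_mult: "\<And>m n. \<chi> (m * n) = \<chi> m * \<chi> n"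
    and norm_chi_le: "\<And>n. norm (\<chi> n) \<le> 1"
    and norm_sum_chi_le: "\<And>n. norm (\<Sum>i<n. \<chi> i) \<le> C"
begin

lemma C_nonneg: "C \<ge> 0"
  using norm_sum_chi_le[of 0] by simp

lemma norm_sum_chi_interval_le:
  fixes a :: "nat \<Rightarrow> real"
  assumes dec: "\<And>i. i > M \<Longrightarrow> a (Suc i) \<le> a i" and nn: "\<And>i. i > M \<Longrightarrow> a i \<ge> 0"
  shows "norm (\<Sum>i\<in>{M<..N}. of_real (a i) * \<chi> i) \<le> 2 * C * a (Suc M)"
proof -
  have "(\<Sum>i\<in>{M<..N}. of_real (a i) * \<chi> i) = (\<Sum>i<N-M. a (Suc M + i) *\<^sub>R \<chi> (Suc M + i))"
    by (rule sum.reindex_bij_witness[of _ "\<lambda>i. Suc M + i" "\<lambda>i. i - Suc M"])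
       (auto simp: scaleR_conv_of_real)
  also have "norm \<dots> \<le> (2 * C) * a (Suc M + 0)"
  proof (rule norm_sum_decreasing_le)
    fix n
    have "(\<Sum>i<n. \<chi> (Suc M + i)) = (\<Sum>i<Suc M + n. \<chi> i) - (\<Sum>i<Suc M. \<chi> i)"
      by (simp only: sum.nat_diff_reindex sum.lessThan_Suc) (induction n, auto)
    also have "norm \<dots> \<le> C + C"
      by (rule order_trans[OF norm_triangle_ineq4]) (intro add_mono norm_sum_chi_le)
    finally show "norm (\<Sum>i<n. \<chi> (Suc M + i)) \<le> 2 * C" by simp
  qed (use dec nn in auto)
  finally show ?thesis by simp
qed

definition S :: "nat \<Rightarrow> complex" where
  "S N = (\<Sum>n=1..N. \<chi> n / n)"

text \<open>The value \<open>L(1, \<chi>)\<close>; the limit exists by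
  \<open>S_tendsto_L\<close>.\<close>

definition L :: complex where
  "L = lim S"

lemma norm_S_diff_le:
  assumes "M \<le> N"
  shows "norm (S N - S M) \<le> 2 * C / Suc M"
proof -
  have "S N - S M = (\<Sum>n\<in>{M<..N}. \<chi> n / n)"
    unfolding S_def by (subst sum_interval_split[OF assms]) auto
  also have "\<dots> = (\<Sum>n\<in>{M<..N}. of_real (1 / n) * \<chi> n)"
    by (rule sum.cong) auto
  also have "norm \<dots> \<le> 2 * C * (1 / Suc M)"
    by (rule norm_sum_chi_interval_le) (auto simp: frac_le)
  finally show ?thesis by simp
qed

lemma S_tendsto_L: "S \<longlonglongrightarrow> L"
proof -
  have "Cauchy S"
  proof (rule CauchyI')
    fix e :: real assume "e > 0"
    obtain M where M: "real M > 2 * C / e" using reals_Archimedean2 by blast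
    have "2 * C / Suc m < e" if "m \<ge> M" for m
    proof -
      have "2 * C / e < Suc m" using M that by linarith
      then show ?thesis using \<open>e > 0\<close> by (simp add: field_simps)
    qed
    then have "\<forall>m\<ge>M. \<forall>n>m. dist (S m) (S n) < e"
      using norm_S_diff_le by (metis dist_commute dist_norm less_imp_le_nat order_le_less_trans)
    then show "\<exists>M. \<forall>m\<ge>M. \<forall>n>m. dist (S m) (S n) < e" by blast
  qed
  then show ?thesis unfolding L_def
    by (simp add: Cauchy_convergent convergent_LIMSEQ_iff[symmetric])
qed

lemma norm_L_diff_le: "norm (L - S M) \<le> 2 * C / Suc M"
proof (rule tendsto_upperbound)
  show "(\<lambda>N. norm (S N - S M)) \<longlonglongrightarrow> norm (L - S M)"
    by (intro tendsto_intros S_tendsto_L)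
  show "\<forall>\<^sub>F N in sequentially. norm (S N - S M) \<le> 2 * C / Suc M"
    using eventually_ge_at_top[of M] by eventually_elim (rule norm_S_diff_le)
qed auto

text \<open>An error proportional to \<open>d\<close> cancels the \<open>1 / d\<close> in the sums
  below, leaving an average over \<open>d \<le> N\<close> that stays bounded.\<close>

lemma norm_L_diff_div_le:
  assumes "d > 0" "N > 0"
  shows "norm (S (N div d) - L) \<le> 2 * C * d / N"
proof -
  have "norm (S (N div d) - L) \<le> 2 * C / Suc (N div d)"
    using norm_L_diff_le[of "N div d"] by (simp add: norm_minus_commute)
  also have "\<dots> \<le> 2 * C * (d / N)"
  proof -
    have "1 / real (Suc (N div d)) \<le> d / N"
      using real_less_mult_div[OF assms(1), of N] assms by (simp add: field_simps)
    then have "2 * C * (1 / real (Suc (N div d))) \<le> 2 * C * (d / N)"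
      using C_nonneg by (intro mult_left_mono) auto
    then show ?thesis by simp
  qed
  finally show ?thesis by simp
qed

definition T :: "nat \<Rightarrow> complex" where
  "T N = (\<Sum>n=1..N. \<chi> n * mangoldt n / n)"

lemma norm_sum_chi_ln_le: "norm (\<Sum>n=1..N. \<chi> n * ln (real n) / n) \<le> ln 2 / 2 + 2 * C * (ln 3 / 3)"
proof -
  \<comment> \<open>The weight \<open>ln n / n\<close> decreases only from \<open>e\<close> on, so
    Abel summation can start at 3.\<close>
  have eq: "(\<Sum>n=1..N. \<chi> n * ln (real n) / n) =
        (\<Sum>n=1..min 2 N. \<chi> n * ln (real n) / n) + (\<Sum>n\<in>{2<..N}. \<chi> n * ln (real n) / n)"
    by (subst sum.union_disjoint[symmetric]) (auto intro!: sum.cong)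
  have 1: "norm (\<Sum>n=1..min 2 N. \<chi> n * ln (real n) / n) \<le> ln 2 / 2"
  proof -
    have "norm (\<Sum>n=1..min 2 N. \<chi> n * ln (real n) / n) \<le> (\<Sum>n=1..min 2 N. ln (real n) / n)"
    proof (rule order_trans[OF norm_sum], rule sum_mono)
      fix n assume "n \<in> {1..min 2 N}"
      then show "norm (\<chi> n * ln (real n) / n) \<le> ln (real n) / n"
        using norm_chi_le[of n] by (auto simp: norm_mult norm_divide intro!: divide_right_mono mult_left_le_one_le)
    qed
    also have "\<dots> \<le> (\<Sum>n=1..2. ln (real n) / n)"
      by (rule sum_mono2) auto
    also have "{1..2::nat} = {1, 2}" by auto
    finally show ?thesis by simp
  qed
  have "(\<Sum>n\<in>{2<..N}. \<chi> n * ln (real n) / n) = (\<Sum>n\<in>{2<..N}. of_real (ln (real n) / n) * \<chi> n)"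
    by (rule sum.cong) auto
  also have "norm \<dots> \<le> 2 * C * (ln (real (Suc 2)) / real (Suc 2))"
  proof (rule norm_sum_chi_interval_le)
    fix i :: nat assume "i > 2"
    then have "exp 1 \<le> real i" using exp_le by linarith
    then show "ln (real (Suc i)) / real (Suc i) \<le> ln (real i) / real i"
      by (rule ln_x_over_x_mono) simp
  qed auto
  finally have "norm (\<Sum>n\<in>{2<..N}. \<chi> n * ln (real n) / n) \<le> 2 * C * (ln 3 / 3)" by simp
  with 1 show ?thesis unfolding eq by (meson add_mono norm_triangle_ineq order_trans)
qed

text \<open>Expanding \<open>ln\<close> as a divisor sum of \<open>mangoldt\<close> turns the
  bounded sum of \<open>\<chi> n * ln n / n\<close> into a sum of
  \<open>\<chi> d * mangoldt d / d\<close> times \<open>S (N div d)\<close>. Replacing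
  \<open>S (N div d)\<close> by \<open>L\<close> gives \<open>L * T N\<close>, with an error of at
  most \<open>2 * C / N\<close> times \<open>chebyshev_psi N\<close>.\<close>

lemma T_bounded:
  assumes "L \<noteq> 0"
  shows "\<exists>B. \<forall>N. norm (T N) \<le> B"
proof -
  define K where "K = ln 2 / 2 + 2 * C * (ln 3 / 3) + 2 * C * (3 * ln 4)"
  have "norm (T N) \<le> K / norm L" if N: "N > 0" for N
  proof -
    have "(\<Sum>n=1..N. \<chi> n * ln (real n) / n) =
          (\<Sum>n=1..N. \<Sum>d | d dvd n. (\<chi> d * mangoldt d / d) * (\<chi> (n div d) / (n div d)))"
    proof (rule sum.cong[OF refl])
      fix n assume "n \<in> {1..N}"
      then have n: "n > 0" by simp
      have "(\<chi> d * mangoldt d / d) * (\<chi> (n div d) / (n div d)) = \<chi> n / n * mangoldt d"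
        if "d dvd n" for d
      proof -
        have "\<chi> n = \<chi> d * \<chi> (n div d)" "complex_of_nat n = of_nat d * of_nat (n div d)"
          using that by (metis chi_mult dvd_mult_div_cancel, metis of_nat_mult dvd_mult_div_cancel)
        then show ?thesis by simp
      qed
      then have "(\<Sum>d | d dvd n. (\<chi> d * mangoldt d / d) * (\<chi> (n div d) / (n div d))) =
                 \<chi> n / n * (\<Sum>d | d dvd n. mangoldt d)"
        unfolding sum_distrib_left by (intro sum.cong) auto
      also have "\<dots> = \<chi> n * ln (real n) / n"
        using mangoldt_sum[of n, where ?'a = complex] n by simp
      finally show "\<chi> n * ln (real n) / n = 
        (\<Sum>d | d dvd n. (\<chi> d * mangoldt d / d) * (\<chi> (n div d) / (n div d)))" ..
    qed
    also have "\<dots> = (\<Sum>d=1..N. \<Sum>m=1..N div d. (\<chi> d * mangoldt d / d) * (\<chi> m / m))"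
      by (rule sum_divisors_swap)
    also have "\<dots> = (\<Sum>d=1..N. (\<chi> d * mangoldt d / d) * S (N div d))"
      by (simp add: S_def sum_distrib_left)
    also have "\<dots> = L * T N + (\<Sum>d=1..N. (\<chi> d * mangoldt d / d) * (S (N div d) - L))"
      unfolding T_def sum_distrib_left sum.distrib[symmetric]
      by (rule sum.cong) (auto simp: algebra_simps diff_divide_distrib)
    finally have eq: "L * T N = (\<Sum>n=1..N. \<chi> n * ln (real n) / n) -
       (\<Sum>d=1..N. (\<chi> d * mangoldt d / d) * (S (N div d) - L))" by simp
    have "norm (\<Sum>d=1..N. (\<chi> d * mangoldt d / d) * (S (N div d) - L)) \<le> 
          (\<Sum>d=1..N. mangoldt d * (2 * C / N))"
    proof (rule order_trans[OF norm_sum], rule sum_mono)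
      fix d assume d: "d \<in> {1..N}"
      have "norm ((\<chi> d * mangoldt d / d) * (S (N div d) - L)) \<le> (1 * mangoldt d / d) * (2 * C * d / N)"
        unfolding norm_mult norm_divide
        using d N norm_chi_le[of d] mangoldt_nonneg[of d] norm_L_diff_div_le[of d N]
        by (intro mult_mono divide_right_mono) (auto intro!: divide_right_mono mult_left_le_one_le)
      also have "\<dots> = mangoldt d * (2 * C / N)" using d by simp
      finally show "norm ((\<chi> d * mangoldt d / d) * (S (N div d) - L)) \<le> mangoldt d * (2 * C / N)" .
    qed
    also have "\<dots> = chebyshev_psi N * (2 * C / N)" unfolding chebyshev_psi_def sum_distrib_right ..
    also have "\<dots> \<le> (3 * ln 4 * N) * (2 * C / N)"
      using C_nonneg by (intro mult_right_mono chebyshev_psi_le) auto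
    also have "\<dots> = 2 * C * (3 * ln 4)" using N by simp
    finally have "norm (L * T N) \<le> K"
      unfolding eq K_def using norm_sum_chi_ln_le[of N]
      by (meson add_mono norm_triangle_ineq4 order_trans)
    then show ?thesis using assms by (simp add: norm_mult field_simps)
  qed
  moreover have "T 0 = 0" by (simp add: T_def)
  ultimately have "\<forall>N. norm (T N) \<le> max 0 (K / norm L)"
    by (metis le_max_iff_disj norm_zero not_gr0 order_refl)
  then show ?thesis by blast
qed

text \<open>The dual of \<open>T_bounded\<close>, for which \<open>L\<close> cannot be divided out:
  by \<open>moebius_sum_ln\<close> the left side is a sum of \<open>moebius d * ln (N / d)\<close>
  against \<open>S (N div d)\<close>, and \<open>L = 0\<close> makes these values themselves of size
  \<open>d / N\<close>. What remains is \<open>2 * C / N\<close> times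
  \<open>N * ln N - ln (fact N)\<close>, which is at most \<open>2 * C\<close>. So a vanishing
  \<open>L\<close> forces \<open>T N\<close> to behave like \<open>- ln N\<close>.\<close>

lemma T_plus_ln_bounded:
  assumes "L = 0"
  shows "\<exists>B. \<forall>N>0. norm (T N + ln (real N)) \<le> B"
proof (intro exI allI impI)
  fix N :: nat assume N: "N > 0"
  have "T N + ln (real N) = (\<Sum>n=1..N. \<chi> n / n * (mangoldt n + (if n = 1 then ln (real N) else 0)))"
  proof -
    have "(\<Sum>n=1..N. \<chi> n / n * of_real (if n = 1 then ln (real N) else 0)) 
        = (\<Sum>n=1..N. if n = 1 then complex_of_real (ln (real N)) else 0)"
      by (rule sum.cong) (auto simp: chi_1)
    also have "\<dots> = ln (real N)" using N by (subst sum.delta) auto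
    finally show ?thesis by (simp add: T_def distrib_left sum.distrib del: mult_eq_0_iff)
  qed
  also have "\<dots> = (\<Sum>n=1..N. \<Sum>d | d dvd n. 
      (\<chi> d * of_real (moebius d * ln (real N / d)) / d) * (\<chi> (n div d) / (n div d)))"
  proof (rule sum.cong[OF refl])
    fix n assume "n \<in> {1..N}"
    then have n: "n > 0" by simp
    have "(\<chi> d * of_real (moebius d * ln (real N / d)) / d) * (\<chi> (n div d) / (n div d)) 
         = \<chi> n / n * of_real (moebius d * ln (real N / d))" if "d dvd n" for d
    proof -
      have "\<chi> n = \<chi> d * \<chi> (n div d)" "complex_of_nat n = of_nat d * of_nat (n div d)"
        using that by (metis chi_mult dvd_mult_div_cancel, metis of_nat_mult dvd_mult_div_cancel)
      then show ?thesis by simp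
    qed
    then have "(\<Sum>d | d dvd n. (\<chi> d * of_real (moebius d * ln (real N / d)) / d) * (\<chi> (n div d) / (n div d)))
       = \<chi> n / n * (\<Sum>d | d dvd n. of_real (moebius d * ln (real N / d)))"
      unfolding sum_distrib_left by (intro sum.cong) auto
    also have "\<dots> = \<chi> n / n * of_real (mangoldt n + (if n = 1 then ln (real N) else 0))"
      using moebius_sum_ln[OF n, of "real N"] N by (simp only: of_real_sum[symmetric])
    finally show "\<chi> n / n * (mangoldt n + (if n = 1 then ln (real N) else 0)) =
        (\<Sum>d | d dvd n. (\<chi> d * of_real (moebius d * ln (real N / d)) / d) * (\<chi> (n div d) / (n div d)))"
      by simp
  qed
  also have "\<dots> = (\<Sum>d=1..N. \<Sum>m=1..N div d. 
      (\<chi> d * of_real (moebius d * ln (real N / d)) / d) * (\<chi> m / m))"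
    by (rule sum_divisors_swap)
  also have "\<dots> = (\<Sum>d=1..N. (\<chi> d * of_real (moebius d * ln (real N / d)) / d) * S (N div d))"
    by (simp add: S_def sum_distrib_left)
  also have "norm \<dots> \<le> (\<Sum>d=1..N. ln (real N / d) * (2 * C / N))"
  proof (rule order_trans[OF norm_sum], rule sum_mono)
    fix d assume d: "d \<in> {1..N}"
    then have ln: "ln (real N / d) \<ge> 0" by simp
    have "norm ((\<chi> d * of_real (moebius d * ln (real N / d)) / d) * S (N div d))
        \<le> ((1 * (1 * ln (real N / d))) / d) * (2 * C * d / N)"
      unfolding norm_mult norm_divide norm_of_real abs_mult norm_of_nat
      using d N norm_chi_le[of d] norm_L_diff_div_le[of d N] assms ln abs_moebius_le[of d]
      by (intro mult_mono divide_right_mono) (auto intro!: mult_nonneg_nonneg)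
    also have "\<dots> = ln (real N / d) * (2 * C / N)" using d by simp
    finally show "norm ((\<chi> d * of_real (moebius d * ln (real N / d)) / d) * S (N div d))
        \<le> ln (real N / d) * (2 * C / N)" .
  qed
  also have "\<dots> = (\<Sum>d=1..N. ln (real N) - ln d) * (2 * C / N)"
    using N by (subst sum_distrib_right) (auto intro!: sum.cong simp: ln_div)
  also have "(\<Sum>d=1..N. ln (real N) - ln d) = real N * ln N - ln (fact N)"
    unfolding fact_prod of_nat_prod by (subst ln_prod) (auto simp: sum_subtractf)
  also have "\<dots> * (2 * C / N) \<le> N * (2 * C / N)"
    using C_nonneg ln_fact_ge[of N] by (intro mult_right_mono) auto
  also have "\<dots> = 2 * C" using N by simp
  finally show "norm (T N + ln (real N)) \<le> 2 * C" .
qed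

end

section \<open>Nonvanishing for real characters\<close>

locale real_bounded_character = bounded_character +
  assumes chi_real: "\<And>n. \<chi> n \<in> {-1, 0, 1}"
begin

definition r :: "nat \<Rightarrow> real" where "r n = Re (\<chi> n)"

lemma of_real_r: "of_real (r n) = \<chi> n"
  using chi_real[of n] by (auto simp: r_def)

lemma r_cases: "r n = -1 \<or> r n = 0 \<or> r n = 1"
  using chi_real[of n] by (auto simp: r_def)

lemma r_mult: "r (m * n) = r m * r n"
  by (metis chi_mult of_real_eq_iff of_real_mult of_real_r)

lemma r_1: "r (Suc 0) = 1"
  by (simp add: r_def chi_1)

lemma r_power: "r (p ^ i) = r p ^ i"
  by (induction i) (auto simp: r_1 r_mult)

text \<open>The Dirichlet coefficients of the product of the zeta function and the
  \<open>L\<close>-series, and equally the power series coefficients of the Lambert series of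
  \<open>r\<close>.\<close>

definition c :: "nat \<Rightarrow> real" where
  "c n = (\<Sum>d | d dvd n. r d)"

lemma sum_power_nonneg: "(\<Sum>i\<le>k. r p ^ i) \<ge> (if even k then 1 else 0)"
proof -
  consider "r p = -1" | "r p = 0" | "r p = 1" using r_cases[of p] by auto
  then show ?thesis
  proof cases
    case 1
    have "(\<Sum>i\<le>k. (- 1::real) ^ i) = (if even k then 1 else 0)"
      by (induction k) auto
    then show ?thesis using 1 by simp
  next
    case 2
    have "(\<Sum>i\<le>k. (0::real) ^ i) = 1"
      by (induction k) auto
    then show ?thesis using 2 by simp
  qed auto
qed

text \<open>By multiplicativity only prime powers matter, where \<open>c\<close> is a sum of powers
  of -1, 0 or 1; that sum is nonnegative, and at least 1 for an even exponent.\<close>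

lemma c_bounds: "n > 0 \<Longrightarrow> c n \<ge> 0 \<and> (is_square n \<longrightarrow> c n \<ge> 1)"
proof (induction n rule: less_induct)
  case (less n)
  show ?case
  proof (cases "n = 1")
    case True
    then show ?thesis by (simp add: c_def r_1)
  next
    case False
    then obtain p k m where n: "prime p" "\<not> p dvd m" "n = p ^ Suc k * m" "0 < m" "m < n"
      using prime_power_cofactor[of n] less.prems by (metis nat_neq_iff less_one)
    define P where "P = (\<Sum>i\<le>Suc k. r p ^ i)"
    have c: "c n = P * c m"
      unfolding c_def n(3) sum_divisors_prime_power_mult[OF n(1,2)] P_def
      by (simp only: r_mult r_power sum_distrib_left[symmetric] sum_distrib_right[symmetric])
    have P: "P \<ge> (if even (Suc k) then 1 else 0)" unfolding P_def by (rule sum_power_nonneg)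
    have IH: "c m \<ge> 0" "is_square m \<longrightarrow> c m \<ge> 1" using less.IH[OF n(5,4)] by auto
    have "c n \<ge> 0" unfolding c using P IH(1) by (auto split: if_splits intro!: mult_nonneg_nonneg)
    moreover have "c n \<ge> 1" if sq: "is_square n"
    proof -
      obtain b where b: "n = b\<^sup>2" using sq by (auto elim!: is_nth_powerE)
      have "b > 0" using b less.prems by (auto intro: Nat.gr0I)
      have "multiplicity p n = Suc k"
        using n by (simp add: prime_elem_multiplicity_mult_distrib multiplicity_same_power
          not_dvd_imp_multiplicity_0 prime_nat_iff del: power_Suc)
      moreover have "multiplicity p n = 2 * multiplicity p b"
        using n(1) \<open>b > 0\<close> by (simp add: b prime_elem_multiplicity_power_distrib)
      ultimately have ev: "even (Suc k)" by (metis dvd_triv_left)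
      have "is_square m"
      proof -
        have "coprime (p ^ Suc k) m" using n(1,2) by (simp add: prime_imp_coprime)
        then show ?thesis using sq n(3) is_nth_power_mult_coprime_nat_iff by blast
      qed
      then have "c m \<ge> 1" using IH by simp
      moreover have "P \<ge> 1" using P ev by simp
      ultimately show ?thesis unfolding c using mult_mono[of 1 P 1 "c m"] by simp
    qed
    ultimately show ?thesis by simp
  qed
qed

text \<open>AM-GM: the terms with index \<open>i\<close> and \<open>n - i\<close> have geometric
  mean \<open>u ^ n\<close>.\<close>

lemma sum_geometric_ge:
  fixes u :: real
  assumes "u \<ge> 0"
  shows "(\<Sum>i<Suc n. (u\<^sup>2) ^ i) \<ge> Suc n * u ^ n"
proof -
  have "2 * (\<Sum>i<Suc n. (u\<^sup>2) ^ i) = (\<Sum>i<Suc n. (u\<^sup>2) ^ i) + (\<Sum>i<Suc n. (u\<^sup>2) ^ (n - i))"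
    using sum.nat_diff_reindex[of "\<lambda>i. (u\<^sup>2) ^ i" "Suc n"] by simp
  also have "\<dots> = (\<Sum>i<Suc n. (u\<^sup>2) ^ i + (u\<^sup>2) ^ (n - i))" by (rule sum.distrib[symmetric])
  also have "\<dots> \<ge> (\<Sum>i<Suc n. 2 * u ^ n)"
  proof (rule sum_mono)
    fix i assume "i \<in> {..<Suc n}"
    then have "u ^ n = u ^ i * u ^ (n - i)" by (simp add: power_add[symmetric])
    moreover have "2 * (u ^ i * u ^ (n - i)) \<le> (u ^ i)\<^sup>2 + (u ^ (n - i))\<^sup>2"
      using sum_squares_bound[of "u ^ i" "u ^ (n - i)"] by simp
    ultimately show "2 * u ^ n \<le> (u\<^sup>2) ^ i + (u\<^sup>2) ^ (n - i)"
      by (simp add: power_mult[symmetric] mult.commute)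
  qed
  finally show ?thesis by simp
qed

text \<open>The gap between \<open>1 / (n * (1 - t))\<close>, whose sum against \<open>r\<close> is
  \<open>Re (S N) / (1 - t)\<close>, and the Lambert weight. It decreases from
  \<open>b t 1 = 1\<close>, so Abel summation bounds its sum against \<open>r\<close> by
  \<open>2 * C\<close> uniformly in \<open>t\<close>.\<close>

definition b :: "real \<Rightarrow> nat \<Rightarrow> real" where
  "b t n = 1 / (n * (1 - t)) - t ^ n / (1 - t ^ n)"

lemma b_decreasing:
  assumes "0 < t" "t < 1" "n > 0"
  shows "b t (Suc n) \<le> b t n"
proof -
  \<comment> \<open>With \<open>G k = (1 - t ^ k) / (1 - t)\<close>, the claim is
    \<open>n * (n + 1) * t ^ n \<le> G n * G (n + 1)\<close>. AM-GM bounds the right side below by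
    \<open>n * (n + 1) * u ^ (2 * n - 1)\<close>, where the odd exponent calls for the square root
    of \<open>t\<close>.\<close>
  define u where "u = sqrt t"
  have u: "u > 0" "u < 1" "t = u\<^sup>2" using assms by (auto simp: u_def real_sqrt_lt_1_iff)
  have geo: "1 - t ^ k = (1 - t) * (\<Sum>i<k. t ^ i)" for k
    by (simp add: one_diff_power_eq)
  define G where "G k = (\<Sum>i<k. t ^ i)" for k
  obtain m where m: "n = Suc m" using assms by (cases n) auto
  have G: "n * u ^ m \<le> G n" "Suc n * u ^ n \<le> G (Suc n)"
    unfolding G_def m u(3) using sum_geometric_ge[of u] u(1) by (simp_all only: less_imp_le)
  have pos: "G n > 0" "G (Suc n) > 0"
    using G u assms by (smt (verit) mult_pos_pos of_nat_0_less_iff zero_less_Suc zero_less_power)+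
  have "real n * Suc n * t ^ n \<le> (n * u ^ m) * (Suc n * u ^ n)"
  proof -
    have "t ^ n = u ^ Suc (m + n)" unfolding u(3) m power_mult[symmetric] by (simp add: mult_2)
    also have "\<dots> \<le> u ^ (m + n)" using u by (intro power_decreasing) auto
    finally have "t ^ n \<le> u ^ m * u ^ n" by (simp add: power_add)
    then have "(real n * Suc n) * t ^ n \<le> (real n * Suc n) * (u ^ m * u ^ n)"
      by (intro mult_left_mono) auto
    then show ?thesis by (simp add: mult_ac)
  qed
  also have "\<dots> \<le> G n * G (Suc n)" by (intro mult_mono G) (use pos u in auto)
  finally have key: "t ^ n / (G n * G (Suc n)) \<le> 1 / (real n * Suc n)"
    using pos assms by (simp add: pos_divide_le_eq pos_le_divide_eq mult_ac del: of_nat_Suc)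
  have "b t n - b t (Suc n) = (1 / (real n * Suc n) - t ^ n / (G n * G (Suc n))) / (1 - t)"
  proof -
    have 1: "1 / (n * (1 - t)) - 1 / (Suc n * (1 - t)) = (1 / (real n * Suc n)) / (1 - t)"
      using assms by (simp add: divide_simps)
    have "t ^ n / (1 - t ^ n) - t ^ Suc n / (1 - t ^ Suc n) 
        = (t ^ n * (1 - t)) / ((1 - t ^ n) * (1 - t ^ Suc n))"
    proof -
      have "1 - t ^ n \<noteq> 0" "1 - t ^ Suc n \<noteq> 0"
        using pos assms geo[of n] geo[of "Suc n"] unfolding G_def by auto
      then show ?thesis by (simp add: divide_simps del: power_Suc) (simp add: algebra_simps)
    qed
    also have "\<dots> = (t ^ n / (G n * G (Suc n))) / (1 - t)"
      unfolding geo G_def[symmetric] using assms pos by (simp add: divide_simps)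
    finally have 2: "t ^ n / (1 - t ^ n) - t ^ Suc n / (1 - t ^ Suc n) = (t ^ n / (G n * G (Suc n))) / (1 - t)" .
    have "b t n - b t (Suc n) = (1 / (n * (1 - t)) - 1 / (Suc n * (1 - t)))
       - (t ^ n / (1 - t ^ n) - t ^ Suc n / (1 - t ^ Suc n))" unfolding b_def by simp
    also have "\<dots> = (1 / (real n * Suc n)) / (1 - t) - (t ^ n / (G n * G (Suc n))) / (1 - t)"
      unfolding 1 2 ..
    finally show ?thesis by (simp add: diff_divide_distrib)
  qed
  also have "\<dots> \<ge> 0" using key assms by auto
  finally show ?thesis by simp
qed

lemma b_nonneg:
  assumes "0 < t" "t < 1" "n > 0"
  shows "b t n \<ge> 0"
proof -
  have "n * t ^ n = (\<Sum>i<n. t ^ n)" by simp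
  also have "\<dots> \<le> (\<Sum>i<n. t ^ i)"
    using assms by (intro sum_mono power_decreasing) auto
  finally have "n * t ^ n * (1 - t) \<le> 1 - t ^ n"
    using assms by (simp add: one_diff_power_eq mult.commute mult_left_mono)
  moreover have "1 - t ^ n > 0" using assms by (simp add: power_less_one_iff)
  ultimately have "t ^ n / (1 - t ^ n) \<le> 1 / (n * (1 - t))"
    using assms by (simp add: pos_divide_le_eq pos_le_divide_eq mult_ac)
  then show ?thesis unfolding b_def by simp
qed

text \<open>Truncation at \<open>N\<close> avoids rearranging infinite series. The squares bound the
  truncated power series of \<open>c\<close> from below; regrouped by divisors it becomes a Lambert
  sum, whose three parts are the main term, the \<open>b\<close>-sum, and a truncation error that
  vanishes as \<open>N\<close> grows.\<close>

lemma sum_square_powers_le: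
  assumes t: "0 < t" "t < 1" and N: "N \<ge> K\<^sup>2"
  shows "(\<Sum>k=1..K. t ^ k\<^sup>2) \<le> Re (S N) / (1 - t) + 2 * C + N * t ^ N / (1 - t)"
proof -
  have "(\<Sum>k=1..K. t ^ k\<^sup>2) = (\<Sum>n\<in>(\<lambda>k. k\<^sup>2) ` {1..K}. t ^ n)"
    by (subst sum.reindex) (auto simp: inj_on_def)
  also have "\<dots> \<le> (\<Sum>n\<in>(\<lambda>k. k\<^sup>2) ` {1..K}. c n * t ^ n)"
  proof (rule sum_mono)
    fix n assume "n \<in> (\<lambda>k. k\<^sup>2) ` {1..K}"
    then have "n > 0" "is_square n" by (auto simp: is_nth_power_def)
    then have "c n \<ge> 1" using c_bounds by auto
    then show "t ^ n \<le> c n * t ^ n" using t mult_right_mono[of 1 "c n" "t ^ n"] by simp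
  qed
  also have "\<dots> \<le> (\<Sum>n=1..N. c n * t ^ n)"
  proof (rule sum_mono2)
    show "(\<lambda>k. k\<^sup>2) ` {1..K} \<subseteq> {1..N}"
    proof safe
      fix k assume "k \<in> {1..K}"
      then have "k\<^sup>2 \<le> K\<^sup>2" by (intro power_mono) auto
      then have "k\<^sup>2 \<le> N" using N by linarith
      then show "k\<^sup>2 \<in> {1..N}" using N \<open>k \<in> {1..K}\<close> by auto
    qed
  qed (use t c_bounds in auto)
  also have "\<dots> = (\<Sum>n=1..N. \<Sum>d | d dvd n. r d * t ^ (d * (n div d)))"
    unfolding c_def sum_distrib_right by (intro sum.cong) auto
  also have "\<dots> = (\<Sum>d=1..N. \<Sum>m=1..N div d. r d * t ^ (d * m))"
    by (rule sum_divisors_swap)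
  \<comment> \<open>The truncated geometric series is the Lambert weight minus a tail, and the
    Lambert weight is \<open>1 / (d * (1 - t)) - b t d\<close> by definition of
    \<open>b\<close>.\<close>
  also have "\<dots> = (\<Sum>d=1..N. (r d / d) / (1 - t) - b t d * r d - r d * (t ^ (d * Suc (N div d)) / (1 - t ^ d)))"
  proof (rule sum.cong[OF refl])
    fix d assume d: "d \<in> {1..N}"
    then have "t ^ d < 1" using t by (simp add: power_less_one_iff)
    have "(\<Sum>m=1..N div d. r d * t ^ (d * m)) = r d * (\<Sum>m=1..N div d. (t ^ d) ^ m)"
      by (simp add: sum_distrib_left power_mult)
    also have "(\<Sum>m=1..M. (t ^ d) ^ m) = (t ^ d - (t ^ d) ^ Suc M) / (1 - t ^ d)" for M
    proof -
      have "(1 - z) * (\<Sum>m=1..M. z ^ m) = z - z ^ Suc M" for z :: real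
      proof (induction M)
        case (Suc M)
        have "(1 - z) * (\<Sum>m=1..Suc M. z ^ m) = (1 - z) * (\<Sum>m=1..M. z ^ m) + (1 - z) * z ^ Suc M"
          by (simp add: distrib_left)
        also have "\<dots> = z - z ^ Suc (Suc M)" unfolding Suc by (simp add: algebra_simps)
        finally show ?case .
      qed simp
      from this[of "t ^ d"] show ?thesis using \<open>t ^ d < 1\<close> by (simp add: field_simps)
    qed
    also have "(t ^ d) ^ Suc (N div d) = t ^ (d * Suc (N div d))"
      by (simp only: power_mult)
    finally show "(\<Sum>m=1..N div d. r d * t ^ (d * m)) = 
        (r d / d) / (1 - t) - b t d * r d - r d * (t ^ (d * Suc (N div d)) / (1 - t ^ d))"
      by (simp add: b_def algebra_simps diff_divide_distrib)
  qed
  also have "\<dots> = (\<Sum>d=1..N. r d / d) / (1 - t) - (\<Sum>d=1..N. b t d * r d) -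
      (\<Sum>d=1..N. r d * (t ^ (d * Suc (N div d)) / (1 - t ^ d)))"
    by (simp add: sum_subtractf sum_divide_distrib)
  also have "(\<Sum>d=1..N. r d / d) = Re (S N)"
    unfolding S_def r_def by simp
  finally have "(\<Sum>k=1..K. t ^ k\<^sup>2) \<le> Re (S N) / (1 - t) - (\<Sum>d=1..N. b t d * r d) -
      (\<Sum>d=1..N. r d * (t ^ (d * Suc (N div d)) / (1 - t ^ d)))" .
  moreover have "- (\<Sum>d=1..N. b t d * r d) \<le> 2 * C"
  proof -
    have "{1..N} = {0<..N}" by auto
    then have "of_real (\<Sum>d=1..N. b t d * r d) = (\<Sum>d\<in>{0<..N}. of_real (b t d) * \<chi> d)"
      by (simp add: of_real_r)
    also have "norm \<dots> \<le> 2 * C * b t (Suc 0)"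
      by (rule norm_sum_chi_interval_le) (use b_decreasing b_nonneg t in auto)
    also have "b t (Suc 0) = 1" using t by (simp add: b_def field_simps)
    finally show ?thesis by (simp only: norm_of_real)
  qed
  moreover have "- (\<Sum>d=1..N. r d * (t ^ (d * Suc (N div d)) / (1 - t ^ d))) \<le> N * t ^ N / (1 - t)"
  proof -
    have "- (\<Sum>d=1..N. r d * (t ^ (d * Suc (N div d)) / (1 - t ^ d))) =
          (\<Sum>d=1..N. - (r d * (t ^ (d * Suc (N div d)) / (1 - t ^ d))))"
      by (rule sum_negf[symmetric])
    also have "\<dots> \<le> (\<Sum>d=1..N. t ^ N / (1 - t))"
    proof (rule sum_mono)
      fix d assume d: "d \<in> {1..N}"
      have "t ^ d \<le> t ^ 1" using t d by (intro power_decreasing) auto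
      then have td: "1 - t \<le> 1 - t ^ d" by simp
      have "real N < real (d * Suc (N div d))" using real_less_mult_div[of d N] d by (simp add: algebra_simps)
      \<comment> \<open>The first omitted multiple of \<open>d\<close> lies beyond \<open>N\<close>,
        so each tail is at most \<open>t ^ N / (1 - t)\<close>, whatever \<open>d\<close>
        is.\<close>
      then have "N \<le> d * Suc (N div d)" by (simp only: of_nat_less_iff)
      then have "t ^ (d * Suc (N div d)) \<le> t ^ N" 
        by (intro power_decreasing) (use t in auto)
      then have *: "t ^ (d * Suc (N div d)) / (1 - t ^ d) \<le> t ^ N / (1 - t)"
        using td t by (intro frac_le) auto
      have "0 \<le> t ^ (d * Suc (N div d)) / (1 - t ^ d)" using t td by simp
      then have "- (r d * (t ^ (d * Suc (N div d)) / (1 - t ^ d))) \<le> t ^ (d * Suc (N div d)) / (1 - t ^ d)"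
        using r_cases[of d] by auto
      with * show "- (r d * (t ^ (d * Suc (N div d)) / (1 - t ^ d))) \<le> t ^ N / (1 - t)" by linarith
    qed
    finally show ?thesis by simp
  qed
  ultimately show ?thesis by linarith
qed

text \<open>Monsky's argument: if \<open>L = 0\<close>, the Lambert series \<open>\<Sum>\<chi>(d) t\<^sup>d / (1 - t\<^sup>d)\<close> stays bounded
  as \<open>t \<rightarrow> 1\<close>, whereas its power series coefficients \<open>c n\<close> are nonnegative, and at least 1 on squares.\<close>
theorem L_nonzero: "L \<noteq> 0"
proof
  assume L0: "L = 0"
  \<comment> \<open>The order of the limits matters: for fixed \<open>t\<close>, letting
    \<open>N\<close> grow removes \<open>Re (S N) / (1 - t)\<close> because \<open>L = 0\<close>;
    only afterwards may \<open>t\<close> tend to 1, which makes each of the \<open>K\<close> terms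
    1.\<close>
  have bound: "(\<Sum>k=1..K. t ^ k\<^sup>2) \<le> 2 * C" if t: "0 < t" "t < 1" for t :: real and K :: nat
  proof (rule tendsto_lowerbound)
    have "(\<lambda>N. Re (S N) / (1 - t) + 2 * C + real N * t ^ N / (1 - t)) \<longlonglongrightarrow>
          Re 0 / (1 - t) + 2 * C + 0 / (1 - t)"
      using S_tendsto_L L0 t powser_times_n_limit_0[of t]
      by (intro tendsto_intros) auto
    then show "(\<lambda>N. Re (S N) / (1 - t) + 2 * C + real N * t ^ N / (1 - t)) \<longlonglongrightarrow> 2 * C" by simp
    show "\<forall>\<^sub>F N in sequentially. (\<Sum>k=1..K. t ^ k\<^sup>2) \<le> Re (S N) / (1 - t) + 2 * C + real N * t ^ N / (1 - t)"
      using eventually_ge_at_top[of "K\<^sup>2"] by eventually_elim (rule sum_square_powers_le[OF t])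
  qed auto
  have "real K \<le> 2 * C" for K
  proof (rule tendsto_upperbound)
    have "((\<lambda>t. \<Sum>k=1..K. t ^ k\<^sup>2) \<longlongrightarrow> (\<Sum>k=1..K. (1::real) ^ k\<^sup>2)) (at_left 1)"
      by (intro tendsto_intros)
    then show "((\<lambda>t. \<Sum>k=1..K. t ^ k\<^sup>2) \<longlongrightarrow> real K) (at_left (1::real))" by simp
    have "\<forall>\<^sub>F t in at_left (1::real). t \<in> {0<..<1}"
      by (rule eventually_at_leftI[of 0]) auto
    then show "\<forall>\<^sub>F t in at_left (1::real). (\<Sum>k=1..K. t ^ k\<^sup>2) \<le> 2 * C"
      by eventually_elim (use bound in auto)
  qed auto
  moreover obtain K :: nat where "real K > 2 * C" using reals_Archimedean2 by blast
  ultimately show False by (meson not_less)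
qed

end

section \<open>Characters modulo a prime\<close>

lemma ln_div_square_le:
  fixes p :: nat
  assumes "p \<ge> 2"
  shows "ln p / (real p)\<^sup>2 \<le> 4 * (1 / sqrt (real (p - 1)) - 1 / sqrt (real p))"
proof -
  \<comment> \<open>The right side is chosen to telescope. Its difference is at least
    \<open>1 / (2 * u ^ 3)\<close>, while \<open>ln p = 2 * ln u \<le> 2 * u\<close> bounds the left
    side by \<open>2 / u ^ 3\<close>; hence the factor 4.\<close>
  define u v where "u = sqrt p" and "v = sqrt (p - 1)"
  have uv: "v > 0" "v \<le> u" "u\<^sup>2 = p" "v\<^sup>2 = p - 1" using assms by (auto simp: u_def v_def)
  have "u * v \<noteq> 0" "u + v \<noteq> 0" using uv by auto
  then have "(1 / v - 1 / u) = (u - v) * (u + v) / (u * v * (u + v))"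
    by (simp add: divide_simps)
  also have "(u - v) * (u + v) = u\<^sup>2 - v\<^sup>2" by (simp add: algebra_simps power2_eq_square)
  also have "\<dots> = 1" using uv assms by (simp add: of_nat_diff)
  finally have 1: "1 / v - 1 / u = 1 / (u * v * (u + v))" .
  have "u * v * (u + v) \<le> u * u * (u + u)" using uv by (intro mult_mono add_mono) auto
  then have 2: "1 / v - 1 / u \<ge> 1 / (2 * u ^ 3)"
    unfolding 1 using uv by (intro frac_le) (auto simp: power3_eq_cube)
  have "ln p = 2 * ln u" unfolding u_def using assms by (simp add: ln_sqrt)
  also have "\<dots> \<le> 2 * u" using uv ln_le_minus_one[of u] by simp
  finally have "ln p / (real p)\<^sup>2 \<le> 2 * u / (real p)\<^sup>2" by (intro divide_right_mono) auto
  also have "\<dots> = 2 * u / u ^ 4" using uv(3) by (metis (no_types) mult_2 numeral_Bit0 power_add power2_eq_square)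
  also have "\<dots> = 4 * (1 / (2 * u ^ 3))" using uv by (simp add: field_simps power_numeral_reduce)
  also have "\<dots> \<le> 4 * (1 / v - 1 / u)" using 2 by simp
  finally show ?thesis by (simp add: u_def v_def)
qed

lemma sum_inverse_powers_le:
  fixes p :: nat
  assumes "p \<ge> 2"
  shows "(\<Sum>k=2..N. 1 / real p ^ k) \<le> 2 / (real p)\<^sup>2"
proof -
  \<comment> \<open>Subtracting the last term makes the bound inductive, since each term is at least
    twice the next.\<close>
  have "(\<Sum>k=2..N. 1 / real p ^ k) \<le> 2 / (real p)\<^sup>2 - 1 / real p ^ N" if "N \<ge> 2" for N
    using that
  proof (induction N rule: dec_induct)
    case (step n)
    have "2 * (1 / real p ^ Suc n) \<le> 1 / real p ^ n"
      using assms by (simp add: field_simps)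
    with step show ?case by simp
  qed simp
  moreover have "(\<Sum>k=2..N. 1 / real p ^ k) = 0" if "N < 2" using that by simp
  ultimately show ?thesis
    by (smt (verit) divide_nonneg_nonneg not_less of_nat_0_le_iff zero_le_power)
qed

text \<open>This permits passing between \<open>mangoldt\<close> and logarithms of primes at bounded
  cost. The powers of \<open>p\<close> from the square on weigh at most
  \<open>2 * ln p / p\<^sup>2\<close>, and twice the telescoping bound of
  \<open>ln_div_square_le\<close> sums to at most 8.\<close>

lemma sum_mangoldt_nonprime_le:
  "(\<Sum>n | n \<in> {1..N} \<and> \<not> prime n. mangoldt n / n) \<le> (8::real)"
proof -
  define I where "I = {p. prime p \<and> p \<le> N} \<times> {2..N}"
  have finI: "finite I" unfolding I_def by (intro finite_cartesian_product) auto
  have "(\<Sum>n | n \<in> {1..N} \<and> \<not> prime n. mangoldt n / real n) =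
        (\<Sum>n | n \<in> {1..N} \<and> \<not> prime n \<and> primepow n. mangoldt n / real n)"
    by (rule sum.mono_neutral_right) (auto simp: mangoldt_def)
  also have "\<dots> \<le> (\<Sum>n\<in>(\<lambda>(p, k). p ^ k) ` I. mangoldt n / real n)"
  proof (rule sum_mono2)
    show "{n. n \<in> {1..N} \<and> \<not> prime n \<and> primepow n} \<subseteq> (\<lambda>(p, k). p ^ k) ` I"
    proof safe
      fix n assume n: "n \<in> {1..N}" "\<not> prime n" "primepow n"
      then obtain p k where pk: "prime p" "k > 0" "n = p ^ k" by (auto simp: primepow_def)
      have "k \<noteq> 1" using n(2) pk by auto
      moreover have "k < p ^ k" "p \<le> p ^ k"
        using pk prime_gt_1_nat[of p] power_gt_expt[of p k] by (auto intro: self_le_power)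
      ultimately have "(p, k) \<in> I" using pk n(1) by (auto simp: I_def)
      then show "n \<in> (\<lambda>(p, k). p ^ k) ` I" using pk(3) by force
    qed
  qed (use finI mangoldt_nonneg in auto)
  also have "\<dots> \<le> (\<Sum>(p, k)\<in>I. mangoldt (p ^ k) / real (p ^ k))"
    using sum_image_le[OF finI, of "\<lambda>n. mangoldt n / real n" "\<lambda>(p, k). p ^ k"] mangoldt_nonneg
    by (simp add: case_prod_unfold)
  also have "\<dots> = (\<Sum>p | prime p \<and> p \<le> N. \<Sum>k=2..N. ln p * (1 / real p ^ k))"
    unfolding I_def by (subst sum.cartesian_product[symmetric]) (auto intro!: sum.cong)
  also have "\<dots> \<le> (\<Sum>p | prime p \<and> p \<le> N. 8 * (1 / sqrt (real (p - 1)) - 1 / sqrt (real p)))"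
  proof (rule sum_mono)
    fix p :: nat assume "p \<in> {p. prime p \<and> p \<le> N}"
    then have p: "p \<ge> 2" by (auto dest: prime_ge_2_nat)
    have "(\<Sum>k=2..N. ln p * (1 / real p ^ k)) = ln p * (\<Sum>k=2..N. 1 / real p ^ k)"
      by (simp add: sum_distrib_left)
    also have "\<dots> \<le> ln p * (2 / (real p)\<^sup>2)"
      using p sum_inverse_powers_le[of p N] by (intro mult_left_mono) auto
    also have "\<dots> \<le> 8 * (1 / sqrt (real (p - 1)) - 1 / sqrt (real p))"
      using mult_left_mono[OF ln_div_square_le[OF p], of 2] by (simp add: mult_ac)
    finally show "(\<Sum>k=2..N. ln p * (1 / real p ^ k)) \<le> 8 * (1 / sqrt (real (p - 1)) - 1 / sqrt (real p))" .
  qed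
  also have "\<dots> \<le> (\<Sum>p=2..N. 8 * (1 / sqrt (real (p - 1)) - 1 / sqrt (real p)))"
    by (rule sum_mono2) (auto simp: dest: prime_ge_2_nat intro!: frac_le)
  also have "\<dots> \<le> 8"
  proof -
    have "(\<Sum>p=2..N. 8 * (1 / sqrt (real (p - 1)) - 1 / sqrt (real p))) \<le> 8 * (1 - 1 / sqrt N)" if "N \<ge> 1" for N :: nat
      using that
    proof (induction N rule: dec_induct)
      case (step n)
      then show ?case by (simp add: algebra_simps)
    qed simp
    then have *: "(\<Sum>p=2..N. 8 * (1 / sqrt (real (p - 1)) - 1 / sqrt (real p))) \<le> 8" if "N \<ge> 1" for N :: nat
      using that by (smt (verit, best) divide_nonneg_nonneg of_nat_0_le_iff real_sqrt_ge_zero)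
    show ?thesis
    proof (cases "N \<ge> 1")
      case False
      then show ?thesis by simp
    qed (rule *)
  qed
  finally show ?thesis .
qed

section \<open>The characters built from a primitive root\<close>

locale prime_modulus =
  fixes q w :: nat
  assumes q: "prime q" and w: "residue_primroot q w"
begin

definition m :: nat where "m = q - 1"

lemma m_pos: "m > 0"
  using q prime_gt_1_nat[of q] by (simp add: m_def)

lemma ord_w: "ord q w = m" and coprime_w: "coprime q w"
  using w q by (auto simp: residue_primroot_def m_def totient_prime)

lemma w_power_cong_iff: "[w ^ i = w ^ j] (mod q) \<longleftrightarrow> [i = j] (mod m)"
  using order_divides_expdiff[OF coprime_w] by (simp add: ord_w)

lemma w_bij: "bij_betw (\<lambda>i. w ^ i mod q) {..<m} (totatives q)"
  using residue_primroot_is_generator[OF prime_gt_1_nat[OF q] w] q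
  by (simp add: m_def totient_prime)

text \<open>The discrete logarithm to base \<open>w\<close>. An arbitrary choice is harmless: it is
  determined modulo \<open>m\<close>, and it occurs only as an exponent of \<open>w\<close> and of
  \<open>m\<close>-th roots of unity.\<close>

definition ind :: "nat \<Rightarrow> nat" where
  "ind n = (SOME i. [w ^ i = n] (mod q))"

lemma w_power_ind:
  assumes "\<not> q dvd n"
  shows "[w ^ ind n = n] (mod q)"
proof -
  have "coprime (n mod q) q"
    using assms q by (metis coprime_commute coprime_mod_left_iff prime_imp_coprime prime_gt_0_nat not_gr0)
  moreover have "n mod q > 0" using assms by (simp add: mod_greater_zero_iff_not_dvd)
  ultimately have "n mod q \<in> totatives q"
    using q by (auto simp: totatives_def prime_gt_0_nat intro: less_imp_le)
  then obtain i where "n mod q = w ^ i mod q"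
    using w_bij by (auto simp: bij_betw_def)
  then have "[w ^ i = n] (mod q)" by (simp add: cong_def)
  then show ?thesis unfolding ind_def by (rule someI)
qed

definition z :: "nat \<Rightarrow> complex" where
  "z j = cis (2 * pi * real j / real m)"

lemma z_power_m: "z j ^ m = 1"
proof -
  have "z j ^ m = cis (2 * pi * real j)" using m_pos by (simp add: z_def Complex.DeMoivre)
  then show ?thesis by (simp add: cis_multiple_2pi)
qed

lemma z_power_cong: "[i = i'] (mod m) \<Longrightarrow> z j ^ i = z j ^ i'"
proof -
  have "z j ^ i = z j ^ (i mod m)" for i
    by (subst div_mult_mod_eq[of i m, symmetric]) (simp only: power_add power_mult mult.commute[of _ m] z_power_m, simp)
  then show "[i = i'] (mod m) \<Longrightarrow> z j ^ i = z j ^ i'" by (metis cong_def)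
qed

lemma z_eq_1_iff: "j < m \<Longrightarrow> z j = 1 \<longleftrightarrow> j = 0"
proof -
  assume j: "j < m"
  have "inj_on z {..<m}"
    using bij_betw_roots_unity[OF m_pos] unfolding z_def bij_betw_def by simp
  moreover have "z 0 = 1" by (simp add: z_def)
  ultimately show ?thesis using j m_pos by (metis inj_on_eq_iff lessThan_iff)
qed

lemma norm_z: "norm (z j) = 1"
  by (simp add: z_def)

lemma sum_powers_root: 
  assumes "x ^ m = (1::complex)"
  shows "(\<Sum>i<m. x ^ i) = (if x = 1 then of_nat m else 0)"
  using assms by (auto simp: geometric_sum)

definition character :: "nat \<Rightarrow> nat \<Rightarrow> complex" where
  "character j n = (if q dvd n then 0 else z j ^ ind n)"

lemma character_eqI: "\<not> q dvd n \<Longrightarrow> [w ^ i = n] (mod q) \<Longrightarrow> character j n = z j ^ i"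
  unfolding character_def using w_power_ind[of n] z_power_cong w_power_cong_iff
  by (metis cong_sym cong_trans)

lemma character_cong: "[a = b] (mod q) \<Longrightarrow> character j a = character j b"
  by (metis character_def character_eqI cong_dvd_iff cong_sym cong_trans w_power_ind)

lemma character_mult: "character j (a * b) = character j a * character j b"
proof (cases "q dvd a \<or> q dvd b")
  case False
  then have "\<not> q dvd a * b" using q by (simp add: prime_dvd_mult_iff)
  moreover have "[w ^ (ind a + ind b) = a * b] (mod q)"
    unfolding power_add by (intro cong_mult w_power_ind) (use False in auto)
  ultimately have "character j (a * b) = z j ^ (ind a + ind b)" by (rule character_eqI)
  then show ?thesis using False by (simp add: character_def power_add)
qed (auto simp: character_def)

lemma character_1: "character j (Suc 0) = 1"
  using character_eqI[of 1 0 j] q by (simp add: prime_nat_iff)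

lemma norm_character_le: "norm (character j n) \<le> 1"
  by (simp add: character_def norm_power norm_z)

lemma sum_character_period:
  assumes "0 < j" "j < m"
  shows "(\<Sum>i<q. character j i) = 0"
proof -
  have "(\<Sum>i<q. character j i) = (\<Sum>i\<in>totatives q. character j i)"
  proof (rule sum.mono_neutral_right)
    show "totatives q \<subseteq> {..<q}"
      using q totatives_less prime_gt_1_nat by fastforce
    show "\<forall>i\<in>{..<q} - totatives q. character j i = 0"
    proof
      fix i assume "i \<in> {..<q} - totatives q"
      then have "q dvd i"
        using q by (auto simp: totatives_def) (metis coprime_commute prime_imp_coprime)
      then show "character j i = 0" by (simp add: character_def)
    qed
  qed auto
  also have "\<dots> = (\<Sum>i<m. character j (w ^ i mod q))"
    by (rule sum.reindex_bij_betw[OF w_bij, symmetric])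
  also have "\<dots> = (\<Sum>i<m. z j ^ i)"
  proof (rule sum.cong[OF refl])
    fix i
    have "\<not> q dvd w ^ i" using coprime_w q
      by (metis coprime_absorb_left coprime_power_right_iff not_prime_unit)
    then have "character j (w ^ i) = z j ^ i" by (rule character_eqI) simp
    moreover have "character j (w ^ i mod q) = character j (w ^ i)" by (rule character_cong) simp
    ultimately show "character j (w ^ i mod q) = z j ^ i" by simp
  qed
  also have "\<dots> = 0" using sum_powers_root[OF z_power_m] z_eq_1_iff[OF assms(2)] assms(1) by simp
  finally show ?thesis .
qed

text \<open>Full periods cancel, so at most \<open>n mod q\<close> terms of norm at most 1
  survive.\<close>

lemma bounded_character_modulus:
  assumes "0 < j" "j < m"
  shows "bounded_character (character j) q"
proof
  fix n
  have shift: "(\<Sum>i<q * a + b. character j i) = (\<Sum>i<b. character j i)" for a b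
  proof (induction a)
    case (Suc a)
    have "(\<Sum>i<q * Suc a + b. character j i) = (\<Sum>i<q. character j i) + (\<Sum>i<q * a + b. character j (q + i))"
    proof -
      have "(\<Sum>i<q + X. character j i) = (\<Sum>i<q. character j i) + (\<Sum>i<X. character j (q + i))" for X
        by (induction X) (auto simp: add.assoc)
      from this[of "q * a + b"] show ?thesis by (simp add: add.assoc)
    qed
    also have "(\<Sum>i<q * a + b. character j (q + i)) = (\<Sum>i<q * a + b. character j i)"
      by (rule sum.cong[OF refl], rule character_cong) (simp add: cong_def)
    finally show ?case using Suc sum_character_period[OF assms] by simp
  qed simp
  have "(\<Sum>i<n. character j i) = (\<Sum>i<n mod q. character j i)"
    using shift[of "n div q" "n mod q"] by simp
  also have "norm \<dots> \<le> (\<Sum>i<n mod q. 1)"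
    by (rule order_trans[OF norm_sum]) (intro sum_mono norm_character_le)
  also have "\<dots> \<le> q" using q by (simp add: prime_gt_0_nat less_imp_le)
  finally show "norm (\<Sum>i<n. character j i) \<le> q" .
qed (auto simp: character_1 character_mult norm_character_le, simp add: character_def)

text \<open>Orthogonality in the character variable: as \<open>z j = z 1 ^ j\<close>, the sum is
  geometric in \<open>j\<close> with an \<open>m\<close>-th root of unity as ratio.\<close>

lemma sum_character: "(\<Sum>j<m. character j n) = (if [n = 1] (mod q) then of_nat m else 0)"
proof (cases "q dvd n")
  case True
  then have "\<not> [n = 1] (mod q)" using q by (metis cong_dvd_iff not_prime_unit)
  then show ?thesis using True by (simp add: character_def)
next
  case False
  have z: "z j = z 1 ^ j" for j by (simp add: z_def Complex.DeMoivre mult_ac)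
  have "(\<Sum>j<m. character j n) = (\<Sum>j<m. (z 1 ^ ind n) ^ j)"
  proof (rule sum.cong[OF refl])
    fix j
    have "z j ^ ind n = (z 1 ^ ind n) ^ j" by (metis z power_mult mult.commute)
    then show "character j n = (z 1 ^ ind n) ^ j" using False by (simp add: character_def)
  qed
  also have "\<dots> = (if z 1 ^ ind n = 1 then of_nat m else 0)"
    by (rule sum_powers_root) (metis power_mult mult.commute z_power_m power_one)
  also have "z 1 ^ ind n = 1 \<longleftrightarrow> [n = 1] (mod q)"
  proof -
    have "z 1 ^ ind n = z (ind n mod m)"
      using z_power_cong[of "ind n" "ind n mod m" 1] z[of "ind n mod m"] by simp
    then have "z 1 ^ ind n = 1 \<longleftrightarrow> ind n mod m = 0"
      using z_eq_1_iff[of "ind n mod m"] m_pos by simp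
    also have "\<dots> \<longleftrightarrow> [ind n = 0] (mod m)" by (simp add: cong_def)
    also have "\<dots> \<longleftrightarrow> [w ^ ind n = w ^ 0] (mod q)" by (rule w_power_cong_iff[symmetric])
    also have "\<dots> \<longleftrightarrow> [n = 1] (mod q)" using w_power_ind[OF False] 
      by (metis cong_sym cong_trans power_0)
    finally show ?thesis .
  qed
  finally show ?thesis .
qed

text \<open>Stated for every \<open>j\<close>, because the principal character \<open>j = 0\<close>
  has unbounded partial sums and is no \<open>bounded_character\<close>; for the others it agrees
  with the \<open>T\<close> of that locale.\<close>

definition T :: "nat \<Rightarrow> nat \<Rightarrow> complex" where
  "T j N = (\<Sum>n=1..N. character j n * mangoldt n / n)"

lemma character_0: "character 0 n = (if q dvd n then 0 else 1)"
  by (simp add: character_def z_def)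

lemma Re_T_0_bounds:
  assumes "N > 0"
  shows "Re (T 0 N) \<le> ln N + 3 * ln 4" "Re (T 0 N) \<ge> ln N - 1 - 8 - ln q / q"
proof -
  have eq: "Re (T 0 N) = (\<Sum>n=1..N. if q dvd n then 0 else mangoldt n / n)"
    unfolding T_def Re_sum by (intro sum.cong) (auto simp: character_0)
  have "Re (T 0 N) \<le> (\<Sum>n=1..N. mangoldt n / n)"
    unfolding eq by (intro sum_mono) (auto simp: mangoldt_nonneg)
  also have "\<dots> \<le> ln N + 3 * ln 4" by (rule mertens_upper[OF assms])
  finally show "Re (T 0 N) \<le> ln N + 3 * ln 4" .
  \<comment> \<open>A multiple of \<open>q\<close> that the principal character removes is either
    \<open>q\<close> itself or not a prime.\<close>
  have "(\<Sum>n=1..N. mangoldt n / n) \<le> (\<Sum>n=1..N. (if q dvd n then 0 else mangoldt n / n) 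
     + ((if \<not> prime n then mangoldt n / n else 0) + (if n = q then ln q / q else 0)))"
  proof (rule sum_mono)
    fix n
    show "(mangoldt n / n :: real) \<le> (if q dvd n then 0 else mangoldt n / n) 
     + ((if \<not> prime n then mangoldt n / n else 0) + (if n = q then ln q / q else 0))"
      using q mangoldt_nonneg[of n] primes_dvd_imp_eq[of q n] by auto
  qed
  also have "\<dots> = Re (T 0 N) + ((\<Sum>n=1..N. if \<not> prime n then mangoldt n / n else 0) 
       + (\<Sum>n=1..N. if n = q then ln q / q else 0))"
    unfolding eq by (simp add: sum.distrib)
  also have "(\<Sum>n=1..N. if \<not> prime n then mangoldt n / n else (0::real)) = 
             (\<Sum>n | n \<in> {1..N} \<and> \<not> prime n. mangoldt n / n)"
    by (subst sum.inter_filter) auto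
  also have "\<dots> \<le> 8" by (rule sum_mangoldt_nonprime_le)
  also have "(\<Sum>n=1..N. if n = q then ln q / q else (0::real)) \<le> ln q / q"
    using q prime_gt_0_nat[of q] by (subst sum.delta) auto
  finally have "(\<Sum>n=1..N. mangoldt n / n) \<le> Re (T 0 N) + (8 + ln q / q)" by simp
  then show "Re (T 0 N) \<ge> ln N - 1 - 8 - ln q / q" using mertens_lower[OF assms] by linarith
qed

end

section \<open>Dirichlet's theorem for a prime modulus\<close>

context prime_modulus
begin

lemma z_complement:
  assumes "j < m"
  shows "z (m - j) = cnj (z j)"
proof -
  have "2 * pi * real (m - j) / real m = 2 * pi + - (2 * pi * real j / real m)"
    using assms by (simp add: field_simps of_nat_diff)
  then have "z (m - j) = cis (2 * pi + - (2 * pi * real j / real m))"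
    by (simp only: z_def)
  also have "\<dots> = cis (- (2 * pi * real j / real m))"
    unfolding cis_mult[symmetric] by simp
  finally show ?thesis by (simp add: z_def cis_cnj)
qed

lemma character_complement: "j < m \<Longrightarrow> character (m - j) n = cnj (character j n)"
  by (simp add: character_def z_complement)

lemma L_complement:
  assumes "0 < j" "j < m"
  shows "bounded_character.L (character (m - j)) = cnj (bounded_character.L (character j))"
proof -
  interpret A: bounded_character "character j" q by (rule bounded_character_modulus[OF assms])
  interpret B: bounded_character "character (m - j)" q by (rule bounded_character_modulus) (use assms in auto)
  have "B.S = (\<lambda>N. cnj (A.S N))"
    by (rule ext) (simp add: A.S_def B.S_def character_complement assms)
  moreover have "(\<lambda>N. cnj (A.S N)) \<longlonglongrightarrow> cnj A.L"
    by (intro tendsto_intros A.S_tendsto_L)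
  ultimately show ?thesis using B.S_tendsto_L LIMSEQ_unique by metis
qed

text \<open>The quadratic character: here \<open>z j = -1\<close>. It is the only nonprincipal one
  that equals its conjugate, whose index is \<open>m - j\<close>.\<close>

lemma L_real_nonzero:
  assumes "0 < j" "2 * j = m"
  shows "bounded_character.L (character j) \<noteq> 0"
proof -
  have j: "j < m" using assms by simp
  interpret A: bounded_character "character j" q by (rule bounded_character_modulus[OF assms(1) j])
  have "2 * pi * real j / real m = pi" using assms by (simp add: field_simps)
  then have z: "z j = -1" unfolding z_def by simp
  have "(-1::complex) ^ i \<in> {-1, 0, 1}" for i by (cases "even i") auto
  then interpret A: real_bounded_character "character j" q
    by unfold_locales (simp add: character_def z)
  show ?thesis by (rule A.L_nonzero)
qed

lemma T_eq:
  assumes "0 < j" "j < m"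
  shows "bounded_character.T (character j) = T j"
proof -
  interpret A: bounded_character "character j" q by (rule bounded_character_modulus[OF assms])
  show ?thesis by (rule ext) (simp add: A.T_def T_def)
qed

lemma Re_T_le:
  assumes "0 < j" "j < m"
  shows "\<exists>B. \<forall>N>0. Re (T j N) \<le> B \<and> (bounded_character.L (character j) = 0 \<longrightarrow> Re (T j N) \<le> B - ln N)"
proof -
  interpret A: bounded_character "character j" q by (rule bounded_character_modulus[OF assms])
  have eq: "T j = A.T" by (rule T_eq[OF assms, symmetric])
  show ?thesis
  proof (cases "A.L = 0")
    case True
    then obtain B where B: "\<And>N. N > 0 \<Longrightarrow> norm (A.T N + ln (real N)) \<le> B"
      using A.T_plus_ln_bounded by blast
    have "Re (A.T N) \<le> B - ln N \<and> Re (A.T N) \<le> B" if "N > 0" for N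
    proof -
      have "Re (A.T N + ln (real N)) \<le> B" using B[OF that] complex_Re_le_cmod order_trans by blast
      moreover have "ln (real N) \<ge> 0" using that by simp
      ultimately show ?thesis by simp
    qed
    then show ?thesis by (intro exI[of _ B]) (simp add: eq)
  next
    case False
    then obtain B where "\<And>N. norm (A.T N) \<le> B" using A.T_bounded by blast
    then have "Re (A.T N) \<le> B" for N using complex_Re_le_cmod order_trans by blast
    then show ?thesis using False by (intro exI[of _ B]) (simp add: eq)
  qed
qed

text \<open>With \<open>b\<close> inverse to \<open>a\<close>, multiplicativity lets
  \<open>character j b\<close> play the part of the conjugate of \<open>character j a\<close>, so
  orthogonality is needed at the residue 1 only.\<close>

lemma sum_character_T:
  assumes "[a * b = 1] (mod q)"
  shows "(\<Sum>j<m. character j b * T j N) = of_real (m * (\<Sum>n | n \<in> {1..N} \<and> [n = a] (mod q). mangoldt n / real n))"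
proof -
  have "(\<Sum>j<m. character j b * T j N) = (\<Sum>j<m. \<Sum>n=1..N. character j (b * n) * (mangoldt n / of_nat n))"
    by (simp add: T_def sum_distrib_left character_mult mult.assoc)
  also have "\<dots> = (\<Sum>n=1..N. (\<Sum>j<m. character j (b * n)) * (mangoldt n / of_nat n))"
    by (subst sum.swap) (simp only: sum_distrib_right)
  also have "\<dots> = (\<Sum>n=1..N. if [n = a] (mod q) then of_nat m * (mangoldt n / of_nat n) else 0)"
  proof (rule sum.cong[OF refl])
    fix n
    have "[b * n = 1] (mod q) \<longleftrightarrow> [n = a] (mod q)"
    proof
      assume *: "[b * n = 1] (mod q)"
      have "[n * (a * b) = n * 1] (mod q)" using assms by (intro cong_mult) auto
      moreover have "[a * (b * n) = a * 1] (mod q)" using * by (intro cong_mult) auto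
      ultimately show "[n = a] (mod q)" by (simp add: mult_ac) (metis cong_sym cong_trans)
    next
      assume "[n = a] (mod q)"
      then have "[b * n = b * a] (mod q)" by (intro cong_mult) auto
      then show "[b * n = 1] (mod q)" using assms by (metis cong_trans mult.commute)
    qed
    then show "(\<Sum>j<m. character j (b * n)) * (mangoldt n / of_nat n) = 
        (if [n = a] (mod q) then of_nat m * (mangoldt n / of_nat n) else 0)"
      by (simp add: sum_character)
  qed
  also have "\<dots> = (\<Sum>n | n \<in> {1..N} \<and> [n = a] (mod q). of_nat m * (mangoldt n / of_nat n))"
    by (subst sum.inter_filter) auto
  finally show ?thesis by (simp add: sum_distrib_left)
qed

lemma lessThan_m: "{..<m} = insert 0 {1..<m}"
  using m_pos by auto

lemma ln_unbounded: "\<exists>N>0. ln (real N) > K"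
proof -
  obtain N :: nat where N: "real N > exp K" using reals_Archimedean2 by blast
  then have "N > 0" by (metis exp_ge_zero not_gr0 not_less of_nat_0)
  then show ?thesis using N by (metis exp_less_cancel_iff exp_ln of_nat_0_less_iff)
qed

text \<open>Summing the \<open>T j N\<close> over \<open>j\<close> gives a nonnegative real number. The trivial character contributes
  \<open>ln N + O(1)\<close> and each vanishing \<open>L\<close>-value \<open>- ln N + O(1)\<close>, so two of them are impossible; and zeros of
  nonreal characters come in conjugate pairs.\<close>
lemma L_nonzero:
  assumes "0 < j" "j < m"
  shows "bounded_character.L (character j) \<noteq> 0"
proof
  assume L0: "bounded_character.L (character j) = 0"
  define j' where "j' = m - j"
  have "2 * j \<noteq> m" using assms L0 L_real_nonzero[of j] by blast
  then have j': "0 < j'" "j' < m" "j' \<noteq> j" "bounded_character.L (character j') = 0"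
    using assms L0 L_complement[OF assms] by (auto simp: j'_def)
  define I where "I = {1..<m}"
  have "\<forall>i\<in>I. \<exists>B. \<forall>N>0. Re (T i N) \<le> B \<and> (bounded_character.L (character i) = 0 \<longrightarrow> Re (T i N) \<le> B - ln N)"
    using Re_T_le by (auto simp: I_def)
  then obtain B where B: "\<And>i N. i \<in> I \<Longrightarrow> N > 0 \<Longrightarrow> Re (T i N) \<le> B i"
     "\<And>i N. i \<in> I \<Longrightarrow> N > 0 \<Longrightarrow> bounded_character.L (character i) = 0 \<Longrightarrow> Re (T i N) \<le> B i - ln N"
    by metis
  have "ln N \<le> 3 * ln 4 + (\<Sum>i\<in>I. B i)" if N: "N > 0" for N :: nat
  proof -
    have "0 \<le> real m * (\<Sum>n | n \<in> {1..N} \<and> [n = 1] (mod q). mangoldt n / real n)"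
      by (intro mult_nonneg_nonneg sum_nonneg) (auto simp: mangoldt_nonneg)
    also have "\<dots> = Re (\<Sum>i<m. character i 1 * T i N)"
      by (subst sum_character_T[of 1]) auto
    also have "\<dots> = Re (T 0 N) + (\<Sum>i\<in>I. Re (T i N))"
      unfolding lessThan_m I_def by (simp add: character_1)
    also have "(\<Sum>i\<in>I. Re (T i N)) \<le> (\<Sum>i\<in>I. B i - (if i \<in> {j, j'} then ln N else 0))"
      by (rule sum_mono) (use B N L0 j' in auto)
    also have "\<dots> = (\<Sum>i\<in>I. B i) - (\<Sum>i\<in>I. if i \<in> {j, j'} then ln N else 0)"
      by (rule sum_subtractf)
    also have "(\<Sum>i\<in>I. if i \<in> {j, j'} then ln N else 0) = (\<Sum>i\<in>{j, j'}. ln N)"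
      by (rule sum.mono_neutral_cong_right) (use assms j' in \<open>auto simp: I_def\<close>)
    also have "\<dots> = 2 * ln N" using j' by simp
    finally show ?thesis using Re_T_0_bounds(1)[OF N] by linarith
  qed
  moreover obtain N where "N > 0" "ln (real N) > 3 * ln 4 + (\<Sum>i\<in>I. B i)" using ln_unbounded by blast
  ultimately show False by (meson not_less)
qed

lemma norm_T_bounded:
  assumes "0 < j" "j < m"
  shows "\<exists>B. \<forall>N. norm (T j N) \<le> B"
  using bounded_character.T_bounded[OF bounded_character_modulus[OF assms] L_nonzero[OF assms]]
  unfolding T_eq[OF assms] .

text \<open>In the orthogonality sum only \<open>j = 0\<close> is unbounded, and it contributes
  \<open>ln N\<close> up to a constant, since \<open>b\<close> is prime to \<open>q\<close> as
  well.\<close>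

lemma mangoldt_progression_lower:
  assumes "\<not> q dvd a"
  shows "\<exists>K. \<forall>N>0. m * (\<Sum>n | n \<in> {1..N} \<and> [n = a] (mod q). mangoldt n / real n) \<ge> ln (real N) - K"
proof -
  obtain b where b: "[a * b = 1] (mod q)"
    using assms q cong_solve_coprime_nat[of a q] by (metis coprime_commute prime_imp_coprime One_nat_def)
  have "\<not> q dvd b"
    using b q by (metis cong_dvd_iff dvd_mult not_prime_unit)
  define I where "I = {1..<m}"
  have "\<forall>i\<in>I. \<exists>B. \<forall>N. norm (T i N) \<le> B" using norm_T_bounded by (auto simp: I_def)
  then obtain B where B: "\<And>i N. i \<in> I \<Longrightarrow> norm (T i N) \<le> B i" by metis
  have "m * (\<Sum>n | n \<in> {1..N} \<and> [n = a] (mod q). mangoldt n / real n) \<ge>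
      ln N - (1 + 8 + ln q / q + (\<Sum>i\<in>I. B i))" if N: "N > 0" for N :: nat
  proof -
    have "m * (\<Sum>n | n \<in> {1..N} \<and> [n = a] (mod q). mangoldt n / real n) = Re (\<Sum>i<m. character i b * T i N)"
      by (subst sum_character_T[OF b]) auto
    also have "\<dots> = Re (T 0 N) + (\<Sum>i\<in>I. Re (character i b * T i N))"
      unfolding lessThan_m I_def using \<open>\<not> q dvd b\<close> by (simp add: character_0)
    finally have eq: "m * (\<Sum>n | n \<in> {1..N} \<and> [n = a] (mod q). mangoldt n / real n) =
        Re (T 0 N) + (\<Sum>i\<in>I. Re (character i b * T i N))" .
    have "(\<Sum>i\<in>I. Re (character i b * T i N)) \<ge> (\<Sum>i\<in>I. - B i)"
    proof (rule sum_mono)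
      fix i assume i: "i \<in> I"
      have "norm (character i b * T i N) \<le> 1 * B i"
        unfolding norm_mult using B[OF i] norm_character_le by (intro mult_mono) auto
      then show "- B i \<le> Re (character i b * T i N)"
        using abs_Re_le_cmod[of "character i b * T i N"] by linarith
    qed
    then show ?thesis unfolding eq using Re_T_0_bounds(2)[OF N] by (simp add: sum_negf)
  qed
  then show ?thesis by blast
qed

lemma not_summable_inverse_primes:
  assumes "\<not> q dvd a"
  shows "\<not> summable (\<lambda>p. if prime p \<and> [p = a] (mod q) then 1 / real p else 0)"
    (is "\<not> summable ?u")
proof
  assume "summable ?u"
  obtain K where K: "\<And>N. N > 0 \<Longrightarrow> 
      m * (\<Sum>n | n \<in> {1..N} \<and> [n = a] (mod q). mangoldt n / real n) \<ge> ln (real N) - K"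
    using mangoldt_progression_lower[OF assms] by blast
  \<comment> \<open>A tail of reciprocals below \<open>1 / (2 * m)\<close>, weighted by logarithms
    up to \<open>ln N\<close>, gives at most \<open>ln N / (2 * m)\<close>: half of what the lower
    bound \<open>ln N / m\<close> demands.\<close>
  have "1 / (2 * real m) > 0" using m_pos by simp
  then obtain M where M: "\<And>i j. i \<ge> M \<Longrightarrow> norm (sum ?u {i..<j}) < 1 / (2 * real m)"
    using \<open>summable ?u\<close> unfolding summable_Cauchy by blast
  define D where "D = (\<Sum>n=1..M. ln (real n))"
  have "ln N / 2 \<le> K + m * (D + 8)" if N: "N > 0" for N :: nat
  proof -
    define A where "A = (\<Sum>n | n \<in> {1..N} \<and> [n = a] (mod q). mangoldt n / real n)"
    have "A \<le> (\<Sum>n=1..N. (if \<not> prime n then mangoldt n / n else 0) + ln n * ?u n)"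
      unfolding A_def sum.inter_filter[OF finite_atLeastAtMost]
      by (rule sum_mono) (auto simp: mangoldt_nonneg)
    also have "\<dots> = (\<Sum>n=1..N. if \<not> prime n then mangoldt n / n else 0) + (\<Sum>n=1..N. ln n * ?u n)"
      by (rule sum.distrib)
    also have "(\<Sum>n=1..N. if \<not> prime n then mangoldt n / n else (0::real)) = 
               (\<Sum>n | n \<in> {1..N} \<and> \<not> prime n. mangoldt n / real n)"
      by (subst sum.inter_filter) auto
    finally have 1: "A \<le> 8 + (\<Sum>n=1..N. ln n * ?u n)"
      using sum_mangoldt_nonprime_le[of N] by linarith
    have "(\<Sum>n=1..N. ln n * ?u n) \<le> (\<Sum>n\<in>{1..M} \<union> {Suc M..<Suc N}. ln n * ?u n)"
      by (rule sum_mono2) (auto intro!: ln_ge_zero)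
    also have "\<dots> = (\<Sum>n=1..M. ln n * ?u n) + (\<Sum>n\<in>{Suc M..<Suc N}. ln n * ?u n)"
      by (rule sum.union_disjoint) auto
    finally have 2: "(\<Sum>n=1..N. ln n * ?u n) \<le> \<dots>" .
    have 3: "(\<Sum>n=1..M. ln n * ?u n) \<le> D"
      unfolding D_def
    proof (rule sum_mono)
      fix n assume "n \<in> {1..M}"
      then show "ln n * ?u n \<le> ln n" by (intro mult_left_le) auto
    qed
    have "(\<Sum>n\<in>{Suc M..<Suc N}. ln n * ?u n) \<le> (\<Sum>n\<in>{Suc M..<Suc N}. ln N * ?u n)"
      by (intro sum_mono mult_right_mono) auto
    also have "\<dots> = ln N * sum ?u {Suc M..<Suc N}" by (rule sum_distrib_left[symmetric])
    also have "\<dots> \<le> ln N * (1 / (2 * real m))"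
    proof (rule mult_left_mono)
      show "sum ?u {Suc M..<Suc N} \<le> 1 / (2 * real m)"
        using M[of "Suc M" "Suc N"] by (simp only: real_norm_def) linarith
    qed (use N in auto)
    finally have 4: "(\<Sum>n\<in>{Suc M..<Suc N}. ln n * ?u n) \<le> ln N * (1 / (2 * real m))" .
    have "A \<le> 8 + (D + ln N * (1 / (2 * real m)))" using 1 2 3 4 by linarith
    then have "m * A \<le> m * (8 + (D + ln N * (1 / (2 * real m))))" by (intro mult_left_mono) auto
    also have "\<dots> = m * (D + 8) + ln N / 2" using m_pos by (simp add: field_simps)
    finally show ?thesis using K[OF N] unfolding A_def by linarith
  qed
  moreover obtain N where "N > 0" "ln (real N) > 2 * (K + m * (D + 8))" using ln_unbounded by blast
  ultimately show False by (smt (verit) field_sum_of_halves)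
qed

end

text \<open>Both parameters serve the divisor-sum argument: a large \<open>s\<close> feeds Turan's
  inequality, and a large \<open>z\<close> makes divisibility by some \<open>p\<^sup>2\<close>
  rare.\<close>

theorem dirichlet_prime_modulus:
  fixes q a z :: nat and s :: real
  assumes q: "prime q" and a: "\<not> q dvd a"
  obtains P where "finite P" "\<And>p. p \<in> P \<Longrightarrow> prime p \<and> [p = a] (mod q) \<and> p > z"
    "(\<Sum>p\<in>P. 1 / real p) \<ge> s"
proof -
  obtain w where "residue_primroot q w" using prime_primitive_root_exists[of q] q prime_gt_1_nat by blast
  then interpret prime_modulus q w using q by unfold_locales
  define u where "u p = (if prime p \<and> [p = a] (mod q) then 1 / real p else 0)" for p :: nat
  have ns: "\<not> summable u" unfolding u_def by (rule not_summable_inverse_primes[OF a])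
  have "\<exists>N. sum u {z<..<N} \<ge> s"
  proof (rule ccontr)
    assume *: "\<not> ?thesis"
    have "sum u {..<N} \<le> sum u {..z} + s" for N
    proof -
      have "sum u {..<N} \<le> sum u ({..z} \<union> {z<..<N})"
        by (rule sum_mono2) (auto simp: u_def)
      also have "\<dots> = sum u {..z} + sum u {z<..<N}" by (rule sum.union_disjoint) auto
      finally show ?thesis using * by (smt (verit))
    qed
    then have "summable u" by (intro summableI_nonneg_bounded) (auto simp: u_def)
    then show False using ns by simp
  qed
  then obtain N where N: "sum u {z<..<N} \<ge> s" by blast
  define P where "P = {p \<in> {z<..<N}. prime p \<and> [p = a] (mod q)}"
  have "(\<Sum>p\<in>P. 1 / real p) = sum u {z<..<N}"
    unfolding P_def u_def by (subst sum.inter_filter) auto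
  then show ?thesis using N by (intro that[of P]) (simp_all add: P_def)
qed

section \<open>Prime divisors and divisibility of the divisor sum\<close>

lemma
  fixes N d :: nat
  shows card_multiples_le: "real (card {n \<in> {1..N}. d dvd n}) \<le> N / d"
  and card_multiples_ge: "real (card {n \<in> {1..N}. d dvd n}) \<ge> N / d - 1"
proof -
  have *: "card {n \<in> {1..N}. d dvd n} = N div d"
  proof (cases "d = 0")
    case False
    have "{n \<in> {1..N}. d dvd n} = (\<lambda>k. d * k) ` {1..N div d}"
    proof safe
      fix n assume "n \<in> {1..N}" "d dvd n"
      then obtain k where "n = d * k" by auto
      then show "n \<in> (\<lambda>k. d * k) ` {1..N div d}"
        using False \<open>n \<in> {1..N}\<close> by (auto simp: less_eq_div_iff_mult_less_eq mult.commute Suc_le_eq)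
    qed (use False in \<open>auto simp: less_eq_div_iff_mult_less_eq mult.commute Suc_le_eq\<close>)
    then show ?thesis using False by (simp add: card_image inj_on_def)
  qed auto
  show "real (card {n \<in> {1..N}. d dvd n}) \<le> N / d" unfolding * by (rule of_nat_div_le_of_nat)
  show "real (card {n \<in> {1..N}. d dvd n}) \<ge> N / d - 1"
  proof (cases "d = 0")
    case False
    then show ?thesis unfolding * using real_less_mult_div[of d N] by (simp add: field_simps)
  qed auto
qed

text \<open>Chebyshev's inequality for the number of prime divisors in \<open>P\<close> about its
  mean \<open>S\<close>. Distinct primes give joint counts of at most \<open>N / (p * r)\<close>, so
  the squared deviations total at most \<open>N * S + 2 * S * card P\<close>, and dividing by
  \<open>(S / 2)\<^sup>2\<close> gives the bound. Its leading term depends on \<open>P\<close> only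
  through \<open>S\<close>.\<close>

lemma turan:
  fixes P :: "nat set" and N :: nat
  assumes fin: "finite P" and pr: "\<And>p. p \<in> P \<Longrightarrow> prime p"
  defines "S \<equiv> (\<Sum>p\<in>P. 1 / real p)"
  assumes S: "S > 0"
  shows "card {n \<in> {1..N}. card {p \<in> P. p dvd n} \<le> S / 2} \<le> 4 * N / S + 8 * card P / S"
proof -
  define i :: "nat \<Rightarrow> nat \<Rightarrow> real" where "i p n = (if p dvd n then 1 else 0)" for p n
  define f where "f n = (\<Sum>p\<in>P. i p n)" for n
  have f: "f n = card {p \<in> P. p dvd n}" for n
    unfolding f_def i_def by (simp add: sum.inter_filter[OF fin, symmetric])
  have sum_i: "(\<Sum>n=1..N. i d n) = card {n \<in> {1..N}. d dvd n}" for d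
    unfolding i_def by (simp add: sum.inter_filter[symmetric])
  have f1: "(\<Sum>n=1..N. f n) \<ge> N * S - card P"
  proof -
    have "(\<Sum>p\<in>P. N / p - 1) \<le> (\<Sum>p\<in>P. \<Sum>n=1..N. i p n)"
      unfolding sum_i by (intro sum_mono card_multiples_ge)
    also have "\<dots> = (\<Sum>n=1..N. f n)" unfolding f_def by (rule sum.swap)
    also have "(\<Sum>p\<in>P. N / p - 1) = N * S - card P"
      by (simp add: sum_subtractf S_def sum_distrib_left)
    finally show ?thesis .
  qed
  have f2: "(\<Sum>n=1..N. (f n)\<^sup>2) \<le> N * S\<^sup>2 + N * S"
  proof -
    have "(\<Sum>n=1..N. (f n)\<^sup>2) = (\<Sum>n=1..N. \<Sum>p\<in>P. \<Sum>r\<in>P. i p n * i r n)"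
      by (simp add: f_def power2_eq_square sum_product)
    also have "\<dots> = (\<Sum>p\<in>P. \<Sum>n=1..N. \<Sum>r\<in>P. i p n * i r n)" by (rule sum.swap)
    also have "\<dots> = (\<Sum>p\<in>P. \<Sum>r\<in>P. \<Sum>n=1..N. i p n * i r n)"
      by (intro sum.cong refl sum.swap)
    also have "\<dots> \<le> (\<Sum>p\<in>P. \<Sum>r\<in>P. N * (1 / p * (1 / r)) + (if r = p then N / p else 0))"
    proof (intro sum_mono)
      fix p r assume pr': "p \<in> P" "r \<in> P"
      show "(\<Sum>n=1..N. i p n * i r n) \<le> N * (1 / p * (1 / r)) + (if r = p then N / p else 0)"
      proof (cases "r = p")
        case True
        have "(\<Sum>n=1..N. i p n * i r n) = (\<Sum>n=1..N. i p n)"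
          unfolding True by (rule sum.cong) (auto simp: i_def)
        also have "\<dots> \<le> N / p" unfolding sum_i by (rule card_multiples_le)
        finally show ?thesis using True by (simp add: add_increasing)
      next
        case False
        then have "coprime p r" using pr' pr by (simp add: primes_coprime)
        then have "(\<Sum>n=1..N. i p n * i r n) = (\<Sum>n=1..N. i (p * r) n)"
          by (intro sum.cong) (auto simp: i_def intro: divides_mult dest: dvd_mult_left dvd_mult_right)
        also have "\<dots> \<le> N / (p * r)" unfolding sum_i by (rule card_multiples_le)
        finally show ?thesis using False by simp
      qed
    qed
    also have "\<dots> = (\<Sum>p\<in>P. \<Sum>r\<in>P. N * (1 / p * (1 / r))) + (\<Sum>p\<in>P. N / p)"
      using fin by (simp add: sum.distrib sum.delta)
    also have "(\<Sum>p\<in>P. \<Sum>r\<in>P. N * (1 / p * (1 / r))) = N * S\<^sup>2"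
    proof -
      have "S\<^sup>2 = (\<Sum>p\<in>P. \<Sum>r\<in>P. 1 / p * (1 / r))"
        by (simp only: S_def power2_eq_square sum_product)
      then show ?thesis by (simp only: sum_distrib_left)
    qed
    also have "(\<Sum>p\<in>P. N / p) = N * S" by (simp add: S_def sum_distrib_left)
    finally show ?thesis .
  qed
  define B where "B = {n \<in> {1..N}. card {p \<in> P. p dvd n} \<le> S / 2}"
  have "card B * (S / 2)\<^sup>2 = (\<Sum>n\<in>B. (S / 2)\<^sup>2)" by simp
  also have "\<dots> \<le> (\<Sum>n\<in>B. (S - f n)\<^sup>2)"
    by (intro sum_mono power_mono) (use S in \<open>auto simp: B_def f\<close>)
  also have "\<dots> \<le> (\<Sum>n=1..N. (S - f n)\<^sup>2)" by (rule sum_mono2) (auto simp: B_def)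
  also have "\<dots> = (\<Sum>n=1..N. S\<^sup>2 - 2 * S * f n + (f n)\<^sup>2)"
    by (simp add: power2_diff algebra_simps)
  also have "\<dots> = N * S\<^sup>2 - 2 * S * (\<Sum>n=1..N. f n) + (\<Sum>n=1..N. (f n)\<^sup>2)"
    by (simp add: sum.distrib sum_subtractf sum_distrib_left)
  also have "\<dots> \<le> N * S\<^sup>2 - 2 * S * (N * S - card P) + (N * S\<^sup>2 + N * S)"
    using f1 f2 S by (intro add_mono diff_mono mult_left_mono) auto
  also have "\<dots> = (4 * N / S + 8 * card P / S) * (S / 2)\<^sup>2"
    using S by (simp add: field_simps power2_eq_square)
  finally show ?thesis unfolding B_def using S by (simp add: mult_le_cancel_right)
qed

section \<open>A calculus of upper densities\<close>

definition upper_density_le :: "nat set \<Rightarrow> real \<Rightarrow> bool" where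
  "upper_density_le A e \<longleftrightarrow> (\<forall>\<^sub>F N in sequentially. real (card (A \<inter> {1..N})) \<le> e * real N)"

text \<open>The inclusion is asked for positive integers only, because the counts ignore 0, where
  divisor sums degenerate.\<close>

lemma upper_density_le_mono:
  assumes "upper_density_le B e" "A \<inter> {1..} \<subseteq> B" "e \<le> e'"
  shows "upper_density_le A e'"
proof -
  have "real (card (A \<inter> {1..N})) \<le> e' * real N" if "real (card (B \<inter> {1..N})) \<le> e * real N" for N
  proof -
    have "card (A \<inter> {1..N}) \<le> card (B \<inter> {1..N})" using assms(2) by (intro card_mono) auto
    then have "real (card (A \<inter> {1..N})) \<le> e * N" using that by linarith
    also have "\<dots> \<le> e' * N" using assms(3) by (simp add: mult_right_mono)
    finally show ?thesis .
  qed
  then show ?thesis using assms(1) unfolding upper_density_le_def by (auto elim: eventually_mono)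
qed

lemma upper_density_le_Un:
  assumes "upper_density_le A e" "upper_density_le B e'"
  shows "upper_density_le (A \<union> B) (e + e')"
  using assms unfolding upper_density_le_def
proof eventually_elim
  case (elim N)
  have "card ((A \<union> B) \<inter> {1..N}) \<le> card (A \<inter> {1..N}) + card (B \<inter> {1..N})"
    unfolding Int_Un_distrib2 by (rule card_Un_le)
  then have "real (card ((A \<union> B) \<inter> {1..N})) \<le> e * N + e' * N" using elim by linarith
  then show ?case by (simp add: distrib_right)
qed

lemma upper_density_le_UN:
  assumes "finite I" "\<And>i. i \<in> I \<Longrightarrow> upper_density_le (A i) (e i)"
  shows "upper_density_le (\<Union>i\<in>I. A i) (\<Sum>i\<in>I. e i)"
  using assms
proof (induction I rule: finite_induct)
  case empty
  then show ?case by (simp add: upper_density_le_def)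
next
  case (insert i I)
  then show ?case using upper_density_le_Un[of "A i" "e i" "\<Union>i\<in>I. A i"] by simp
qed

lemma eventually_affine_le:
  fixes a b e :: real
  assumes "a < e"
  shows "\<forall>\<^sub>F N in sequentially. a * real N + b \<le> e * real N"
proof -
  obtain N0 :: nat where "real N0 \<ge> b / (e - a)" using real_arch_simple by blast
  then have "a * real N + b \<le> e * real N" if "N \<ge> N0" for N
  proof -
    have "b / (e - a) \<le> real N" using that \<open>real N0 \<ge> b / (e - a)\<close> by linarith
    then have "b \<le> real N * (e - a)" using assms by (simp add: field_simps)
    then show ?thesis by (simp add: algebra_simps)
  qed
  then show ?thesis using eventually_sequentially by blast
qed

text \<open>The strict slack between \<open>a\<close> and \<open>e\<close> absorbs the constant
  \<open>b\<close>, so boundary terms, however large, disappear here once and for all.\<close>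

lemma upper_density_le_affine:
  assumes "\<And>N. real (card (A \<inter> {1..N})) \<le> a * real N + b" "a < e"
  shows "upper_density_le A e"
  unfolding upper_density_le_def using eventually_affine_le[OF assms(2), of b]
  by eventually_elim (rule order_trans[OF assms(1)])

lemma upper_density_le_finite:
  assumes "finite A" "e > 0"
  shows "upper_density_le A e"
proof (rule upper_density_le_affine[where a = 0 and b = "card A"])
  show "real (card (A \<inter> {1..N})) \<le> 0 * real N + real (card A)" for N
    using assms(1) by (simp add: card_mono)
qed (use assms in auto)

lemma upper_density_few_prime_factors:
  assumes "finite P" "\<And>p. p \<in> P \<Longrightarrow> prime p" "(\<Sum>p\<in>P. 1 / real p) > 4 / e" "e > 0"
  shows "upper_density_le {n. card {p \<in> P. p dvd n} \<le> (\<Sum>p\<in>P. 1 / real p) / 2} e"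
proof -
  define S where "S = (\<Sum>p\<in>P. 1 / real p)"
  have S: "S > 4 / e" "S > 0" using assms by (auto simp: S_def intro: less_trans[of 0 "4 / e"])
  show ?thesis
  proof (rule upper_density_le_affine[where a = "4 / S" and b = "8 * card P / S"])
    fix N
    have "card ({n. card {p \<in> P. p dvd n} \<le> (\<Sum>p\<in>P. 1 / real p) / 2} \<inter> {1..N}) =
          card {n \<in> {1..N}. card {p \<in> P. p dvd n} \<le> S / 2}"
      unfolding S_def by (rule arg_cong[where f = card]) auto
    then show "card ({n. card {p \<in> P. p dvd n} \<le> (\<Sum>p\<in>P. 1 / real p) / 2} \<inter> {1..N}) \<le> 4 / S * real N + 8 * card P / S"
      using turan[OF assms(1,2), folded S_def, OF _ S(2), of N] by simp
  next
    show "4 / S < e" using S assms(4) by (simp add: field_simps)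
  qed
qed

lemma sum_inverse_squares_le:
  fixes z :: nat
  assumes "finite P" "\<And>p. p \<in> P \<Longrightarrow> p > z" "z > 0"
  shows "(\<Sum>p\<in>P. 1 / (real p)\<^sup>2) \<le> 1 / z"
proof -
  have "P \<subseteq> {Suc z..Suc z + Max (insert 0 P)}"
  proof
    fix p assume "p \<in> P"
    then have "p > z" "p \<le> Max (insert 0 P)" using assms by auto
    then show "p \<in> {Suc z..Suc z + Max (insert 0 P)}" by auto
  qed
  then have "(\<Sum>p\<in>P. 1 / (real p)\<^sup>2) \<le> (\<Sum>p=Suc z..Suc z + Max (insert 0 P). 1 / (real p)\<^sup>2)"
    by (intro sum_mono2) auto
  also have "\<dots> \<le> (\<Sum>p=Suc z..Suc z + Max (insert 0 P). 1 / real (p - 1) - 1 / real p)"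
  proof (rule sum_mono)
    fix p assume "p \<in> {Suc z..Suc z + Max (insert 0 P)}"
    then have p: "p > z" "p > 1" using assms(3) by auto
    have "1 / (real p)\<^sup>2 \<le> 1 / (real (p - 1) * real p)"
      using p by (intro frac_le) (auto simp: power2_eq_square intro!: mult_right_mono)
    also have "\<dots> = 1 / real (p - 1) - 1 / real p"
      using p by (simp add: field_simps of_nat_diff)
    finally show "1 / (real p)\<^sup>2 \<le> 1 / real (p - 1) - 1 / real p" .
  qed
  also have "\<dots> = 1 / z - 1 / (Suc z + Max (insert 0 P))"
  proof -
    have "(\<Sum>p=Suc z..Suc z + k. 1 / real (p - 1) - 1 / real p) = 1 / z - 1 / real (Suc z + k)" for k
      by (induction k) auto
    then show ?thesis by simp
  qed
  finally show ?thesis by (smt (verit) divide_nonneg_nonneg of_nat_0_le_iff)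
qed

section \<open>Divisibility of the divisor sum by a fixed modulus\<close>

definition divisor_sum :: "nat \<Rightarrow> nat" where
  "divisor_sum n = (\<Sum>d | d dvd n. d)"

lemma divisor_sum_pos: "n > 0 \<Longrightarrow> divisor_sum n > 0"
  unfolding divisor_sum_def by (rule sum_pos2[of _ n]) auto

lemma divisor_sum_eq: "n > 0 \<Longrightarrow> divisor_sum n = sum_proper_divisors n + n"
proof -
  assume "n > 0"
  then have "{d. d dvd n} = insert n {d. d dvd n \<and> d < n}" by (auto dest: dvd_imp_le)
  then show ?thesis using \<open>n > 0\<close>
    by (simp add: divisor_sum_def sum_proper_divisors_def)
qed

text \<open>An exact prime divisor \<open>p\<close> splits off the factor \<open>1 + p\<close>, a
  multiple of \<open>q\<close>, and the remaining members of \<open>F\<close> stay exact divisors of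
  the cofactor.\<close>

lemma power_card_dvd_divisor_sum:
  assumes "finite F" "n > 0" "\<And>p. p \<in> F \<Longrightarrow> prime p \<and> p dvd n \<and> \<not> p\<^sup>2 dvd n \<and> [p + 1 = 0] (mod q)"
  shows "q ^ card F dvd divisor_sum n"
  using assms
proof (induction F arbitrary: n rule: finite_induct)
  case (insert p F)
  then obtain n' where n: "n = p * n'" by (metis insertI1 dvdE)
  have p: "prime p" "\<not> p dvd n'" using insert.prems(2)[of p] n by (auto simp: power2_eq_square)
  have "q ^ card F dvd divisor_sum n'"
  proof (rule insert.IH)
    show "n' > 0" using n insert.prems(1) by simp
    fix r assume r: "r \<in> F"
    then have r': "prime r" "r dvd p * n'" "\<not> r\<^sup>2 dvd p * n'" "[r + 1 = 0] (mod q)"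
      using insert.prems(2)[of r] n by auto
    have "r \<noteq> p" using r insert.hyps by auto
    then have "\<not> r dvd p" using p(1) r'(1) primes_dvd_imp_eq by blast
    then show "prime r \<and> r dvd n' \<and> \<not> r\<^sup>2 dvd n' \<and> [r + 1 = 0] (mod q)"
      using r' by (auto simp: prime_dvd_mult_iff)
  qed
  moreover have "divisor_sum n = (1 + p) * divisor_sum n'"
    using sum_divisors_prime_power_mult[OF p, of "\<lambda>d. d" 1]
    by (simp add: divisor_sum_def n sum_distrib_left sum.distrib)
  moreover have "q dvd 1 + p" using insert.prems(2)[of p] by (simp add: cong_0_iff)
  ultimately have "q * q ^ card F dvd divisor_sum n" by (metis mult_dvd_mono)
  then show ?case using insert.hyps by simp
qed simp

lemma upper_density_not_prime_power_dvd_divisor_sum: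
  assumes q: "prime q" and e: "e > 0"
  shows "upper_density_le {n. \<not> q ^ k dvd divisor_sum n} e"
proof -
  obtain z :: nat where z: "real z > 4 / e" using reals_Archimedean2 by blast
  then have z0: "z > 0" using e by (auto intro!: Nat.gr0I)
  have nd: "\<not> q dvd q - 1" using q prime_gt_1_nat[of q] by (auto dest: dvd_imp_le)
  \<comment> \<open>The residue \<open>q - 1\<close> makes \<open>q\<close> divide
    \<open>p + 1\<close>. A reciprocal sum of at least \<open>2 * k\<close> turns more than
    \<open>S / 2\<close> prime divisors into at least \<open>k\<close>, and \<open>16 / e\<close>
    exceeds the \<open>4 / (e / 2)\<close> that Turan's bound asks for. The choice
    \<open>z > 4 / e\<close> keeps the multiples of some \<open>p\<^sup>2\<close> below density
    \<open>e / 2\<close>.\<close>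
  obtain P where P: "finite P" "\<And>p. p \<in> P \<Longrightarrow> prime p \<and> [p = q - 1] (mod q) \<and> p > z"
    "(\<Sum>p\<in>P. 1 / real p) \<ge> max (2 * real k) (16 / e)"
  proof (rule dirichlet_prime_modulus[OF q nd, of z "max (2 * real k) (16 / e)"])
    fix P assume "finite P" and *: "\<And>p. p \<in> P \<Longrightarrow> prime p \<and> [p = q - 1] (mod q) \<and> p > z"
      and "(\<Sum>p\<in>P. 1 / real p) \<ge> max (2 * real k) (16 / e)"
    from this(1) * this(3) show ?thesis by (rule that)
  qed
  define S where "S = (\<Sum>p\<in>P. 1 / real p)"
  have 1: "upper_density_le {n. card {p \<in> P. p dvd n} \<le> S / 2} (e / 2)"
    unfolding S_def
  proof (rule upper_density_few_prime_factors)
    have "4 / (e / 2) < 16 / e" using e by (simp add: field_simps)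
    then show "4 / (e / 2) < (\<Sum>p\<in>P. 1 / real p)" using P(3) by simp
  qed (use P e in auto)
  have 2: "upper_density_le {n. \<exists>p\<in>P. p\<^sup>2 dvd n} (e / 2)"
  proof (rule upper_density_le_affine[where a = "1 / z" and b = 0])
    fix N
    have "{n. \<exists>p\<in>P. p\<^sup>2 dvd n} \<inter> {1..N} = (\<Union>p\<in>P. {n \<in> {1..N}. p\<^sup>2 dvd n})" by auto
    then have "card ({n. \<exists>p\<in>P. p\<^sup>2 dvd n} \<inter> {1..N}) \<le> (\<Sum>p\<in>P. card {n \<in> {1..N}. p\<^sup>2 dvd n})"
      using card_UN_le[OF P(1)] by metis
    then have "real (card ({n. \<exists>p\<in>P. p\<^sup>2 dvd n} \<inter> {1..N})) \<le> real (\<Sum>p\<in>P. card {n \<in> {1..N}. p\<^sup>2 dvd n})"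
      by (simp only: of_nat_le_iff)
    also have "\<dots> = (\<Sum>p\<in>P. real (card {n \<in> {1..N}. p\<^sup>2 dvd n}))" by (rule of_nat_sum)
    also have "\<dots> \<le> (\<Sum>p\<in>P. real N / real (p\<^sup>2))" by (intro sum_mono card_multiples_le)
    also have "\<dots> = N * (\<Sum>p\<in>P. 1 / (real p)\<^sup>2)" by (simp add: sum_distrib_left)
    also have "\<dots> \<le> N * (1 / z)"
      using P z0 by (intro mult_left_mono sum_inverse_squares_le) auto
    finally show "real (card ({n. \<exists>p\<in>P. p\<^sup>2 dvd n} \<inter> {1..N})) \<le> 1 / real z * real N + 0" by simp
  next
    have "1 / real z < e / 4" using z e z0 by (simp add: field_simps)
    then show "1 / real z < e / 2" using e by simp
  qed
  have "upper_density_le ({n. card {p \<in> P. p dvd n} \<le> S / 2} \<union> {n. \<exists>p\<in>P. p\<^sup>2 dvd n}) (e / 2 + e / 2)"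
    by (rule upper_density_le_Un[OF 1 2])
  then show ?thesis
  proof (rule upper_density_le_mono)
    show "{n. \<not> q ^ k dvd divisor_sum n} \<inter> {1..} \<subseteq>
      {n. card {p \<in> P. p dvd n} \<le> S / 2} \<union> {n. \<exists>p\<in>P. p\<^sup>2 dvd n}"
    proof (intro subsetI, rule ccontr)
      fix n assume *: "n \<in> {n. \<not> q ^ k dvd divisor_sum n} \<inter> {1..}"
        "n \<notin> {n. card {p \<in> P. p dvd n} \<le> S / 2} \<union> {n. \<exists>p\<in>P. p\<^sup>2 dvd n}"
      have n: "n > 0" "\<not> q ^ k dvd divisor_sum n" "card {p \<in> P. p dvd n} > S / 2"
        "\<not> (\<exists>p\<in>P. p\<^sup>2 dvd n)" using * by (auto simp: not_le)
      define F where "F = {p \<in> P. p dvd n}"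
      have "q ^ card F dvd divisor_sum n"
      proof (rule power_card_dvd_divisor_sum)
        fix p assume p: "p \<in> F"
        then have "[p + 1 = (q - 1) + 1] (mod q)" using P(2)[of p] by (intro cong_add) (auto simp: F_def)
        then have "[p + 1 = 0] (mod q)" using prime_gt_0_nat[OF q] by (simp add: cong_def)
        then show "prime p \<and> p dvd n \<and> \<not> p\<^sup>2 dvd n \<and> [p + 1 = 0] (mod q)"
          using p P(2)[of p] n(4) by (auto simp: F_def)
      qed (use P n in \<open>auto simp: F_def\<close>)
      moreover have "k \<le> card F" using n(3) P(3) unfolding F_def S_def by linarith
      ultimately show False using n(2) by (meson dvd_trans le_imp_power_dvd)
    qed
  qed simp
qed

lemma upper_density_not_dvd_divisor_sum:
  assumes M: "M > 0" and e: "e > 0"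
  shows "upper_density_le {n. \<not> M dvd divisor_sum n} e"
proof -
  define Q where "Q = prime_factors M"
  have fin: "finite Q" by (simp add: Q_def)
  \<comment> \<open>Equal shares of \<open>e\<close> for the prime factors; the \<open>Suc\<close>
    spares a separate case for \<open>M = 1\<close>.\<close>
  have "upper_density_le (\<Union>q\<in>Q. {n. \<not> q ^ multiplicity q M dvd divisor_sum n}) (\<Sum>q\<in>Q. e / Suc (card Q))"
    by (rule upper_density_le_UN[OF fin], rule upper_density_not_prime_power_dvd_divisor_sum)
       (use e in \<open>auto simp: Q_def\<close>)
  then show ?thesis
  proof (rule upper_density_le_mono)
    show "{n. \<not> M dvd divisor_sum n} \<inter> {1..} \<subseteq> (\<Union>q\<in>Q. {n. \<not> q ^ multiplicity q M dvd divisor_sum n})"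
    proof (intro subsetI, rule ccontr)
      fix n assume *: "n \<in> {n. \<not> M dvd divisor_sum n} \<inter> {1..}"
        "n \<notin> (\<Union>q\<in>Q. {n. \<not> q ^ multiplicity q M dvd divisor_sum n})"
      have n: "n > 0" "\<not> M dvd divisor_sum n" "\<forall>q\<in>Q. q ^ multiplicity q M dvd divisor_sum n"
        using * by auto
      have "M dvd divisor_sum n"
      proof (rule multiplicity_le_imp_dvd)
        fix p assume p: "prime (p::nat)"
        show "multiplicity p M \<le> multiplicity p (divisor_sum n)"
        proof (cases "p dvd M")
          case True
          then have "p \<in> Q" using p M by (auto simp: Q_def prime_factors_dvd)
          then show ?thesis using n(3) p divisor_sum_pos[OF n(1)]
            by (intro multiplicity_geI) auto
        qed (simp add: not_dvd_imp_multiplicity_0)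
      qed (use M in auto)
      then show False using n(2) by simp
    qed
    show "(\<Sum>q\<in>Q. e / Suc (card Q)) \<le> e" using e by (simp add: field_simps)
  qed
qed

text \<open>Residue 1 modulo 2 means the odd primes, so Dirichlet's theorem and Turan's bound
  already contain this. It is what later yields \<open>s(n) \<ge> n div D\<close>.\<close>

lemma upper_density_no_small_prime_factor:
  assumes e: "e > 0"
  obtains D :: nat where "D > 0" "upper_density_le {n. \<not> (\<exists>p\<le>D. prime p \<and> p dvd n)} e"
proof -
  have "\<not> 2 dvd (1::nat)" by simp
  then obtain P where P: "finite P" "\<And>p. p \<in> P \<Longrightarrow> prime p \<and> [p = 1] (mod 2) \<and> p > 0"
    "(\<Sum>p\<in>P. 1 / real p) \<ge> 8 / e"
    using dirichlet_prime_modulus[OF two_is_prime_nat] by metis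
  have "upper_density_le {n. card {p \<in> P. p dvd n} \<le> (\<Sum>p\<in>P. 1 / real p) / 2} e"
  proof (rule upper_density_few_prime_factors)
    have "4 / e < 8 / e" using e by (simp add: field_simps)
    then show "4 / e < (\<Sum>p\<in>P. 1 / real p)" using P(3) by linarith
  qed (use P e in auto)
  \<comment> \<open>The sum of \<open>P\<close> is a convenient upper bound for its members, and
    \<open>Suc\<close> makes it positive.\<close>
  then have "upper_density_le {n. \<not> (\<exists>p\<le>Suc (\<Sum>P). prime p \<and> p dvd n)} e"
  proof (rule upper_density_le_mono)
    show "{n. \<not> (\<exists>p\<le>Suc (\<Sum>P). prime p \<and> p dvd n)} \<inter> {1..} \<subseteq>
        {n. card {p \<in> P. p dvd n} \<le> (\<Sum>p\<in>P. 1 / real p) / 2}"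
    proof safe
      fix n assume n: "\<not> (\<exists>p\<le>Suc (\<Sum>P). prime p \<and> p dvd n)"
      have "p \<le> Suc (\<Sum>P)" if "p \<in> P" for p
        using member_le_sum[of p P "\<lambda>x. x"] that P(1) by simp
      then have "{p \<in> P. p dvd n} = {}" using n P(2) by auto
      then have "card {p \<in> P. p dvd n} = 0" by (simp only: card.empty)
      then show "real (card {p \<in> P. p dvd n}) \<le> (\<Sum>p\<in>P. 1 / real p) / 2"
        by (simp only:) (simp add: sum_nonneg)
    qed
  qed simp
  then show ?thesis using that by blast
qed

section \<open>Digits\<close>

definition low_digits :: "nat \<Rightarrow> nat \<Rightarrow> nat \<Rightarrow> nat list" where
  "low_digits g j n = map (\<lambda>i. (n div g ^ i) mod g) (rev [0..<j])"

text \<open>Digits padded with leading zeros, unlike \<open>base_expansion\<close>; this makes the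
  set a function of the residue modulo \<open>g ^ K\<close>.\<close>

definition digit_set :: "nat \<Rightarrow> nat \<Rightarrow> nat \<Rightarrow> nat set" where
  "digit_set g K n = (\<lambda>i. (n div g ^ i) mod g) ` {..<K}"

lemma length_low_digits [simp]: "length (low_digits g j n) = j"
  by (simp add: low_digits_def)

lemma set_low_digits: "set (low_digits g j n) = digit_set g j n"
  by (simp add: low_digits_def digit_set_def atLeast0LessThan)

lemma base_expansion_append:
  assumes "g \<ge> 2" "n div g ^ j > 0"
  shows "base_expansion g n = base_expansion g (n div g ^ j) @ low_digits g j n"
  using assms(2)
proof (induction j)
  case (Suc j)
  have eq: "n div g ^ Suc j = n div g ^ j div g"
    by (simp add: div_mult2_eq[symmetric] mult.commute)
  have pos: "n div g ^ j div g > 0" using Suc.prems unfolding eq .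
  then have ge: "\<not> n div g ^ j < g" by auto
  then have "n div g ^ j > 0" using assms(1) by linarith
  then have "base_expansion g n = base_expansion g (n div g ^ j) @ low_digits g j n"
    by (rule Suc.IH)
  also have "base_expansion g (n div g ^ j) = base_expansion g (n div g ^ Suc j) @ [n div g ^ j mod g]"
    unfolding eq using ge assms(1) by (subst base_expansion.simps) auto
  finally show ?case by (simp add: low_digits_def)
qed (simp add: low_digits_def)

lemma set_last_digits:
  assumes "g \<ge> 2" "n \<ge> g ^ K"
  shows "set (last_digits g K n) = digit_set g K n"
proof -
  have "n div g ^ K > 0" using assms by (simp add: div_greater_zero_iff)
  from base_expansion_append[OF assms(1) this]
  show ?thesis by (simp add: last_digits_def set_low_digits)
qed

text \<open>The bounds say that the block \<open>n div g ^ j\<close> has exactly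
  \<open>Suc K\<close> digits, so padding cannot smuggle in a zero.\<close>

lemma set_first_digits:
  assumes g: "g \<ge> 2" and a: "n div g ^ j \<ge> g ^ K" "n div g ^ j < g ^ Suc K"
  shows "set (first_digits g (Suc K) n) = digit_set g (Suc K) (n div g ^ j)"
proof -
  define a where "a = n div g ^ j"
  have "g ^ K > 0" using g by simp
  then have "a > 0" using a unfolding a_def by linarith
  then have n: "base_expansion g n = base_expansion g a @ low_digits g j n"
    unfolding a_def by (rule base_expansion_append[OF g])
  have top: "a div g ^ K > 0" "a div g ^ K < g"
    using a \<open>g ^ K > 0\<close> unfolding a_def[symmetric] 
    by (auto simp: div_greater_zero_iff less_mult_imp_div_less)
  have "base_expansion g a = base_expansion g (a div g ^ K) @ low_digits g K a"
    by (rule base_expansion_append[OF g top(1)])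
  also have "base_expansion g (a div g ^ K) = [a div g ^ K]"
    using top by (simp add: base_expansion.simps)
  finally have a': "base_expansion g a = [a div g ^ K] @ low_digits g K a" .
  have "first_digits g (Suc K) n = [a div g ^ K] @ low_digits g K a"
    unfolding first_digits_def n a' by simp
  then have "set (first_digits g (Suc K) n) = insert (a div g ^ K) (digit_set g K a)"
    by (simp add: set_low_digits)
  also have "\<dots> = digit_set g (Suc K) a"
    using top by (simp add: digit_set_def lessThan_Suc)
  finally show ?thesis unfolding a_def .
qed

lemma digit_set_mod:
  assumes "g > 0"
  shows "digit_set g K (n mod g ^ K) = digit_set g K n"
  unfolding digit_set_def
proof (rule image_cong[OF refl])
  fix i assume "i \<in> {..<K}"
  then have "K = i + Suc (K - Suc i)" by auto
  then have K: "g ^ K = g ^ i * (g * g ^ (K - Suc i))" by (metis power_Suc power_add)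
  have "n div g ^ i mod g = (n mod g ^ K + g ^ K * (n div g ^ K)) div g ^ i mod g" by simp
  also have "n mod g ^ K + g ^ K * (n div g ^ K)
      = n mod g ^ K + g ^ i * (g * (g ^ (K - Suc i) * (n div g ^ K)))"
    by (subst (2) K) (simp only: mult.assoc)
  also have "\<dots> div g ^ i = g * (g ^ (K - Suc i) * (n div g ^ K)) + n mod g ^ K div g ^ i"
    using assms by (subst div_mult_self2) auto
  also have "\<dots> mod g = n mod g ^ K div g ^ i mod g" by simp
  finally show "n mod g ^ K div g ^ i mod g = n div g ^ i mod g" ..
qed

section \<open>Digit strings that miss a digit\<close>

lemma card_avoiding_digit_le:
  assumes "g > 0" "d < g"
  shows "card {r. r < g ^ K \<and> d \<notin> digit_set g K r} \<le> (g - 1) ^ K"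
proof (induction K)
  case (Suc K)
  define A where "A K = {r. r < g ^ K \<and> d \<notin> digit_set g K r}" for K
  have fin: "finite (A K)" for K unfolding A_def by (rule finite_subset[of _ "{..<g ^ K}"]) auto
  have "card (A (Suc K)) \<le> card (A K \<times> ({..<g} - {d}))"
  proof (rule card_inj_on_le)
    show "inj_on (\<lambda>r. (r div g, r mod g)) (A (Suc K))"
      by (rule inj_onI) (metis div_mult_mod_eq prod.inject)
    show "(\<lambda>r. (r div g, r mod g)) ` A (Suc K) \<subseteq> A K \<times> ({..<g} - {d})"
    proof safe
      fix r assume r: "r \<in> A (Suc K)"
      have "digit_set g (Suc K) r = insert (r mod g) (digit_set g K (r div g))"
        unfolding digit_set_def lessThan_Suc_eq_insert_0 
        by (auto simp: image_image div_mult2_eq)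
      then show "r div g \<in> A K"
        using r assms by (auto simp: A_def less_mult_imp_div_less mult.commute)
      show "r mod g < g" using assms by simp
      show False if "d = r mod g"
        using r that \<open>digit_set g (Suc K) r = _\<close> by (auto simp: A_def)
    qed
  qed (use fin in auto)
  also have "\<dots> = card (A K) * (g - 1)"
    using assms by (simp add: card_cartesian_product)
  also have "\<dots> \<le> (g - 1) ^ K * (g - 1)" using Suc unfolding A_def by simp
  finally show ?case unfolding A_def by (simp add: mult.commute)
next
  case 0
  have "card {r. r < g ^ 0 \<and> d \<notin> digit_set g 0 r} \<le> card {0::nat}"
    by (intro card_mono) auto
  then show ?case by simp
qed

definition deficient :: "nat \<Rightarrow> nat \<Rightarrow> nat set" where
  "deficient g K = {r. r < g ^ K \<and> \<not> {0..<g} \<subseteq> digit_set g K r}"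

lemma finite_deficient [simp]: "finite (deficient g K)"
  unfolding deficient_def by (rule finite_subset[of _ "{..<g ^ K}"]) auto

lemma card_deficient_le:
  assumes "g > 0"
  shows "card (deficient g K) \<le> g * (g - 1) ^ K"
proof -
  have "deficient g K \<subseteq> (\<Union>d<g. {r. r < g ^ K \<and> d \<notin> digit_set g K r})"
    by (auto simp: deficient_def)
  then have "card (deficient g K) \<le> card (\<Union>d<g. {r. r < g ^ K \<and> d \<notin> digit_set g K r})"
    by (rule card_mono[rotated]) auto
  also have "\<dots> \<le> (\<Sum>d<g. card {r. r < g ^ K \<and> d \<notin> digit_set g K r})"
    by (rule card_UN_le) simp
  also have "\<dots> \<le> (\<Sum>d<g. (g - 1) ^ K)"
    by (intro sum_mono card_avoiding_digit_le) (use assms in auto)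
  finally show ?thesis by simp
qed

text \<open>A union bound over the missing digit gives the proportion at most
  \<open>g * ((g - 1) / g) ^ Suc K\<close>, a null sequence.\<close>

lemma deficient_proportion_small:
  assumes "g \<ge> 2" "e > 0"
  obtains K where "real (card (deficient g (Suc K))) / real g ^ Suc K < e"
proof -
  define x where "x = (real g - 1) / real g"
  have "(\<lambda>n. g * x ^ n) \<longlonglongrightarrow> real g * 0"
    using assms by (intro tendsto_intros LIMSEQ_realpow_zero) (auto simp: x_def field_simps)
  then have "\<forall>\<^sub>F n in sequentially. g * x ^ n < e" using assms(2) by (simp add: order_tendsto_iff)
  then obtain n0 where "\<And>n. n \<ge> n0 \<Longrightarrow> g * x ^ n < e" by (auto simp: eventually_sequentially)
  then have *: "g * x ^ Suc n0 < e" by (meson le_SucI order_refl)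
  have "real (card (deficient g (Suc n0))) \<le> real (g * (g - 1) ^ Suc n0)"
    using card_deficient_le[of g "Suc n0"] assms by (simp only: of_nat_le_iff)
  also have "\<dots> = g * (real g - 1) ^ Suc n0" using assms by (simp add: of_nat_diff)
  finally have "real (card (deficient g (Suc n0))) / real g ^ Suc n0 \<le> g * x ^ Suc n0"
    using assms by (simp add: x_def power_divide divide_right_mono del: power_Suc)
  then show ?thesis using * that by (meson order_le_less_trans)
qed

section \<open>Residue classes in intervals, and the last digits\<close>

lemma card_residue_interval_le:
  fixes a b :: real
  assumes "M > 0" "a \<le> b"
  shows "finite {n::nat. a \<le> n \<and> n \<le> b \<and> n mod M = r}" (is "finite ?A")
    and "card {n::nat. a \<le> n \<and> n \<le> b \<and> n mod M = r} \<le> (b - a) / M + 1"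
proof -
  define a' b' where "a' = (a - r) / M" and "b' = (b - r) / M"
  have "?A \<subseteq> {..nat \<lfloor>b\<rfloor>}" by (auto simp: le_nat_floor)
  then show fin: "finite ?A" using finite_subset by blast
  have inj: "inj_on (\<lambda>n. int (n div M)) ?A"
    by (rule inj_onI) (metis (mono_tags, lifting) div_mult_mod_eq mem_Collect_eq of_nat_eq_iff)
  have sub: "(\<lambda>n. int (n div M)) ` ?A \<subseteq> {\<lceil>a'\<rceil>..\<lfloor>b'\<rfloor>}"
  proof safe
    fix n assume n: "a \<le> real n" "real n \<le> b" "r = n mod M"
    have "real n = real (n div M) * M + r"
      using n(3) by (metis div_mult_mod_eq of_nat_add of_nat_mult)
    then have "a' \<le> real (n div M)" "real (n div M) \<le> b'"
      using n assms by (auto simp: a'_def b'_def field_simps)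
    then show "int (n div M) \<in> {\<lceil>a'\<rceil>..\<lfloor>b'\<rfloor>}" by (simp add: ceiling_le_iff le_floor_iff)
  qed
  have "card ?A = card ((\<lambda>n. int (n div M)) ` ?A)" by (rule card_image[OF inj, symmetric])
  also have "\<dots> \<le> card {\<lceil>a'\<rceil>..\<lfloor>b'\<rfloor>}" by (rule card_mono[OF _ sub]) simp
  also have "\<dots> = nat (\<lfloor>b'\<rfloor> - \<lceil>a'\<rceil> + 1)" by simp
  finally have "real (card ?A) \<le> real (nat (\<lfloor>b'\<rfloor> - \<lceil>a'\<rceil> + 1))" by simp
  also have "\<dots> \<le> b' - a' + 1"
  proof -
    have "a' \<le> b'" using assms by (simp add: a'_def b'_def divide_right_mono)
    moreover have "real_of_int \<lfloor>b'\<rfloor> \<le> b'" "real_of_int \<lceil>a'\<rceil> \<ge> a'" by simp_all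
    ultimately show ?thesis by linarith
  qed
  also have "b' - a' = (b - a) / M" by (simp add: a'_def b'_def diff_divide_distrib[symmetric])
  finally show "card ?A \<le> (b - a) / M + 1" .
qed

lemma upper_density_residues:
  assumes "M > 0" "finite R" "card R / M < e"
  shows "upper_density_le {n. n mod M \<in> R} e"
proof (rule upper_density_le_affine[where a = "card R / M" and b = "card R"])
  fix N
  have "{n. n mod M \<in> R} \<inter> {1..N} \<subseteq> (\<Union>r\<in>R. {n. 0 \<le> real n \<and> real n \<le> real N \<and> n mod M = r})"
    by auto
  then have "card ({n. n mod M \<in> R} \<inter> {1..N}) \<le> card (\<Union>r\<in>R. {n. 0 \<le> real n \<and> real n \<le> real N \<and> n mod M = r})"
    by (rule card_mono[rotated]) (intro finite_UN_I assms card_residue_interval_le, auto)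
  also have "\<dots> \<le> (\<Sum>r\<in>R. card {n. 0 \<le> real n \<and> real n \<le> real N \<and> n mod M = r})"
    by (rule card_UN_le[OF assms(2)])
  finally have "real (card ({n. n mod M \<in> R} \<inter> {1..N})) \<le>
      real (\<Sum>r\<in>R. card {n. 0 \<le> real n \<and> real n \<le> real N \<and> n mod M = r})"
    by (simp only: of_nat_le_iff)
  also have "\<dots> \<le> (\<Sum>r\<in>R. (real N - 0) / M + 1)"
    unfolding of_nat_sum by (intro sum_mono card_residue_interval_le assms) auto
  finally show "real (card ({n. n mod M \<in> R} \<inter> {1..N})) \<le> card R / M * real N + card R"
    by (simp add: algebra_simps)
qed (use assms in auto)

lemma sum_proper_divisors_ge:
  assumes "prime p" "p dvd n" "p \<le> D" "n > 0"
  shows "sum_proper_divisors n \<ge> n div D"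
proof -
  have p: "p > 1" using assms(1) prime_gt_1_nat by blast
  have "n div D \<le> n div p" using assms(3) p by (intro div_le_mono2) auto
  also have "\<dots> \<le> sum_proper_divisors n"
    unfolding sum_proper_divisors_def
  proof (rule member_le_sum)
    have "n div p dvd n" "n div p < n" using assms p by (auto simp: dvd_div_iff_mult)
    then show "n div p \<in> {d. d dvd n \<and> d < n}" by simp
  qed auto
  finally show ?thesis .
qed

lemma upper_density_last_digits:
  assumes g: "g \<ge> 2" and e: "e > 0"
  shows "\<exists>K. upper_density_le {n. \<not> {0..<g} \<subseteq> set (last_digits g K (sum_proper_divisors n))} e"
proof -
  have "e / 4 > 0" using e by simp
  obtain K0 where K0: "real (card (deficient g (Suc K0))) / real g ^ Suc K0 < e / 4"
    using deficient_proportion_small[OF g \<open>e / 4 > 0\<close>] .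
  obtain D where D: "D > 0" "upper_density_le {n. \<not> (\<exists>p\<le>D. prime p \<and> p dvd n)} (e / 4)"
    using upper_density_no_small_prime_factor[OF \<open>e / 4 > 0\<close>] .
  define K where "K = Suc K0"
  define M where "M = g ^ K"
  have M: "M > 0" using g by (simp add: M_def)
  \<comment> \<open>The outer \<open>mod M\<close> matters for \<open>r = 0\<close> only: it makes
    the map negation modulo \<open>M\<close>, an injection on residues.\<close>
  define R where "R = {r. r < M \<and> (M - r) mod M \<in> deficient g K}"
  have finR: "finite R" unfolding R_def by (rule finite_subset[of _ "{..<M}"]) auto
  have "card R \<le> card (deficient g K)"
  proof (rule card_inj_on_le)
    show "inj_on (\<lambda>r. (M - r) mod M) R"
    proof (rule inj_onI)
      fix r s assume rs: "r \<in> R" "s \<in> R" "(M - r) mod M = (M - s) mod M"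
      have "[r + s + (M - r) = r + s + (M - s)] (mod M)"
        using rs(3) by (intro cong_add) (auto simp: cong_def)
      moreover have "r + s + (M - r) = s + M" "r + s + (M - s) = r + M" using rs(1,2) by (auto simp: R_def)
      ultimately have "s mod M = r mod M" by (simp add: cong_def)
      moreover have "r < M" "s < M" using rs(1,2) by (simp_all add: R_def)
      ultimately show "r = s" by simp
    qed
  qed (auto simp: R_def)
  then have "real (card R) / M \<le> real (card (deficient g K)) / M"
    by (simp add: divide_right_mono)
  also have "\<dots> < e / 4" using K0 by (simp add: M_def K_def)
  finally have R: "upper_density_le {n. n mod M \<in> R} (e / 4)"
    by (rule upper_density_residues[OF M finR])
  have sig: "upper_density_le {n. \<not> M dvd divisor_sum n} (e / 4)"
    using M e by (intro upper_density_not_dvd_divisor_sum) auto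
  \<comment> \<open>Beyond \<open>D * M\<close> one has \<open>n div D \<ge> M\<close>, so
    \<open>s(n)\<close> is long enough for \<open>set_last_digits\<close>.\<close>
  have small: "upper_density_le {..<D * M} (e / 4)"
    using e by (intro upper_density_le_finite) auto
  have "upper_density_le (({n. \<not> M dvd divisor_sum n} \<union> {n. \<not> (\<exists>p\<le>D. prime p \<and> p dvd n)}) \<union>
      ({..<D * M} \<union> {n. n mod M \<in> R})) ((e / 4 + e / 4) + (e / 4 + e / 4))"
    by (intro upper_density_le_Un sig D small R)
  then have "upper_density_le {n. \<not> {0..<g} \<subseteq> set (last_digits g K (sum_proper_divisors n))} e"
  proof (rule upper_density_le_mono)
    show "{n. \<not> {0..<g} \<subseteq> set (last_digits g K (sum_proper_divisors n))} \<inter> {1..} \<subseteq>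
      ({n. \<not> M dvd divisor_sum n} \<union> {n. \<not> (\<exists>p\<le>D. prime p \<and> p dvd n)}) \<union>
      ({..<D * M} \<union> {n. n mod M \<in> R})"
    proof (intro subsetI, rule ccontr)
      fix n assume n1: "n \<in> {n. \<not> {0..<g} \<subseteq> set (last_digits g K (sum_proper_divisors n))} \<inter> {1..}"
        and n2: "n \<notin> ({n. \<not> M dvd divisor_sum n} \<union> {n. \<not> (\<exists>p\<le>D. prime p \<and> p dvd n)}) \<union>
          ({..<D * M} \<union> {n. n mod M \<in> R})"
      define s where "s = sum_proper_divisors n"
      have n: "n > 0" "\<not> {0..<g} \<subseteq> set (last_digits g K s)" using n1 by (auto simp: s_def)
      have M_dvd: "M dvd s + n" using n2 divisor_sum_eq[OF n(1)] by (auto simp: s_def)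
      have big: "D * M \<le> n" and nR: "n mod M \<notin> R" using n2 by auto
      obtain p where p: "p \<le> D" "prime p" "p dvd n" using n2 by auto
      have "M \<le> n div D" using big D(1) by (simp add: less_eq_div_iff_mult_less_eq mult.commute)
      also have "\<dots> \<le> s" unfolding s_def by (rule sum_proper_divisors_ge) (use p n in auto)
      finally have "set (last_digits g K s) = digit_set g K s"
        unfolding M_def by (rule set_last_digits[OF g])
      then have "s mod M \<in> deficient g K"
        using n(2) M g by (simp add: deficient_def M_def digit_set_mod)
      moreover have "s mod M = (M - n mod M) mod M"
      proof -
        have lt: "n mod M < M" using M by simp
        have "[s + n = 0] (mod M)" using M_dvd by (simp add: cong_0_iff)
        moreover have "[(M - n mod M) + n = (M - n mod M) + n mod M] (mod M)"
          by (intro cong_add) (auto simp: cong_def)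
        then have "[(M - n mod M) + n = 0] (mod M)"
          using lt by (simp add: cong_def)
        ultimately have "[s + n = (M - n mod M) + n] (mod M)" by (metis cong_sym cong_trans)
        then have "[s = M - n mod M] (mod M)" by (simp only: cong_add_rcancel_nat)
        then show ?thesis by (simp add: cong_def)
      qed
      ultimately have "n mod M \<in> R" using M by (simp add: R_def)
      then show False using nR by simp
    qed
  qed simp
  then show ?thesis by blast
qed

section \<open>Leading digits\<close>

text \<open>Complementary divisors give \<open>\<sigma>(n) / n\<close> as the sum of
  \<open>1 / d\<close>; starting at 2 omits the term of \<open>n\<close> itself, which
  \<open>s(n)\<close> excludes.\<close>

definition trunc_abundancy :: "nat \<Rightarrow> nat \<Rightarrow> real" where
  "trunc_abundancy y n = (\<Sum>d=2..y. if d dvd n then 1 / real d else 0)"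

definition abundancy_tail :: "nat \<Rightarrow> nat \<Rightarrow> real" where
  "abundancy_tail y n = (\<Sum>d | d dvd n \<and> d > y. 1 / real d)"

lemma abundancy_tail_nonneg: "abundancy_tail y n \<ge> 0"
  unfolding abundancy_tail_def by (rule sum_nonneg) simp

lemma sum_proper_divisors_eq_abundancy:
  assumes "n > 0" "y \<ge> 1"
  shows "real (sum_proper_divisors n) = n * (trunc_abundancy y n + abundancy_tail y n)"
proof -
  have fin: "finite {d. d dvd n}" using assms by simp
  have "real (divisor_sum n) = (\<Sum>d | d dvd n. real d)"
    by (simp add: divisor_sum_def)
  also have "\<dots> = (\<Sum>d | d dvd n. real (n div d))"
    by (rule sum.reindex_bij_witness[of _ "\<lambda>d. n div d" "\<lambda>d. n div d"]) (use assms in auto)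
  also have "\<dots> = n * (\<Sum>d | d dvd n. 1 / real d)"
    by (simp add: sum_distrib_left real_of_nat_div)
  also have "{d. d dvd n} = insert 1 ({d \<in> {2..y}. d dvd n} \<union> {d. d dvd n \<and> d > y})"
    using assms by (auto simp: Suc_le_eq)
  also have "(\<Sum>d\<in>\<dots>. 1 / real d) = 1 + (trunc_abundancy y n + abundancy_tail y n)"
  proof -
    have "(\<Sum>d\<in>{d \<in> {2..y}. d dvd n} \<union> {d. d dvd n \<and> d > y}. 1 / real d) 
       = trunc_abundancy y n + abundancy_tail y n"
      unfolding trunc_abundancy_def abundancy_tail_def sum.inter_filter[OF finite_atLeastAtMost, symmetric]
      by (rule sum.union_disjoint) (use fin in auto)
    moreover have "finite ({d \<in> {2..y}. d dvd n} \<union> {d. d dvd n \<and> d > y})" using fin by auto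
    ultimately show ?thesis using assms by (subst sum.insert) auto
  qed
  finally have "real (divisor_sum n) = n * (1 + (trunc_abundancy y n + abundancy_tail y n))" .
  moreover have "real (divisor_sum n) = sum_proper_divisors n + n"
    using divisor_sum_eq[OF assms(1)] by simp
  ultimately show ?thesis by (simp add: algebra_simps)
qed

lemma trunc_abundancy_mod: "trunc_abundancy y (n mod fact y) = trunc_abundancy y n"
proof -
  have "d dvd n mod fact y \<longleftrightarrow> d dvd n" if "d \<in> {2..y}" for d
    using that by (intro dvd_mod_iff dvd_fact) auto
  then show ?thesis unfolding trunc_abundancy_def by (intro sum.cong) auto
qed

lemma trunc_abundancy_ge:
  fixes p D :: nat
  assumes "p dvd n" "2 \<le> p" "p \<le> D" "D \<le> y"
  shows "trunc_abundancy y n \<ge> 1 / D"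
proof -
  have "1 / real D \<le> 1 / real p" using assms by (intro frac_le) auto
  also have "\<dots> = (if p dvd n then 1 / real p else 0)" using assms by simp
  also have "\<dots> \<le> trunc_abundancy y n"
    unfolding trunc_abundancy_def by (rule member_le_sum) (use assms in auto)
  finally show ?thesis .
qed

text \<open>Markov's inequality: on average over \<open>n \<le> N\<close> the tail is at most the
  sum of \<open>1 / d\<^sup>2\<close> over \<open>d > y\<close>, hence at most
  \<open>1 / y\<close>.\<close>

lemma upper_density_abundancy_tail:
  assumes "y > 0" "\<delta> > 0" "1 / (\<delta> * y) < e"
  shows "upper_density_le {n. abundancy_tail y n > \<delta>} e"
proof (rule upper_density_le_affine[where a = "1 / (\<delta> * y)" and b = 0])
  fix N
  define B where "B = {n. abundancy_tail y n > \<delta>} \<inter> {1..N}"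
  have "\<delta> * card B = (\<Sum>n\<in>B. \<delta>)" by simp
  also have "\<dots> \<le> (\<Sum>n\<in>B. abundancy_tail y n)" by (rule sum_mono) (auto simp: B_def)
  also have "\<dots> \<le> (\<Sum>n=1..N. abundancy_tail y n)"
    by (rule sum_mono2) (auto simp: B_def abundancy_tail_nonneg)
  also have "\<dots> = (\<Sum>n=1..N. \<Sum>d | d dvd n. if d > y then 1 / real d else 0)"
  proof (rule sum.cong[OF refl])
    fix n assume "n \<in> {1..N}"
    then have "finite {d. d dvd n}" by simp
    then show "abundancy_tail y n = (\<Sum>d | d dvd n. if d > y then 1 / real d else 0)"
      unfolding abundancy_tail_def by (simp add: sum.inter_filter[symmetric])
  qed
  also have "\<dots> = (\<Sum>d=1..N. \<Sum>m=1..N div d. if d > y then 1 / real d else 0)"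
    by (rule sum_divisors_swap)
  also have "\<dots> \<le> (\<Sum>d=1..N. if d > y then N * (1 / (real d)\<^sup>2) else 0)"
  proof (rule sum_mono)
    fix d assume d: "d \<in> {1..N}"
    have "real (N div d) * (1 / real d) \<le> (real N / d) * (1 / real d)"
      by (intro mult_right_mono of_nat_div_le_of_nat) auto
    then show "(\<Sum>m=1..N div d. if d > y then 1 / real d else 0) \<le> (if d > y then N * (1 / (real d)\<^sup>2) else 0)"
      by (simp add: power2_eq_square)
  qed
  also have "\<dots> = (\<Sum>d | d \<in> {1..N} \<and> d > y. N * (1 / (real d)\<^sup>2))"
    by (subst sum.inter_filter) auto
  also have "\<dots> = N * (\<Sum>d | d \<in> {1..N} \<and> d > y. 1 / (real d)\<^sup>2)" by (rule sum_distrib_left[symmetric])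
  also have "\<dots> \<le> N * (1 / y)"
    using assms by (intro mult_left_mono sum_inverse_squares_le) auto
  finally show "card ({n. abundancy_tail y n > \<delta>} \<inter> {1..N}) \<le> 1 / (\<delta> * y) * real N + 0"
    using assms unfolding B_def by (simp add: field_simps)
qed (use assms in auto)

section \<open>Counting the integers with a given leading block\<close>

lemma linear_le_exponential:
  fixes \<eta> :: real
  assumes "\<eta> > 0"
  shows "\<exists>c\<ge>0. \<forall>j. real j + 1 \<le> \<eta> * 2 ^ j + c"
proof -
  have "(\<lambda>n. real n * (1/2) ^ n) \<longlonglongrightarrow> 0" by (rule powser_times_n_limit_0) simp
  then have "\<forall>\<^sub>F n in sequentially. real n * (1/2) ^ n < \<eta>" using assms by (simp add: order_tendsto_iff)
  then obtain j0 where j0: "\<And>j. j \<ge> j0 \<Longrightarrow> real j * (1/2) ^ j < \<eta>" by (auto simp: eventually_sequentially)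
  have "real j + 1 \<le> \<eta> * 2 ^ j + (real j0 + 1)" for j
  proof (cases "j \<ge> j0")
    case True
    then have "real j \<le> \<eta> * 2 ^ j" using j0[OF True] by (simp add: field_simps power_divide)
    then show ?thesis by simp
  next
    case False
    then have "real j + 1 \<le> 0 + (real j0 + 1)" by simp
    also have "\<dots> \<le> \<eta> * 2 ^ j + (real j0 + 1)" using assms by (intro add_right_mono) simp
    finally show ?thesis .
  qed
  then show ?thesis by (intro exI[of _ "real j0 + 1"]) simp
qed

text \<open>The interval lengths at the scales \<open>g ^ j\<close> are dominated by the largest
  one. The number of scales is logarithmic in \<open>X\<close>; it is stated as a small multiple of
  \<open>X\<close> plus a constant, because each scale costs a bounded counting error that must fit
  an affine bound.\<close>

lemma geometric_scales:
  fixes X c \<eta> b :: real and g :: nat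
  assumes g: "g \<ge> 2" and c: "c \<ge> 1" and X: "X \<ge> 0"
    and b: "\<eta> \<ge> 0" "b \<ge> 0" "\<And>j. real j + 1 \<le> \<eta> * 2 ^ j + b"
  defines "J \<equiv> {j. c * real g ^ j \<le> X}"
  shows "finite J" "(\<Sum>j\<in>J. real g ^ j) \<le> 2 * X / c" "card J \<le> \<eta> * X + b"
proof -
  have "J \<subseteq> {..nat \<lfloor>X\<rfloor>}"
  proof
    fix j assume "j \<in> J"
    have "real j \<le> 2 ^ j" by (rule less_imp_le, rule of_nat_less_two_power)
    also have "\<dots> \<le> real g ^ j" using g by (intro power_mono) auto
    also have "\<dots> \<le> c * real g ^ j" using c by (simp add: mult_le_cancel_right1)
    also have "\<dots> \<le> X" using \<open>j \<in> J\<close> by (simp add: J_def)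
    finally show "j \<in> {..nat \<lfloor>X\<rfloor>}" by (simp add: le_nat_floor)
  qed
  then show fin: "finite J" using finite_subset by blast
  have "(\<Sum>j\<in>J. real g ^ j) \<le> 2 * X / c \<and> card J \<le> \<eta> * X + b"
  proof (cases "J = {}")
    case False
    define m where "m = Max J"
    have m: "c * real g ^ m \<le> X" using Max_in[OF fin False] by (simp add: J_def m_def)
    have sub: "J \<subseteq> {..m}" using fin by (auto simp: m_def)
    have "(\<Sum>j\<le>k. real g ^ j) \<le> 2 * real g ^ k" for k
    proof (induction k)
      case (Suc k)
      have "2 * real g ^ k \<le> real g ^ Suc k" using g by simp
      then show ?case using Suc by simp
    qed simp
    moreover have "(\<Sum>j\<in>J. real g ^ j) \<le> (\<Sum>j\<le>m. real g ^ j)" by (rule sum_mono2) (use sub in auto)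
    ultimately have "(\<Sum>j\<in>J. real g ^ j) \<le> 2 * real g ^ m" by (meson order_trans)
    also have "\<dots> \<le> 2 * X / c" using m c by (simp add: field_simps)
    finally have 1: "(\<Sum>j\<in>J. real g ^ j) \<le> 2 * X / c" .
    have "card J \<le> card {..m}" by (rule card_mono[OF _ sub]) simp
    then have "real (card J) \<le> real m + 1" by simp
    also have "\<dots> \<le> \<eta> * 2 ^ m + b" by (rule b(3))
    also have "\<dots> \<le> \<eta> * X + b"
    proof -
      have "2 ^ m \<le> real g ^ m" using g by (intro power_mono) auto
      also have "\<dots> \<le> c * real g ^ m" using c by (simp add: mult_le_cancel_right1)
      finally have "2 ^ m \<le> X" using m by linarith
      then show ?thesis using b(1) by (simp add: mult_left_mono)
    qed
    finally show ?thesis using 1 by simp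
  qed (use X b c in auto)
  then show "(\<Sum>j\<in>J. real g ^ j) \<le> 2 * X / c" "card J \<le> \<eta> * X + b" by auto
qed

lemma exists_leading_block:
  fixes s :: nat
  assumes g: "g \<ge> 2" and s: "s \<ge> g ^ K"
  obtains j where "s div g ^ j \<ge> g ^ K" "s div g ^ j < g ^ Suc K"
proof -
  define P where "P j \<longleftrightarrow> s div g ^ j < g ^ Suc K" for j
  have "s < 2 ^ s" by (rule less_exp)
  also have "\<dots> \<le> g ^ s" using g by (intro power_mono) auto
  finally have "P s" using g by (simp add: P_def)
  define j where "j = (LEAST j. P j)"
  have j: "P j" unfolding j_def by (rule LeastI[of P, OF \<open>P s\<close>])
  moreover have "s div g ^ j \<ge> g ^ K"
  proof (cases j)
    case (Suc i)
    then have "\<not> P i" unfolding j_def using not_less_Least by (metis lessI)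
    then have "g * g ^ K \<le> s div g ^ i" by (simp add: P_def)
    then have "g ^ K \<le> s div g ^ i div g" using g by (simp add: less_eq_div_iff_mult_less_eq mult.commute)
    then show ?thesis by (simp add: Suc div_mult2_eq[symmetric] mult.commute)
  qed (use s in simp)
  ultimately show ?thesis using that by (simp add: P_def)
qed

text \<open>As \<open>s n / n\<close> is almost the constant \<open>h\<close> on \<open>A\<close>, the condition \<open>a g\<^sup>j \<le> s n < (a + 1) g\<^sup>j\<close>
  confines \<open>n\<close> to an interval of length \<open>2 g\<^sup>j / h\<close>, that is to about \<open>2 g\<^sup>j / (h Q)\<close> members of the
  residue class.\<close>
lemma upper_density_leading_block_class:
  fixes h \<delta> e :: real and s :: "nat \<Rightarrow> nat" and g Q K r :: nat and A :: "nat set"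
  assumes g: "g \<ge> 2" and Q: "Q > 0" and h: "h > 0" and e: "e > 0"
    and \<delta>: "\<delta> > 0" "\<delta> * g ^ Suc K \<le> h"
    and A: "\<And>n. n \<in> A \<Longrightarrow> n mod Q = r \<and> n * h \<le> s n \<and> s n \<le> n * (h + \<delta>)
      \<and> (\<exists>j. s n div g ^ j \<in> deficient g (Suc K) \<and> s n div g ^ j \<ge> g ^ K)"
  shows "upper_density_le A ((8 * real (card (deficient g (Suc K))) / real g ^ K + e) / real Q)"
proof -
  define B where "B = card (deficient g (Suc K))"
  \<comment> \<open>Chosen so that the counting errors over all scales,
    \<open>real B * \<eta> * 2 * h\<close> per integer, amount to \<open>B / (2 * (B + 1))\<close>
    times \<open>e / Q\<close>; the \<open>+ 1\<close> covers \<open>B = 0\<close>.\<close>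
  define \<eta> where "\<eta> = e / (4 * (Q * (real B + 1) * h))"
  have "\<eta> > 0" unfolding \<eta>_def using e Q h by (intro divide_pos_pos mult_pos_pos) (auto intro: add_nonneg_pos)
  obtain b where b: "b \<ge> 0" "\<And>j. real j + 1 \<le> \<eta> * 2 ^ j + b"
    using linear_le_exponential[OF \<open>\<eta> > 0\<close>] by blast
  have gK: "real g ^ K \<ge> 1" using g by simp
  have "real (g ^ Suc K) \<ge> 1" using g unfolding of_nat_power by (intro one_le_power) auto
  then have "\<delta> * 1 \<le> \<delta> * real (g ^ Suc K)" using \<delta>(1) by (intro mult_left_mono) auto
  also have "\<dots> \<le> h" by (rule \<delta>(2))
  finally have "\<delta> \<le> h" by simp
  show ?thesis
    unfolding B_def[symmetric]
  proof (rule upper_density_le_affine[where a = "8 * real B / (real Q * real g ^ K) + real B * \<eta> * 2 * h" and b = "B * b"])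
    fix N :: nat
    \<comment> \<open>An upper bound for \<open>s n\<close> when \<open>n \<le> N\<close>, as
      \<open>\<delta> \<le> h\<close>.\<close>
    define X where "X = 2 * h * N"
    define J where "J = {j. real g ^ K * real g ^ j \<le> X}"
    define I where "I a j = {n::nat. (real a - 1) * g ^ j / h \<le> n \<and> n \<le> (real a + 1) * g ^ j / h \<and> n mod Q = r}" for a j
    have X: "X \<ge> 0" using h by (simp add: X_def)
    note J = geometric_scales[OF g gK X less_imp_le[OF \<open>\<eta> > 0\<close>] b, folded J_def]
    have le: "(real a - 1) * g ^ j / h \<le> (real a + 1) * g ^ j / h" for a j
      using h by (intro divide_right_mono mult_right_mono) auto
    have sub: "A \<inter> {1..N} \<subseteq> (\<Union>j\<in>J. \<Union>a\<in>deficient g (Suc K). I a j)"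
    proof
      fix n assume n: "n \<in> A \<inter> {1..N}"
      then obtain j where j: "s n div g ^ j \<in> deficient g (Suc K)" "s n div g ^ j \<ge> g ^ K" using A by blast
      define a where "a = s n div g ^ j"
      have nA: "n mod Q = r" "n * h \<le> s n" "s n \<le> n * (h + \<delta>)" using A[of n] n by auto
      have "a * g ^ j \<le> s n" unfolding a_def by (rule div_times_less_eq_dividend)
      then have 1: "real a * real g ^ j \<le> s n" by (metis of_nat_le_iff of_nat_mult of_nat_power)
      have "s n < (a + 1) * g ^ j" unfolding a_def using g
        by (metis Suc_eq_plus1 dividend_less_div_times less_le_trans mult_Suc zero_less_power pos2)
      then have "real (s n) < real ((a + 1) * g ^ j)" by (simp only: of_nat_less_iff)
      then have 2: "real (s n) < (real a + 1) * real g ^ j"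
        by (simp only: of_nat_mult of_nat_add of_nat_1 of_nat_power)
      have "real (g ^ K) \<le> real a" using j(2) unfolding a_def by (simp only: of_nat_le_iff)
      then have "real g ^ K * real g ^ j \<le> real a * real g ^ j" by (intro mult_right_mono) auto
      also have "\<dots> \<le> n * (h + \<delta>)" using 1 nA by linarith
      also have "\<dots> \<le> N * (h + h)" using n \<open>\<delta> \<le> h\<close> h \<delta> by (intro mult_mono) auto
      finally have jJ: "j \<in> J" by (simp add: J_def X_def mult_ac)
      have up: "n * h \<le> (real a + 1) * real g ^ j" using nA 2 by linarith
      have "a < g ^ Suc K" using j(1) by (simp add: deficient_def a_def)
      then have "real (a + 1) \<le> real (g ^ Suc K)" by (simp only: of_nat_le_iff)
      then have a1: "real a + 1 \<le> real g ^ Suc K"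
        by (simp only: of_nat_add of_nat_1 of_nat_power)
      \<comment> \<open>This is where the relative accuracy of \<open>\<delta>\<close> is used: the
        error \<open>n * \<delta>\<close> is at most one block unit \<open>g ^ j\<close>, so the
        lower end of the interval moves only from \<open>a\<close> to \<open>a - 1\<close>.\<close>
      have "n * \<delta> * real g ^ Suc K \<le> n * h"
        using mult_left_mono[OF \<delta>(2), of "real n"] by (simp only: mult.assoc of_nat_power of_nat_0_le_iff)
      also have "\<dots> \<le> real g ^ Suc K * real g ^ j"
        by (rule order_trans[OF up mult_right_mono[OF a1]]) simp
      finally have "real g ^ Suc K * (n * \<delta>) \<le> real g ^ Suc K * real g ^ j" by (simp only: mult.commute)
      moreover have "real g ^ Suc K > 0" using g by (intro zero_less_power) auto
      ultimately have "n * \<delta> \<le> real g ^ j" by (simp only: mult_le_cancel_left_pos)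
      then have low: "(real a - 1) * real g ^ j \<le> n * h"
        using 1 nA(3) by (simp add: algebra_simps)
      have "n \<in> I a j" unfolding I_def using up low h nA(1) by (simp add: field_simps)
      then show "n \<in> (\<Union>j\<in>J. \<Union>a\<in>deficient g (Suc K). I a j)"
        using jJ j(1) unfolding a_def by blast
    qed
    have finI: "finite (I a j)" and cardI: "card (I a j) \<le> 2 * g ^ j / (h * Q) + 1" for a j
    proof -
      show "finite (I a j)" unfolding I_def by (rule card_residue_interval_le(1)[OF Q le])
      have "card (I a j) \<le> ((real a + 1) * g ^ j / h - (real a - 1) * g ^ j / h) / Q + 1"
        unfolding I_def by (rule card_residue_interval_le(2)[OF Q le])
      also have "(real a + 1) * g ^ j / h - (real a - 1) * g ^ j / h = 2 * g ^ j / h"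
        by (simp add: diff_divide_distrib[symmetric] algebra_simps)
      finally show "card (I a j) \<le> 2 * g ^ j / (h * Q) + 1" by simp
    qed
    have "card (A \<inter> {1..N}) \<le> card (\<Union>j\<in>J. \<Union>a\<in>deficient g (Suc K). I a j)"
      by (rule card_mono[OF _ sub]) (use J(1) finI in auto)
    also have "\<dots> \<le> (\<Sum>j\<in>J. card (\<Union>a\<in>deficient g (Suc K). I a j))" by (rule card_UN_le[OF J(1)])
    also have "\<dots> \<le> (\<Sum>j\<in>J. \<Sum>a\<in>deficient g (Suc K). card (I a j))"
      by (intro sum_mono card_UN_le) simp
    finally have "real (card (A \<inter> {1..N})) \<le> real (\<Sum>j\<in>J. \<Sum>a\<in>deficient g (Suc K). card (I a j))"
      by (simp only: of_nat_le_iff)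
    also have "\<dots> \<le> (\<Sum>j\<in>J. \<Sum>a\<in>deficient g (Suc K). 2 * g ^ j / (h * Q) + 1)"
      unfolding of_nat_sum by (intro sum_mono cardI)
    also have "\<dots> = (\<Sum>j\<in>J. B * (2 / (h * Q)) * real g ^ j + B)"
      by (simp add: B_def algebra_simps)
    also have "\<dots> = B * (2 / (h * Q)) * (\<Sum>j\<in>J. real g ^ j) + B * card J"
      by (simp add: sum.distrib sum_distrib_left)
    \<comment> \<open>The constant 8 collects three factors 2: the interval length, the geometric
      sum, and \<open>X = 2 * h * N\<close>.\<close>
    also have "\<dots> \<le> B * (2 / (h * Q)) * (2 * X / real g ^ K) + B * (\<eta> * X + b)"
      using J(2,3) h by (intro add_mono mult_left_mono) (auto intro!: mult_left_mono)
    also have "\<dots> = (8 * real B / (real Q * real g ^ K) + real B * \<eta> * 2 * h) * N + B * b"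
      using h Q by (simp add: X_def field_simps)
    finally show "card (A \<inter> {1..N}) \<le> (8 * real B / (real Q * real g ^ K) + real B * \<eta> * 2 * h) * real N + B * b" .
  next
    have "real B * \<eta> * 2 * h = (real B / (2 * (real B + 1))) * (e / Q)"
      using h Q by (simp add: \<eta>_def divide_simps)
    also have "\<dots> < 1 * (e / Q)" using e Q by (intro mult_strict_right_mono) (auto simp: field_simps)
    finally show "8 * real B / (real Q * real g ^ K) + real B * \<eta> * 2 * h < (8 * real B / real g ^ K + e) / real Q"
      by (simp add: add_divide_distrib mult.commute)
  qed
qed

lemma upper_density_first_digits:
  assumes g: "g \<ge> 2" and e: "e > 0"
  shows "\<exists>K. upper_density_le {n. \<not> {0..<g} \<subseteq> set (first_digits g K (sum_proper_divisors n))} e"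
proof -
  \<comment> \<open>The proportion is relative to \<open>g ^ Suc K\<close> but will be divided by
    \<open>g ^ K\<close>, and \<open>8 * g * (e / (40 * g)) = e / 5\<close>.\<close>
  have e': "e / 5 > 0" "e / (40 * g) > 0" using e g by auto
  obtain K where K: "real (card (deficient g (Suc K))) / real g ^ Suc K < e / (40 * g)"
    using deficient_proportion_small[OF g e'(2)] .
  define B where "B = card (deficient g (Suc K))"
  have B: "8 * real B / real g ^ K < e / 5"
    using K g by (simp add: B_def field_simps)
  obtain D where D: "D > 0" "upper_density_le {n. \<not> (\<exists>p\<le>D. prime p \<and> p dvd n)} (e / 5)"
    using upper_density_no_small_prime_factor[OF e'(1)] .
  \<comment> \<open>A prime factor up to \<open>D\<close> gives \<open>h \<ge> 1 / D\<close>, and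
    \<open>\<delta>\<close> is the largest error that this bound allows in
    \<open>upper_density_leading_block_class\<close>.\<close>
  define \<delta> where "\<delta> = 1 / (D * real g ^ Suc K)"
  have \<delta>: "\<delta> > 0" using D g by (simp add: \<delta>_def)
  obtain y0 :: nat where y0: "real y0 > 5 / (\<delta> * e)" using reals_Archimedean2 by blast
  \<comment> \<open>The part \<open>y0\<close> makes the tail rare; adding \<open>D\<close> makes
    the truncated sum see every prime up to \<open>D\<close>.\<close>
  define y where "y = y0 + D"
  have y: "y > 0" "D \<le> y" "1 / (\<delta> * y) < e / 5"
  proof -
    show "y > 0" "D \<le> y" using D by (auto simp: y_def)
    have "real y > 5 / (\<delta> * e)" using y0 by (simp add: y_def)
    then show "1 / (\<delta> * y) < e / 5" using \<delta> e \<open>y > 0\<close> by (simp add: field_simps)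
  qed
  have tail: "upper_density_le {n. abundancy_tail y n > \<delta>} (e / 5)"
    by (rule upper_density_abundancy_tail[OF y(1) \<delta> y(3)])
  define Q :: nat where "Q = fact y"
  have Q: "Q > 0" by (simp add: Q_def)
  define s where "s = sum_proper_divisors"
  define A where "A r = {n. n > 0 \<and> n mod Q = r \<and> trunc_abundancy y n \<ge> 1 / D \<and> abundancy_tail y n \<le> \<delta>
     \<and> (\<exists>j. s n div g ^ j \<in> deficient g (Suc K) \<and> s n div g ^ j \<ge> g ^ K)}" for r
  \<comment> \<open>Each class has its own \<open>h\<close>, but the bound carries the factor
    \<open>1 / Q\<close> and does not depend on \<open>h\<close>, so the \<open>Q\<close> classes
    add up to a bound free of \<open>Q\<close>.\<close>
  have "upper_density_le (\<Union>r<Q. A r) (\<Sum>r<Q. (8 * real B / real g ^ K + e / 5) / real Q)"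
  proof (rule upper_density_le_UN)
    fix r assume "r \<in> {..<Q}"
    show "upper_density_le (A r) ((8 * real B / real g ^ K + e / 5) / real Q)"
    proof (cases "A r = {}")
      case True
      then show ?thesis using e by (simp add: upper_density_le_def)
    next
      case False
      define h where "h = trunc_abundancy y r"
      have h_eq: "trunc_abundancy y n = h" if "n \<in> A r" for n
        using that trunc_abundancy_mod[of y n] by (auto simp: A_def h_def Q_def)
      then have hD: "h \<ge> 1 / D" using False by (force simp: A_def)
      moreover have "1 / real D > 0" using D by simp
      ultimately have h: "h > 0" by linarith
      have "\<delta> * g ^ Suc K = 1 / D" using g by (simp add: \<delta>_def)
      then have \<delta>h: "\<delta> * g ^ Suc K \<le> h" using hD by simp
      have "n mod Q = r \<and> n * h \<le> s n \<and> s n \<le> n * (h + \<delta>)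
        \<and> (\<exists>j. s n div g ^ j \<in> deficient g (Suc K) \<and> s n div g ^ j \<ge> g ^ K)" if n: "n \<in> A r" for n
      proof -
        have "real (s n) = n * (h + abundancy_tail y n)"
          using sum_proper_divisors_eq_abundancy[of n y] n y(1) h_eq[OF n] by (simp add: s_def A_def)
        moreover have "n * (h + abundancy_tail y n) \<le> n * (h + \<delta>)"
          using n by (intro mult_left_mono) (auto simp: A_def)
        moreover have "n * h \<le> n * (h + abundancy_tail y n)"
          using abundancy_tail_nonneg[of y n] by (intro mult_left_mono) auto
        ultimately show ?thesis using n by (auto simp: A_def)
      qed
      then show ?thesis
        unfolding B_def by (intro upper_density_leading_block_class[OF g Q h e'(1) \<delta> \<delta>h])
    qed
  qed simp
  moreover have "(\<Sum>r<Q. (8 * real B / real g ^ K + e / 5) / real Q) = 8 * real B / real g ^ K + e / 5" using Q by simp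
  ultimately have "upper_density_le (\<Union>r<Q. A r) (8 * real B / real g ^ K + e / 5)" by (simp only:)
  then have main: "upper_density_le (\<Union>r<Q. A r) (e / 5 + e / 5)"
    by (rule upper_density_le_mono) (use B in auto)
  have small: "upper_density_le {..<D * g ^ K} (e / 5)"
    using e by (intro upper_density_le_finite) auto
  have "upper_density_le (({n. \<not> (\<exists>p\<le>D. prime p \<and> p dvd n)} \<union> {n. abundancy_tail y n > \<delta>}) \<union>
      ({..<D * g ^ K} \<union> (\<Union>r<Q. A r))) ((e / 5 + e / 5) + (e / 5 + (e / 5 + e / 5)))"
    by (intro upper_density_le_Un D(2) tail small main)
  then have "upper_density_le {n. \<not> {0..<g} \<subseteq> set (first_digits g (Suc K) (sum_proper_divisors n))} e"
  proof (rule upper_density_le_mono)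
    show "{n. \<not> {0..<g} \<subseteq> set (first_digits g (Suc K) (sum_proper_divisors n))} \<inter> {1..} \<subseteq>
      ({n. \<not> (\<exists>p\<le>D. prime p \<and> p dvd n)} \<union> {n. abundancy_tail y n > \<delta>}) \<union>
      ({..<D * g ^ K} \<union> (\<Union>r<Q. A r))"
    proof (intro subsetI, rule ccontr)
      fix n assume n1: "n \<in> {n. \<not> {0..<g} \<subseteq> set (first_digits g (Suc K) (sum_proper_divisors n))} \<inter> {1..}"
        and n2: "n \<notin> ({n. \<not> (\<exists>p\<le>D. prime p \<and> p dvd n)} \<union> {n. abundancy_tail y n > \<delta>}) \<union>
          ({..<D * g ^ K} \<union> (\<Union>r<Q. A r))"
      have n: "n > 0" "\<not> {0..<g} \<subseteq> set (first_digits g (Suc K) (s n))" using n1 by (auto simp: s_def)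
      have big: "D * g ^ K \<le> n" and nA: "n \<notin> A (n mod Q)" and T: "abundancy_tail y n \<le> \<delta>"
        using n2 Q by auto
      obtain p where p: "p \<le> D" "prime p" "p dvd n" using n2 by auto
      have h: "trunc_abundancy y n \<ge> 1 / D"
        by (rule trunc_abundancy_ge[OF p(3) prime_ge_2_nat[OF p(2)] p(1) y(2)])
      have "g ^ K \<le> n div D" using big D(1) by (simp add: less_eq_div_iff_mult_less_eq mult.commute)
      also have "\<dots> \<le> s n" unfolding s_def by (rule sum_proper_divisors_ge) (use p n in auto)
      finally obtain j where j: "s n div g ^ j \<ge> g ^ K" "s n div g ^ j < g ^ Suc K"
        using exists_leading_block[OF g] by blast
      have "s n div g ^ j \<in> deficient g (Suc K)"
        using n(2) j unfolding set_first_digits[OF g j] by (simp add: deficient_def)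
      then have "n \<in> A (n mod Q)" using n(1) h T j(1) by (auto simp: A_def)
      then show False using nA by simp
    qed
  qed simp
  then show ?thesis by blast
qed

section \<open>Passage from a fixed number of digits to \<open>k(x)\<close>\<close>

lemma density_one_of_scale:
  fixes k :: "real \<Rightarrow> nat" and G :: "nat \<Rightarrow> nat \<Rightarrow> bool"
  assumes k: "filterlim k at_top at_top"
    and mono: "\<And>K K' n. K \<le> K' \<Longrightarrow> G K n \<Longrightarrow> G K' n"
    and dens: "\<And>e. e > 0 \<Longrightarrow> \<exists>K. upper_density_le {n. \<not> G K n} e"
  shows "(\<lambda>x::real. real (card {n::nat. 0 < n \<and> real n \<le> x \<and> G (k x) n})) \<sim>[at_top] (\<lambda>x. x)"
proof (rule asymp_equivI')
  show "((\<lambda>x. real (card {n::nat. 0 < n \<and> real n \<le> x \<and> G (k x) n}) / x) \<longlongrightarrow> 1) at_top"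
  proof (rule tendstoI)
    fix e :: real assume "e > 0"
    then have "e / 2 > 0" by simp
    then obtain K where "upper_density_le {n. \<not> G K n} (e / 2)" using dens by blast
    then have "\<forall>\<^sub>F N in sequentially. real (card ({n. \<not> G K n} \<inter> {1..N})) \<le> e / 2 * real N"
      by (simp add: upper_density_le_def)
    moreover have "filterlim (\<lambda>x::real. nat \<lfloor>x\<rfloor>) sequentially at_top"
      by (rule filterlim_compose[OF filterlim_nat_sequentially filterlim_floor_sequentially])
    ultimately have 1: "\<forall>\<^sub>F x in at_top. real (card ({n. \<not> G K n} \<inter> {1..nat \<lfloor>x\<rfloor>})) \<le> e / 2 * real (nat \<lfloor>x::real\<rfloor>)"
      by (rule eventually_compose_filterlim)
    have 2: "\<forall>\<^sub>F x in at_top. k x \<ge> K" using k by (simp add: filterlim_at_top)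
    \<comment> \<open>Rounding \<open>x\<close> down loses less than 1, which is below
      \<open>e / 2 * x\<close> once \<open>x > 2 / e\<close>.\<close>
    have 3: "\<forall>\<^sub>F x::real in at_top. x > max 1 (2 / e)" by (rule eventually_gt_at_top)
    show "\<forall>\<^sub>F x in at_top. dist (real (card {n::nat. 0 < n \<and> real n \<le> x \<and> G (k x) n}) / x) 1 < e"
      using 1 2 3
    proof eventually_elim
      case (elim x)
      define N where "N = nat \<lfloor>x\<rfloor>"
      define A where "A = {n::nat. 0 < n \<and> real n \<le> x \<and> G (k x) n}"
      have x: "x > 1" "x > 2 / e" using elim by auto
      have N: "real N \<le> x" "x < real N + 1" using x by (auto simp: N_def)
      have A: "A \<subseteq> {1..N}" using x by (auto simp: A_def N_def le_nat_floor)
      then have "card A \<le> card {1..N}" by (rule card_mono[rotated]) simp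
      then have up: "real (card A) \<le> x" using N by simp
      have "{1..N} \<subseteq> A \<union> ({n. \<not> G K n} \<inter> {1..N})"
        using mono[OF elim(2)] N by (auto simp: A_def)
      then have "card {1..N} \<le> card (A \<union> ({n. \<not> G K n} \<inter> {1..N}))"
        by (rule card_mono[rotated]) (use A finite_subset in auto)
      also have "\<dots> \<le> card A + card ({n. \<not> G K n} \<inter> {1..N})" by (rule card_Un_le)
      finally have "real N \<le> real (card A) + real (card ({n. \<not> G K n} \<inter> {1..N}))" by simp
      also have "\<dots> \<le> real (card A) + e / 2 * N" using elim(1) by (simp add: N_def)
      also have "\<dots> \<le> real (card A) + e / 2 * x" using N \<open>e > 0\<close> by simp
      finally have "x - 1 - e / 2 * x \<le> real (card A)" using N by linarith
      moreover have "1 < e / 2 * x" using x \<open>e > 0\<close> by (simp add: field_simps)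
      ultimately have "x - e * x < real (card A)" by simp
      then have "1 - e < real (card A) / x" using x by (simp add: field_simps)
      moreover have "real (card A) / x \<le> 1" using up x by simp
      ultimately show ?case unfolding A_def[symmetric] using \<open>e > 0\<close> by (simp add: dist_real_def)
    qed
  qed
qed

theorem theorem1p1:
  fixes g :: nat and k :: "real \<Rightarrow> nat"
  assumes "g \<ge> 2"
    and "\<And>x. k x > 0"
    and "filterlim k at_top at_top"
  shows "(\<lambda>x::real. real (card {n::nat. 0 < n \<and> real n \<le> x \<and>
            {0..<g} \<subseteq> set (last_digits g (k x) (sum_proper_divisors n))})) \<sim>[at_top] (\<lambda>x. x)
       \<and> (\<lambda>x::real. real (card {n::nat. 0 < n \<and> real n \<le> x \<and>
            {0..<g} \<subseteq> set (first_digits g (k x) (sum_proper_divisors n))})) \<sim>[at_top] (\<lambda>x. x)"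
proof (rule conjI)
  have last_mono: "set (last_digits g K m) \<subseteq> set (last_digits g K' m)" if "K \<le> K'" for K K' m
    unfolding last_digits_def using that by (intro set_drop_subset_set_drop) simp
  have first_mono: "set (first_digits g K m) \<subseteq> set (first_digits g K' m)" if "K \<le> K'" for K K' m
    unfolding first_digits_def by (rule set_take_subset_set_take[OF that])
  show "(\<lambda>x::real. real (card {n::nat. 0 < n \<and> real n \<le> x \<and>
            {0..<g} \<subseteq> set (last_digits g (k x) (sum_proper_divisors n))})) \<sim>[at_top] (\<lambda>x. x)"
    by (rule density_one_of_scale[OF assms(3)])
       (use last_mono upper_density_last_digits[OF assms(1)] in blast)+
  show "(\<lambda>x::real. real (card {n::nat. 0 < n \<and> real n \<le> x \<and>
            {0..<g} \<subseteq> set (first_digits g (k x) (sum_proper_divisors n))})) \<sim>[at_top] (\<lambda>x. x)"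
    by (rule density_one_of_scale[OF assms(3)])
       (use first_mono upper_density_first_digits[OF assms(1)] in blast)+
qed

end
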